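(* Let $k>4$ be an integer. Every graph $G$ that contains no induced $P_k$, is not $C_{k-2}$-colorable, and is minimal with respect to the induced-subgraph relation among such graphs (i.e. every proper induced subgraph of $G$ is $C_{k-2}$-colorable), has at most $3k+28$ vertices.
   Context: All graphs are finite and simple. $P_k$ is the path on $k$ vertices and $C_{k-2}$ the cycle on $k-2$ vertices. A graph $G$ is $C_{k-2}$-colorable if there is a map $\varphi:V(G)\to V(C_{k-2})$ such that $\varphi(u)\varphi(v)$ is an edge of $C_{k-2}$ for every edge $uv$ of $G$. *)

theory Defs
  imports "Graph_Theory.Digraph_Isomorphism" "Graph_Theory.Pair_Digraph"
begin

text \<open>
  Finite simple graphs are rendered by the locale \<^locale>\<open>pair_graph\<close>: finite, loop-free digraphs
  whose arc set is a symmetric relation on the vertices, an undirected edge \<open>uv\<close> being the pair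
  of arcs \<open>(u, v)\<close> and \<open>(v, u)\<close>.
\<close>

definition path_graph :: "nat \<Rightarrow> nat pair_pre_digraph" where
  "path_graph n =
     \<lparr> pverts = {..<n},
       parcs = {(i, j). i < n \<and> j < n \<and> (j = i + 1 \<or> i = j + 1)} \<rparr>"

text \<open>The cycle is only meaningful for \<open>n \<ge> 3\<close>; for \<open>n = 1\<close> the definition gives a loop.\<close>

definition cycle_graph :: "nat \<Rightarrow> nat pair_pre_digraph" where
  "cycle_graph n =
     \<lparr> pverts = {..<n},
       parcs = {(i, j). i < n \<and> j < n \<and> (j = (i + 1) mod n \<or> i = (j + 1) mod n)} \<rparr>"

lemma pair_graph_path_graph: "pair_graph (path_graph n)"
proof -
  have "finite (parcs (path_graph n))"
    by (rule finite_subset[of _ "{..<n} \<times> {..<n}"]) (auto simp: path_graph_def)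
  then show ?thesis
    by unfold_locales (auto simp: path_graph_def symmetric_def sym_def)
qed

lemma pair_graph_cycle_graph:
  assumes "n \<ge> 3"
  shows "pair_graph (cycle_graph n)"
proof -
  have fin: "finite (parcs (cycle_graph n))"
    by (rule finite_subset[of _ "{..<n} \<times> {..<n}"]) (auto simp: cycle_graph_def)
  have "Suc i mod n \<noteq> i" if "i < n" for i
    using that assms by (cases "Suc i = n") auto
  with fin show ?thesis
    by unfold_locales (auto simp: cycle_graph_def symmetric_def sym_def eq_commute[of _ "_ mod n"])
qed

definition contains_induced :: "'a pair_pre_digraph \<Rightarrow> 'b pair_pre_digraph \<Rightarrow> bool" where
  "contains_induced G F \<longleftrightarrow>
     (\<exists>H :: 'a pair_pre_digraph.
        induced_subgraph (with_proj H) (with_proj G) \<and> digraph_iso (with_proj F) (with_proj H))"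

definition colorable :: "'b pair_pre_digraph \<Rightarrow> 'a pair_pre_digraph \<Rightarrow> bool" where
  "colorable C G \<longleftrightarrow>
     (\<exists>\<phi>. \<phi> ` pverts G \<subseteq> pverts C \<and> (\<forall>(u, v) \<in> parcs G. (\<phi> u, \<phi> v) \<in> parcs C))"

end

theory Submission
  imports Defs
begin

text \<open>
  Suppose \<open>G\<close> has more than \<open>3k + 28\<close> vertices. By minimality every set of at most \<open>3k + 28\<close> vertices
  is colourable, so it suffices to colour \<open>G\<close> assuming this. Put \<open>q = k - 2\<close>. A shortest odd
  cycle of \<open>G\<close> is induced, has at most \<open>k\<close> vertices and is colourable, so \<open>q\<close> is odd and its length is
  \<open>q\<close> or \<open>k\<close>. In the second case \<open>G\<close> is a blown-up \<open>C\<^sub>k\<close>.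

  If \<open>q \<ge> 5\<close> and \<open>v\<close> is a \<open>q\<close>-cycle, its colouring is unique up to symmetry. A vertex attached to \<open>v\<close>
  sees either two vertices \<open>v (i - 1), v (i + 1)\<close>, and then has colour \<open>i\<close>, or a single vertex \<open>v i\<close>, and
  then has one of the colours \<open>i - 1\<close> (low) and \<open>i + 1\<close> (high). The vertices not attached to \<open>v\<close> impose only
  binary constraints on these. All constraints are either local or of the form ``if \<open>x\<close> is low then \<open>y\<close> is low'', so a
  conflict is a chain of such implications from a vertex that is forced to be low to one that is forced to
  be high. In a \<open>P\<^sub>k\<close>-free graph a shortest chain is short, so it lies in a colourable set.

  If \<open>q = 3\<close>, the same idea applies to an induced five-cycle (for each of its five colouring patterns) or,
  if there is none, to a dominating triangle. If the dominating clique is an edge, the two sides are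
  connected because there is no star cutset, and four local obstructions suffice.
\<close>

section \<open>Induced paths and odd cycles\<close>

text \<open>Once the cycle is coloured, the open choices form a 2-SAT instance. Low and high are
  oriented along the cycle so that every non-local clause leads from low to low. Its least solution,
  low exactly where a chain of implications forces it, is the natural colouring, and only a chain
  from a forced low vertex to a forced high one can break it. A forcing is certified by at most two
  further vertices. For q \<ge> 5 a shortest chain has at most q + 2 steps, so q vertices of the
  cycle, q + 3 of the chain, q + 2 common neighbours and 4 certificate vertices, in all 3q + 9 = 3k
  + 3, contradict local colourability. The bound has to cover k = 5 as well: five patterns of an
  induced five-cycle with obstructions of at most six vertices need 35 vertices, a dominating edge
  needs 2 + 4 * 8 = 34. Triangles are the obstacle there: a class of vertices with open colour may
  contain edges, and its two colours then alternate along components. Colours are integers read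
  modulo q, so that rotations and reflections are arithmetic.\<close>

lemma shortest_chain:
  assumes "R\<^sup>*\<^sup>* a b" "a \<in> A" "b \<in> B"
  obtains n and p :: "nat \<Rightarrow> 'a" where "p 0 \<in> A" "p n \<in> B"
    "\<And>i. i < n \<Longrightarrow> R (p i) (p (Suc i))"
    "\<And>i j. i < j \<Longrightarrow> j \<le> n \<Longrightarrow> R (p i) (p j) \<Longrightarrow> j = Suc i"
    "\<And>i. i \<le> n \<Longrightarrow> p i \<in> A \<Longrightarrow> i = 0"
    "\<And>i. i \<le> n \<Longrightarrow> p i \<in> B \<Longrightarrow> i = n"
    "inj_on p {..n}"
proof -
  define P where "P n p \<longleftrightarrow> p 0 \<in> A \<and> p n \<in> B \<and> (\<forall>i<n. R (p i) (p (Suc i)))"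
    for n and p :: "nat \<Rightarrow> 'a"
  obtain n0 where "(R ^^ n0) a b" using assms(1) rtranclp_imp_relpowp by metis
  then obtain p0 where "P n0 p0"
    using assms(2,3) unfolding relpowp_fun_conv P_def by metis
  define n where "n = (LEAST n. \<exists>p. P n p)"
  have "\<exists>p. P n p" unfolding n_def by (rule LeastI[of _ n0]) (use \<open>P n0 p0\<close> in blast)
  then obtain p where p: "P n p" by blast
  have least: "\<not> P m p'" if "m < n" for m p'
    using that not_less_Least unfolding n_def by blast
  have R: "R (p i) (p (Suc i))" if "i < n" for i using p that by (auto simp: P_def)
  have induced: "j = Suc i" if "i < j" "j \<le> n" "R (p i) (p j)" for i j
  proof (rule ccontr)
    assume "j \<noteq> Suc i"
    \<comment> \<open>\<open>d\<close> vertices lie strictly between \<open>p i\<close> and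
      \<open>p j\<close>; cutting them out leaves a shorter chain with the same ends.\<close>
    define d where "d = j - Suc i"
    have d: "d > 0" "j = i + d + 1" using that \<open>j \<noteq> Suc i\<close> by (auto simp: d_def)
    have "P (n - d) (\<lambda>t. if t \<le> i then p t else p (t + d))"
      unfolding P_def
    proof (intro conjI allI impI)
      show "(if 0 \<le> i then p 0 else p (0 + d)) \<in> A" using p by (auto simp: P_def)
      show "(if n - d \<le> i then p (n - d) else p (n - d + d)) \<in> B"
        using p d that by (auto simp: P_def)
      fix t assume "t < n - d"
      then show "R (if t \<le> i then p t else p (t + d)) (if Suc t \<le> i then p (Suc t) else p (Suc t + d))"
        using R d that by (cases "t = i") (auto)
    qed
    moreover have "n - d < n" using d that by auto
    ultimately show False using least by blast
  qed
  have A0: "i = 0" if "i \<le> n" "p i \<in> A" for i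
  proof (rule ccontr)
    assume "i \<noteq> 0"
    have "P (n - i) (\<lambda>t. p (t + i))" using p that by (auto simp: P_def)
    then show False using least[of "n - i"] \<open>i \<noteq> 0\<close> that by auto
  qed
  have Bn: "i = n" if "i \<le> n" "p i \<in> B" for i
  proof (rule ccontr)
    assume "i \<noteq> n"
    have "P i p" using p that by (auto simp: P_def)
    then show False using least[of i] \<open>i \<noteq> n\<close> that by auto
  qed
  have neq: "p i \<noteq> p j" if "i < j" "j \<le> n" for i j
  proof
    assume eq: "p i = p j"
    show False
    proof (cases "j = n")
      case True
      then have "p i \<in> B" using p eq by (auto simp: P_def)
      then show False using Bn[of i] that by auto
    next
      case False
      then have "R (p i) (p (Suc j))" using R[of j] eq that by auto
      then show False using induced[of i "Suc j"] that False by auto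
    qed
  qed
  have "inj_on p {..n}" by (rule linorder_inj_onI) (use neq in auto)
  then show ?thesis using that p R induced A0 Bn unfolding P_def by blast
qed

lemma relpowp_sym:
  assumes "\<And>x y. R x y \<Longrightarrow> R y x" "(R ^^ n) x y"
  shows "(R ^^ n) y x"
  using assms(2)
proof (induction n arbitrary: y)
  case (Suc n)
  then obtain z where "(R ^^ n) x z" "R z y" by auto
  then show ?case using Suc.IH assms(1) relpowp_Suc_I2 by metis
qed auto

lemma relpowp_addI: "(R ^^ m) x y \<Longrightarrow> (R ^^ n) y z \<Longrightarrow> (R ^^ (m + n)) x z"
  by (auto simp: relpowp_add)

lemma dvd_smallD: "(n::int) dvd x \<Longrightarrow> \<bar>x\<bar> < n \<Longrightarrow> x = 0"
  using zdvd_imp_le[of n "\<bar>x\<bar>"] by (cases "x = 0") auto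

text \<open>Adjacency in C_q for colours that are integers taken modulo \<open>q\<close>. No range
  has to be respected, so a colouring may be translated or negated freely. For \<open>q = 3\<close>
  it is inequality modulo 3.\<close>

definition near :: "int \<Rightarrow> int \<Rightarrow> int \<Rightarrow> bool" where
  "near q a b \<longleftrightarrow> q dvd a - b - 1 \<or> q dvd a - b + 1"

lemma near_sym: "near q a b \<Longrightarrow> near q b a"
proof -
  assume "near q a b"
  moreover have "b - a - 1 = - (a - b + 1)" "b - a + 1 = - (a - b - 1)" by auto
  ultimately show ?thesis unfolding near_def by (metis dvd_minus_iff)
qed

text \<open>The combinatorics is done for a plain adjacency relation; digraphs return only when the
  theorem is translated.\<close>

locale ugraph =
  fixes V :: "'a set" and E :: "'a \<Rightarrow> 'a \<Rightarrow> bool"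
  assumes finV: "finite V"
    and E_sym: "E x y \<Longrightarrow> E y x"
    and E_irrefl: "\<not> E x x"
    and E_V: "E x y \<Longrightarrow> x \<in> V"
begin

lemma E_V2: "E x y \<Longrightarrow> y \<in> V" using E_V E_sym by blast

definition hcol :: "int \<Rightarrow> 'a set \<Rightarrow> bool" where
  "hcol q S \<longleftrightarrow> (\<exists>f::'a \<Rightarrow> int. \<forall>u\<in>S. \<forall>w\<in>S. E u w \<longrightarrow> near q (f u) (f w))"

text \<open>Induced paths are lists so that a forbidden one can be assembled by prepending vertices
  to a known one, each step asking only for the adjacencies of the new vertex.\<close>

primrec ipath :: "'a list \<Rightarrow> bool" where
  "ipath [] = True"
| "ipath (x # xs) = (x \<in> V \<and> x \<notin> set xs \<and> (xs \<noteq> [] \<longrightarrow> E x (hd xs)) \<and>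
     (\<forall>z\<in>set (tl xs). \<not> E x z) \<and> ipath xs)"

definition adj_in :: "'a set \<Rightarrow> 'a \<Rightarrow> 'a \<Rightarrow> bool" where
  "adj_in U u w \<longleftrightarrow> u \<in> U \<and> w \<in> U \<and> E u w"

abbreviation conn :: "'a set \<Rightarrow> 'a \<Rightarrow> 'a \<Rightarrow> bool" where
  "conn U \<equiv> (adj_in U)\<^sup>*\<^sup>*"

lemma adj_in_sym: "adj_in U u w \<Longrightarrow> adj_in U w u"
  using E_sym by (auto simp: adj_in_def)

definition bip :: "'a set \<Rightarrow> bool" where
  "bip U \<longleftrightarrow> (\<exists>b::'a \<Rightarrow> bool. \<forall>u\<in>U. \<forall>w\<in>U. E u w \<longrightarrow> b u \<noteq> b w)"

lemma ipath_map_upt: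
  assumes "\<And>i. i < n \<Longrightarrow> p i \<in> V" "inj_on p {..<n}"
    "\<And>i j. i < j \<Longrightarrow> j < n \<Longrightarrow> E (p i) (p j) \<longleftrightarrow> j = Suc i"
  shows "ipath (map p [0..<n])"
  using assms
proof (induction n arbitrary: p)
  case (Suc n)
  have "ipath (map (p \<circ> Suc) [0..<n])"
  proof (rule Suc.IH)
    show "inj_on (p \<circ> Suc) {..<n}"
      by (rule comp_inj_on) (auto intro: inj_on_subset[OF Suc.prems(2)])
  qed (use Suc.prems in auto)
  moreover have "map p [0..<Suc n] = p 0 # map (p \<circ> Suc) [0..<n]"
    by (simp add: map_upt_Suc comp_def del: upt_Suc)
  moreover have "p 0 \<notin> set (map (p \<circ> Suc) [0..<n])"
  proof
    assume "p 0 \<in> set (map (p \<circ> Suc) [0..<n])"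
    then obtain j where "j < n" "p 0 = p (Suc j)" by auto
    then show False using inj_onD[OF Suc.prems(2), of 0 "Suc j"] by auto
  qed
  moreover have "\<not> E (p 0) z" if z: "z \<in> set (tl (map (p \<circ> Suc) [0..<n]))" for z
  proof -
    obtain j where "j < n" "j \<ge> 1" "z = p (Suc j)"
      using z by (auto simp: map_tl[symmetric] tl_upt)
    then show ?thesis using Suc.prems(3)[of 0 "Suc j"] by auto
  qed
  moreover have "E (p 0) (hd (map (p \<circ> Suc) [0..<n]))" if "n > 0"
    using that Suc.prems(3)[of 0 "Suc 0"] by (simp add: hd_map)
  ultimately show ?case using Suc.prems(1)[of 0] by (simp del: upt_Suc)
qed simp

text \<open>A shortest walk inside \<open>U\<close> has no chords, and all its vertices lie in
  \<open>U\<close>, so it is induced in the whole graph.\<close>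

lemma conn_ipath:
  assumes "conn U u w" "u \<in> U" "U \<subseteq> V"
  obtains xs where "xs \<noteq> []" "hd xs = u" "last xs = w" "set xs \<subseteq> U" "ipath xs"
proof -
  obtain n p where p: "p 0 = u" "p n = w" "\<And>i. i < n \<Longrightarrow> adj_in U (p i) (p (Suc i))"
    "\<And>i j. i < j \<Longrightarrow> j \<le> n \<Longrightarrow> adj_in U (p i) (p j) \<Longrightarrow> j = Suc i" "inj_on p {..n}"
    by (rule shortest_chain[OF assms(1), of "{u}" "{w}"]) auto
  have U: "p i \<in> U" if "i \<le> n" for i
  proof (cases i)
    case 0
    then show ?thesis using p(1) assms(2) by simp
  next
    case (Suc j)
    then show ?thesis using p(3)[of j] that by (auto simp: adj_in_def)
  qed
  have "ipath (map p [0..<Suc n])"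
  proof (rule ipath_map_upt)
    show "inj_on p {..<Suc n}" using p(5) by (simp add: lessThan_Suc_atMost)
    show "E (p i) (p j) \<longleftrightarrow> j = Suc i" if "i < j" "j < Suc n" for i j
      using p(3)[of i] p(4)[of i j] that U by (auto simp: adj_in_def)
  qed (use U assms(3) in auto)
  then show ?thesis
    using p(1,2) U by (intro that[of "map p [0..<Suc n]"]) (auto simp: hd_map last_map simp del: upt_Suc)
qed

text \<open>Both functions flip at every edge, so whether they agree is constant along the path.
  This compares a bipartition of a whole class with a colouring known only on the path.\<close>

lemma alternating_ipath:
  assumes "ipath xs" "xs \<noteq> []"
    "\<And>u w. u \<in> set xs \<Longrightarrow> w \<in> set xs \<Longrightarrow> E u w \<Longrightarrow> f u \<noteq> f w"
    "\<And>u w. u \<in> set xs \<Longrightarrow> w \<in> set xs \<Longrightarrow> E u w \<Longrightarrow> g u \<noteq> g w"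
  shows "((f (hd xs) :: bool) = g (hd xs)) = (f (last xs) = g (last xs))"
  using assms
proof (induction xs)
  case (Cons x xs)
  show ?case
  proof (cases "xs = []")
    case False
    have "(f (hd xs) = g (hd xs)) = (f (last xs) = g (last xs))"
      using Cons False by auto
    moreover have "f x \<noteq> f (hd xs)" "g x \<noteq> g (hd xs)"
      using Cons.prems False by auto
    ultimately show ?thesis using False by auto
  qed simp
qed simp

text \<open>Indexing an induced cycle periodically by all integers removes the wrap-around cases. A
  triangle is the instance \<open>n = 3\<close>.\<close>

definition icyc :: "int \<Rightarrow> (int \<Rightarrow> 'a) \<Rightarrow> bool" where
  "icyc n v \<longleftrightarrow> n \<ge> 3 \<and> range v \<subseteq> V \<and> (\<forall>i j. v i = v j \<longleftrightarrow> n dvd i - j) \<and>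
     (\<forall>i j. E (v i) (v j) \<longleftrightarrow> near n i j)"

lemma icyc_V: "icyc n v \<Longrightarrow> v i \<in> V" by (auto simp: icyc_def)
lemma icyc_eq: "icyc n v \<Longrightarrow> v i = v j \<longleftrightarrow> n dvd i - j" by (auto simp: icyc_def)
lemma icyc_E: "icyc n v \<Longrightarrow> E (v i) (v j) \<longleftrightarrow> near n i j" by (auto simp: icyc_def)

lemma icyc_flip: "icyc n v \<Longrightarrow> icyc n (\<lambda>i. v (- i))"
proof -
  assume a: "icyc n v"
  have "near n (-i) (-j) \<longleftrightarrow> near n i j" for i j
  proof -
    have "- i - - j - 1 = - (i - j + 1)" "- i - - j + 1 = - (i - j - 1)" by auto
    then show ?thesis unfolding near_def by (metis dvd_minus_iff)
  qed
  moreover have "n dvd - i - - j \<longleftrightarrow> n dvd i - j" for i j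
  proof -
    have "- i - - j = - (i - j)" by auto
    then show ?thesis by (metis dvd_minus_iff)
  qed
  ultimately show ?thesis using a unfolding icyc_def by blast
qed

lemma icyc_mod: "icyc n v \<Longrightarrow> v (i mod n) = v i"
  using icyc_eq[of n v "i mod n" i] by (simp add: mod_eq_dvd_iff[symmetric])

lemma icyc_range: "icyc n v \<Longrightarrow> range v = v ` {0..<n}"
proof -
  assume a: "icyc n v"
  have "v i \<in> v ` {0..<n}" for i
    using icyc_mod[OF a, of i] a by (metis (no_types) imageI atLeastLessThan_iff icyc_def pos_mod_bound pos_mod_sign less_le_trans zero_less_numeral)
  then show ?thesis by auto
qed

lemma icyc_card: "icyc n v \<Longrightarrow> card (range v) = nat n"
proof -
  assume a: "icyc n v"
  have "inj_on v {0..<n}"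
  proof (rule inj_onI)
    fix i j assume "i \<in> {0..<n}" "j \<in> {0..<n}" "v i = v j"
    then show "i = j" using icyc_eq[OF a] dvd_smallD[of n "i - j"] by auto
  qed
  then show ?thesis using icyc_range[OF a] card_image by fastforce
qed

lemma icyc_finite: "icyc n v \<Longrightarrow> finite (range v)"
  using icyc_range by (metis finite_imageI finite_atLeastLessThan_int)

definition arc :: "(int \<Rightarrow> 'a) \<Rightarrow> int \<Rightarrow> nat \<Rightarrow> 'a list" where
  "arc v s m = map (\<lambda>j. v (s + int j)) [0..<m]"

lemma length_arc [simp]: "length (arc v s m) = m" by (simp add: arc_def)

lemma set_arc: "set (arc v s m) = v ` {s..<s + int m}"
proof -
  have "{s..<s + int m} = (\<lambda>j. s + int j) ` {0..<m}"
  proof (intro equalityI subsetI)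
    fix x assume "x \<in> {s..<s + int m}"
    then show "x \<in> (\<lambda>j. s + int j) ` {0..<m}" by (intro image_eqI[of _ _ "nat (x - s)"]) auto
  qed auto
  then show ?thesis by (simp add: arc_def image_image)
qed

lemma hd_arc: "m > 0 \<Longrightarrow> hd (arc v s m) = v s" by (simp add: arc_def hd_map)

lemma set_tl_arc: "set (tl (arc v s m)) = v ` {s + 1..<s + int m}"
proof (cases m)
  case (Suc k)
  have "tl (arc v s m) = arc v (s + 1) k"
    by (simp add: arc_def Suc map_upt_Suc comp_def algebra_simps del: upt_Suc)
  then show ?thesis using set_arc[of v "s+1" k] Suc by (simp add: algebra_simps)
qed (simp add: arc_def)

text \<open>At least one vertex of the cycle is left out, so the two ends of the arc are not joined
  around the back.\<close>

lemma ipath_arc: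
  assumes "icyc n v" "int m \<le> n - 1"
  shows "ipath (arc v s m)"
  unfolding arc_def
proof (rule ipath_map_upt)
  show "inj_on (\<lambda>j. v (s + int j)) {..<m}"
  proof (rule inj_onI)
    fix i j assume "i \<in> {..<m}" "j \<in> {..<m}" "v (s + int i) = v (s + int j)"
    then show "i = j" using icyc_eq[OF assms(1)] dvd_smallD[of n "int i - int j"] assms(2) by auto
  qed
  show "E (v (s + int i)) (v (s + int j)) \<longleftrightarrow> j = Suc i" if "i < j" "j < m" for i j
  proof -
    have "n dvd int i - int j - 1 \<longleftrightarrow> False"
      using dvd_smallD[of n "int i - int j - 1"] that assms(2) by auto
    moreover have "n dvd int i - int j + 1 \<longleftrightarrow> j = Suc i"
      using dvd_smallD[of n "int i - int j + 1"] that assms(2) by auto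
    ultimately show ?thesis using icyc_E[OF assms(1)] by (simp add: near_def)
  qed
qed (use icyc_V[OF assms(1)] in auto)

section \<open>Bipartiteness and shortest odd cycles\<close>

lemma bip_if_no_odd_closed_walk:
  assumes "\<And>n u. odd n \<Longrightarrow> \<not> (adj_in U ^^ n) u u"
  shows "bip U"
proof -
  \<comment> \<open>The choice sees only the predicate \<open>conn U x u\<close> of
    \<open>x\<close>, which is the same for all vertices of a component, so \<open>r\<close> picks
    one root for each component.\<close>
  define r where "r u = (SOME x. conn U x u)" for u
  have r: "conn U (r u) u" for u unfolding r_def by (rule someI[of _ u]) simp
  define b where "b u \<longleftrightarrow> (\<exists>m. even m \<and> (adj_in U ^^ m) (r u) u)" for u
  have "b u \<noteq> b w" if "u \<in> U" "w \<in> U" "E u w" for u w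
  proof -
    have uw: "adj_in U u w" using that by (auto simp: adj_in_def)
    have "conn U x u \<longleftrightarrow> conn U x w" for x
      using uw adj_in_sym by (meson rtranclp.rtrancl_into_rtrancl)
    then have eq: "r u = r w" by (simp add: r_def)
    obtain mu where mu: "(adj_in U ^^ mu) (r u) u" using r rtranclp_imp_relpowp by metis
    obtain mw where mw: "(adj_in U ^^ mw) (r u) w" using r eq rtranclp_imp_relpowp by metis
    have closed: "(adj_in U ^^ (m + 1 + m')) (r u) (r u)"
      if "(adj_in U ^^ m) (r u) u" "(adj_in U ^^ m') (r u) w" for m m'
    proof -
      have "(adj_in U ^^ 1) u w" using uw by (simp only: relpowp_1)
      from relpowp_addI[OF relpowp_addI[OF that(1) this] relpowp_sym[OF adj_in_sym that(2)]]
      show ?thesis .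
    qed
    show ?thesis
    proof
      assume bb: "b u = b w"
      obtain m m' where mm: "even m = even m'" "(adj_in U ^^ m) (r u) u" "(adj_in U ^^ m') (r u) w"
        using bb mu mw eq unfolding b_def by metis
      have "odd (m + 1 + m')" using mm(1) by auto
      then show False using assms closed[OF mm(2,3)] by blast
    qed
  qed
  then show ?thesis unfolding bip_def by blast
qed

lemma odd_closed_walk_relpowp:
  assumes "(adj_in U ^^ n) u u" "odd n"
  obtains m c where "odd m" "c m = c 0" "\<And>i. i < m \<Longrightarrow> adj_in U (c i) (c (Suc i))"
    "m \<le> n" "\<And>m' u'. odd m' \<Longrightarrow> (adj_in U ^^ m') u' u' \<Longrightarrow> m \<le> m'"
proof -
  define Q where "Q m \<longleftrightarrow> odd m \<and> (\<exists>u'. (adj_in U ^^ m) u' u')" for m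
  have "Q n" using assms by (auto simp: Q_def)
  define m where "m = (LEAST m. Q m)"
  have "Q m" unfolding m_def by (rule LeastI, rule \<open>Q n\<close>)
  then obtain c where "odd m" "c m = c 0" "\<And>i. i < m \<Longrightarrow> adj_in U (c i) (c (Suc i))"
    unfolding Q_def relpowp_fun_conv by metis
  moreover have "m \<le> m'" if "Q m'" for m' unfolding m_def by (rule Least_le) (rule that)
  ultimately show ?thesis using that \<open>Q n\<close> unfolding Q_def by blast
qed

text \<open>A repeated vertex splits a shortest odd closed walk into two closed walks with lengths
  adding up to \<open>n\<close>, a chord into two with lengths adding up to \<open>n + 2\<close>;
  one of them is odd and shorter. Minimality is passed on for closed walks, the form in which the
  odd girth argument applies it.\<close>

lemma shortest_odd_cycle:
  assumes "\<not> bip U" "U \<subseteq> V"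
  obtains n v where "odd n" "icyc (int n) v" "range v \<subseteq> U"
    "\<And>m u. odd m \<Longrightarrow> (adj_in U ^^ m) u u \<Longrightarrow> n \<le> m"
proof -
  obtain n0 u0 where "odd n0" "(adj_in U ^^ n0) u0 u0" using bip_if_no_odd_closed_walk assms(1) by blast
  then obtain n c where n: "odd n" "c n = c 0" "\<And>i. i < n \<Longrightarrow> adj_in U (c i) (c (Suc i))"
    and least: "\<And>m' u'. odd m' \<Longrightarrow> (adj_in U ^^ m') u' u' \<Longrightarrow> n \<le> m'"
    using odd_closed_walk_relpowp by metis
  have walk: "(adj_in U ^^ (j - i)) (c i) (c j)" if "i \<le> j" "j \<le> n" for i j
    unfolding relpowp_fun_conv using that n(3) by (intro exI[of _ "\<lambda>t. c (i + t)"]) auto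
  have around: "(adj_in U ^^ (n - (j - i))) (c j) (c i)" if "i \<le> j" "j \<le> n" for i j
    using relpowp_addI[OF walk[of j n] , of i "c i"] walk[of 0 i] n(2) that
    by (simp add: Nat.diff_diff_right)
  have n3: "n \<ge> 3"
  proof (rule ccontr)
    assume "\<not> n \<ge> 3"
    then have "n = 1" using n(1) by (cases n rule: nat.exhaust) (auto elim!: oddE)
    then show False using n(2) n(3)[of 0] E_irrefl by (auto simp: adj_in_def)
  qed
  have neq: "c i \<noteq> c j" if "i < j" "j < n" for i j
  proof
    assume eq: "c i = c j"
    have "odd (j - i) \<or> odd (n - (j - i))" using n(1) that by auto
    moreover have "(adj_in U ^^ (j - i)) (c i) (c i)" "(adj_in U ^^ (n - (j - i))) (c i) (c i)"
      using walk[of i j] around[of i j] eq that by auto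
    ultimately have "n \<le> j - i \<or> n \<le> n - (j - i)" using least by blast
    then show False using that by auto
  qed
  have chord: "j = Suc i \<or> i = 0 \<and> j = n - 1" if "i < j" "j < n" "E (c i) (c j)" for i j
  proof (rule ccontr)
    assume a: "\<not> ?thesis"
    have cU: "c i \<in> U" "c j \<in> U" using n(3)[of i] n(3)[of j] that by (auto simp: adj_in_def)
    then have e: "adj_in U (c i) (c j)" "adj_in U (c j) (c i)" using that E_sym by (auto simp: adj_in_def)
    have w1: "(adj_in U ^^ (j - i + 1)) (c i) (c i)"
      using relpowp_Suc_I[of "j - i" "adj_in U", OF walk e(2)] that unfolding Suc_eq_plus1 by linarith
    have w2: "(adj_in U ^^ (n - (j - i) + 1)) (c j) (c j)"
      using relpowp_Suc_I[of "n - (j - i)" "adj_in U", OF around e(1)] that unfolding Suc_eq_plus1 by linarith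
    have "odd (j - i + 1) \<or> odd (n - (j - i) + 1)" using n(1) that by auto
    moreover have "j - i + 1 < n" "n - (j - i) + 1 < n" using a that by auto
    ultimately show False using least w1 w2 by (metis not_less)
  qed
  \<comment> \<open>Periodic extension of the closed walk; a residue modulo \<open>n\<close> never
    reaches the duplicate end point \<open>c n\<close>.\<close>
  define v where "v i = c (nat (i mod int n))" for i :: int
  have npos: "int n > 0" using n3 by auto
  have lt: "nat (i mod int n) < n" for i using npos by (simp add: nat_less_iff)
  have U: "v i \<in> U" for i using n(3)[OF lt] by (auto simp: v_def adj_in_def)
  have eq: "v i = v j \<longleftrightarrow> int n dvd i - j" for i j
  proof -
    have "v i = v j \<longleftrightarrow> nat (i mod int n) = nat (j mod int n)"
      using neq lt unfolding v_def by (metis linorder_neqE_nat)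
    also have "\<dots> \<longleftrightarrow> i mod int n = j mod int n"
      using npos by (metis eq_nat_nat_iff pos_mod_sign)
    finally show ?thesis by (simp add: mod_eq_dvd_iff)
  qed
  have suc: "E (v i) (v (i + 1))" for i
  proof -
    define t where "t = nat (i mod int n)"
    have t: "t < n" "i mod int n = int t" using lt npos by (auto simp: t_def)
    have "v (i + 1) = v (int t + 1)" using eq[of "i + 1" "int t + 1"] t(2)
      by (metis add_diff_cancel_right mod_eq_dvd_iff mod_mod_trivial)
    also have "\<dots> = c (Suc t)"
    proof (cases "Suc t = n")
      case True
      then have "(int t + 1) mod int n = 0" by (metis add.commute mod_self of_nat_Suc)
      then show ?thesis using True n(2) by (simp add: v_def)
    next
      case False
      then have "(int t + 1) mod int n = int (Suc t)" using t by auto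
      then show ?thesis by (simp add: v_def del: of_nat_Suc)
    qed
    finally show ?thesis using n(3)[OF t(1)] by (simp add: v_def t_def adj_in_def)
  qed
  have EE: "E (v i) (v j) \<longleftrightarrow> near (int n) i j" for i j
  proof
    assume "near (int n) i j"
    then consider "v i = v (j + 1)" | "v j = v (i + 1)"
      unfolding near_def using eq[of i "j + 1"] eq[of "i + 1" j] by (auto simp: algebra_simps)
    then show "E (v i) (v j)" using suc[of i] suc[of j] E_sym by metis
  next
    assume e: "E (v i) (v j)"
    define s t where "s = nat (i mod int n)" and "t = nat (j mod int n)"
    have st: "s < n" "t < n" "v i = c s" "v j = c t" using lt by (auto simp: s_def t_def v_def)
    have "int s = i mod int n" "int t = j mod int n" using npos by (auto simp: s_def t_def)
    then have d: "int n dvd i - int s" "int n dvd j - int t" by (simp_all add: minus_mod_eq_mult_div)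
    have ne: "s \<noteq> t" using e st E_irrefl by metis
    have *: "int n dvd int s - int t - 1 \<or> int n dvd int s - int t + 1"
    proof (cases "s < t")
      case True
      then show ?thesis using chord[of s t] e st by auto
    next
      case False
      then have "s = Suc t \<or> t = 0 \<and> s = n - 1" using chord[of t s] e st ne E_sym by auto
      then show ?thesis using st by auto
    qed
    have "i - j - 1 = (i - int s) - (j - int t) + (int s - int t - 1)"
      "i - j + 1 = (i - int s) - (j - int t) + (int s - int t + 1)" by auto
    then show "near (int n) i j"
      unfolding near_def using * d by (metis dvd_add dvd_diff)
  qed
  have "icyc (int n) v" unfolding icyc_def using n3 U assms(2) eq EE by auto
  then show ?thesis using that[OF n(1)] U least by blast
qed

text \<open>A connected bipartite graph has just two proper 2-colourings, so the prescriptions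
  \<open>P\<close> extend as soon as any two of them in one component are compatible. The second
  hypothesis expresses this through an arbitrary proper \<open>b\<close>.\<close>

lemma bip_extend:
  assumes "bip U"
    and "\<And>u u' t t' b. \<lbrakk>P u t; P u' t'; u \<in> U; u' \<in> U; conn U u u';
           \<And>x y. x \<in> U \<Longrightarrow> y \<in> U \<Longrightarrow> E x y \<Longrightarrow> (b::'a \<Rightarrow> bool) x \<noteq> b y\<rbrakk> \<Longrightarrow> (t = t') = (b u = b u')"
  obtains g :: "'a \<Rightarrow> bool" where "\<And>x y. x \<in> U \<Longrightarrow> y \<in> U \<Longrightarrow> E x y \<Longrightarrow> g x \<noteq> g y"
    "\<And>u t. u \<in> U \<Longrightarrow> P u t \<Longrightarrow> g u = t"
proof -
  obtain b :: "'a \<Rightarrow> bool" where b: "\<And>x y. x \<in> U \<Longrightarrow> y \<in> U \<Longrightarrow> E x y \<Longrightarrow> b x \<noteq> b y"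
    using assms(1) unfolding bip_def by blast
  \<comment> \<open>\<open>s u\<close> holds if some prescription in the component of
    \<open>u\<close> agrees with \<open>b\<close>; where it fails, \<open>g\<close> is the negation
    of \<open>b\<close>.\<close>
  define s where "s u \<longleftrightarrow> (\<exists>x t. x \<in> U \<and> P x t \<and> conn U x u \<and> b x = t)" for u
  define g where "g u \<longleftrightarrow> (b u = s u)" for u
  have "g x \<noteq> g y" if "x \<in> U" "y \<in> U" "E x y" for x y
  proof -
    have "adj_in U x y" using that by (auto simp: adj_in_def)
    then have "conn U z x \<longleftrightarrow> conn U z y" for z
      using adj_in_sym by (meson rtranclp.rtrancl_into_rtrancl)
    then have "s x = s y" by (simp add: s_def)
    then show ?thesis using b[OF that] by (auto simp: g_def)
  qed
  moreover have "g u = t" if "u \<in> U" "P u t" for u t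
  proof (cases "b u = t")
    case True
    then have "s u" unfolding s_def using that by blast
    then show ?thesis using True by (simp add: g_def)
  next
    case False
    have "\<not> s u"
    proof
      assume "s u"
      then obtain x t' where "x \<in> U" "P x t'" "conn U x u" "b x = t'" unfolding s_def by blast
      then show False using assms(2)[of x t' u t b] b that False by auto
    qed
    then show ?thesis using False by (simp add: g_def)
  qed
  ultimately show ?thesis using that by blast
qed

end

section \<open>Colourings by an odd cycle\<close>

lemma near_cong: "near q a b \<Longrightarrow> q dvd a - a' \<Longrightarrow> q dvd b - b' \<Longrightarrow> near q a' b'"
proof -
  assume a: "near q a b" "q dvd a - a'" "q dvd b - b'"
  have "q dvd a' - b' - 1" if "q dvd a - b - 1" using that a(2,3) by algebra
  moreover have "q dvd a' - b' + 1" if "q dvd a - b + 1" using that a(2,3) by algebra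
  ultimately show ?thesis using a(1) unfolding near_def by blast
qed

text \<open>Comparing colours always ends in the divisibility of a small combination of signs. The
  list leaves out 5 and 7 in both signs, the only nonzero values of size at most 8 that an odd
  modulus from 5 on can divide.\<close>

lemma no_odd_dvd:
  fixes n :: int
  assumes "odd n" "n \<ge> 5" "n dvd c" "c \<in> {1, 2, 3, 4, 6, 8, -1, -2, -3, -4, -6, -8}"
  shows False
proof -
  have "\<bar>c\<bar> \<le> 8" "c \<noteq> 0" using assms(4) by auto
  then have "n \<le> 8" using zdvd_imp_le[of n "\<bar>c\<bar>"] assms(3) by auto
  then have "n = 5 \<or> n = 7" using assms(1,2) by presburger
  then show False using assms(3,4) by auto
qed

context ugraph
begin

lemma bip_hcol: "bip S \<Longrightarrow> hcol q S"
proof -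
  assume "bip S"
  then obtain b where b: "\<forall>u\<in>S. \<forall>w\<in>S. E u w \<longrightarrow> (b u :: bool) \<noteq> b w" unfolding bip_def by blast
  have "near q (if b u then 1 else 0) (if b w then 1 else 0)" if "b u \<noteq> b w" for u w
    using that by (auto simp: near_def)
  then show ?thesis unfolding hcol_def using b by (intro exI[of _ "\<lambda>u. if b u then 1 else 0"]) metis
qed

text \<open>The steps \<open>e\<close> lift the image of the cycle to a walk on the integers. It
  closes up modulo \<open>q\<close>, so the total displacement is \<open>q\<close> times a winding
  number.\<close>

lemma icyc_hom_steps:
  assumes c: "icyc (int n) v" and f: "\<And>i. near q (f (v i)) (f (v (i + 1)))"
  obtains e :: "nat \<Rightarrow> int" where "\<And>i. e i \<in> {1, -1}"
    "\<And>i. q dvd f (v (int i)) - f (v 0) - sum e {..<i}" "q dvd sum e {..<n}"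
proof -
  have "\<exists>e. e \<in> {1, -1} \<and> q dvd f (v (int i + 1)) - f (v (int i)) - e" for i :: nat
    using near_sym[OF f[of "int i"]] unfolding near_def by auto
  then obtain e where e: "\<And>i. e i \<in> {1, -1}" "\<And>i. q dvd f (v (int i + 1)) - f (v (int i)) - e i"
    by metis
  have s: "q dvd f (v (int i)) - f (v 0) - sum e {..<i}" for i
  proof (induction i)
    case (Suc i)
    have "q dvd (f (v (int i + 1)) - f (v (int i)) - e i) + (f (v (int i)) - f (v 0) - sum e {..<i})"
      using e(2) Suc by (rule dvd_add)
    then show ?case by (simp add: algebra_simps)
  qed simp
  have "v (int n) = v 0" using icyc_eq[OF c] by simp
  then have "q dvd - sum e {..<n}" using s[of n] by simp
  then have "q dvd sum e {..<n}" by simp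
  then show ?thesis using that e(1) s by blast
qed

lemma odd_sum_pm1: "(\<And>i. e i \<in> {1, -1 :: int}) \<Longrightarrow> odd (sum e {..<n :: nat}) \<longleftrightarrow> odd n"
proof (induction n)
  case (Suc n)
  then have "e n = 1 \<or> e n = -1" by blast
  then have "odd (e n)" by auto
  then show ?case using Suc by simp
qed simp

text \<open>The displacement of an odd number of unit steps is odd, hence nonzero; it is divisible
  by \<open>q\<close> and at most \<open>n\<close> in absolute value. If \<open>q = n\<close>, all
  steps must point the same way, so the map is a rotation, possibly after a reflection.\<close>

lemma icyc_hom:
  assumes c: "icyc (int n) v" and "odd n" and f: "\<And>i. near q (f (v i)) (f (v (i + 1)))" and "q > 0"
  shows "odd q \<and> q \<le> int n \<and>
    (q = int n \<longrightarrow> (\<exists>e\<in>{1, -1}. \<forall>i. q dvd f (v i) - (f (v 0) + e * i)))"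
proof -
  obtain e where e: "\<And>i::nat. e i \<in> {1, -1}"
    and s: "\<And>i::nat. q dvd f (v (int i)) - f (v 0) - sum e {..<i}" and d: "q dvd sum e {..<n}"
    using icyc_hom_steps[OF c, of q f] f by blast
  have o: "odd (sum e {..<n})" using odd_sum_pm1 e \<open>odd n\<close> by blast
  have ab: "\<bar>sum e {..<i}\<bar> \<le> int i" for i
    using sum_abs[of e "{..<i}"] sum_bounded_above[of "{..<i}" "\<lambda>i. \<bar>e i\<bar>" 1] e
    by (smt (verit) card_lessThan insert_iff mult.right_neutral singletonD)
  have "sum e {..<n} \<noteq> 0" using o by auto
  then have "q \<le> \<bar>sum e {..<n}\<bar>" using zdvd_imp_le[of q "\<bar>sum e {..<n}\<bar>"] d by auto
  then have le: "q \<le> int n" using ab[of n] by linarith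
  have oq: "odd q" using o d by (meson dvd_trans)
  have "\<exists>e\<in>{1, -1}. \<forall>i. q dvd f (v i) - (f (v 0) + e * i)" if qn: "q = int n"
  proof -
    have "\<bar>sum e {..<n}\<bar> = int n" using ab[of n] \<open>q \<le> \<bar>sum e {..<n}\<bar>\<close> qn by linarith
    then have "sum e {..<n} = 1 * int n \<or> sum e {..<n} = - 1 * int n" by linarith
    then obtain c where c1: "c \<in> {1, -1}" "sum e {..<n} = c * int n" by blast
    \<comment> \<open>Each \<open>1 - c * e i\<close> is 0 or 2, so a vanishing sum makes every step
      equal to \<open>c\<close>.\<close>
    have "sum (\<lambda>i. 1 - c * e i) {..<n} = 0"
      using c1 by (auto simp: sum_subtractf sum_distrib_left[symmetric])
    moreover have "0 \<le> 1 - c * e i" for i using e[of i] c1(1) by auto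
    ultimately have "\<forall>i\<in>{..<n}. 1 - c * e i = 0" by (subst (asm) sum_nonneg_eq_0_iff) auto
    then have ec: "e i = c" if "i < n" for i using that e[of i] c1(1) by auto
    have "q dvd f (v i) - (f (v 0) + c * i)" for i
    proof -
      define t where "t = nat (i mod q)"
      have t: "int t = i mod q" "t < n" using \<open>q > 0\<close> qn by (auto simp: t_def nat_less_iff)
      have "sum e {..<t} = c * int t" using ec t(2) by simp
      then have "q dvd f (v i) - f (v 0) - c * (i mod q)"
        using s[of t] t(1) icyc_mod[OF c, of i] qn by simp
      moreover have "q dvd c * (i mod q - i)" by (simp add: minus_mod_eq_mult_div mod_eq_dvd_iff[symmetric])
      ultimately have "q dvd (f (v i) - f (v 0) - c * (i mod q)) + c * (i mod q - i)" by (rule dvd_add)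
      then show ?thesis by (simp add: algebra_simps)
    qed
    then show ?thesis using c1(1) by blast
  qed
  then show ?thesis using oq le by blast
qed


lemma hcol_normalised:
  assumes c: "icyc q v" and "odd q" and "hcol q (S \<union> range v)"
  obtains f where "\<And>i. q dvd f (v i) - i"
    "\<And>x y. x \<in> S \<union> range v \<Longrightarrow> y \<in> S \<union> range v \<Longrightarrow> E x y \<Longrightarrow> near q (f x) (f y)"
proof -
  obtain f where f: "\<forall>x\<in>S \<union> range v. \<forall>y\<in>S \<union> range v. E x y \<longrightarrow> near q (f x) (f y)"
    using assms(3) unfolding hcol_def by blast
  have q3: "q \<ge> 3" using c by (simp add: icyc_def)
  have c': "icyc (int (nat q)) v" using c q3 by simp
  have st: "near q (f (v i)) (f (v (i + 1)))" for i
    using f icyc_E[OF c] by (auto simp: near_def)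
  obtain e where e: "e \<in> {1, -1}" "\<And>i. q dvd f (v i) - (f (v 0) + e * i)"
  proof -
    have "odd (nat q)" using \<open>odd q\<close> q3 by (simp add: even_nat_iff)
    moreover have "q > 0" "q = int (nat q)" using q3 by auto
    ultimately have "\<exists>e\<in>{1, -1}. \<forall>i. q dvd f (v i) - (f (v 0) + e * i)"
      using icyc_hom[OF c' _ st] by blast
    then show ?thesis using that by blast
  qed
  \<comment> \<open>An automorphism of C_q: the shift moves the colour of \<open>v 0\<close> to 0,
    and multiplying by \<open>e\<close> undoes a reflection.\<close>
  define g where "g x = e * (f x - f (v 0))" for x
  show ?thesis
  proof (rule that[of g])
    fix i
    have "q dvd e * (f (v i) - (f (v 0) + e * i))" using e(2) by simp
    moreover have "e * (f (v i) - (f (v 0) + e * i)) = g (v i) - i"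
      using e(1) by (elim insertE) (simp_all add: g_def)
    ultimately show "q dvd g (v i) - i" by simp
  next
    fix x y assume "x \<in> S \<union> range v" "y \<in> S \<union> range v" "E x y"
    then have n: "near q (f x) (f y)" using f by blast
    show "near q (g x) (g y)"
    proof (cases "e = 1")
      case True
      then show ?thesis using n by (simp add: g_def near_def)
    next
      case False
      then have "e = -1" using e(1) by blast
      then show ?thesis using near_sym[OF n] by (simp add: g_def near_def)
    qed
  qed
qed

end

text \<open>A counterexample to the bound. The assumptions are contradictory, and each later locale
  adds one structural case in which the contradiction is reached.\<close>

locale obstruction = ugraph V E for V :: "'a set" and E +
  fixes k :: nat and q :: int
  assumes k4: "k > 4" and q_def: "q = int k - 2"
    and Pfree: "ipath xs \<Longrightarrow> length xs \<noteq> k"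
    and notcol: "\<not> hcol q V"
    and crit: "S \<subset> V \<Longrightarrow> hcol q S"
    and big: "3 * k + 28 < card V"
begin

lemma q3: "q \<ge> 3" using k4 q_def by auto

lemma local_col: "S \<subseteq> V \<Longrightarrow> card S \<le> 3 * k + 28 \<Longrightarrow> hcol q S"
  using crit big by (metis leD psubsetI)

lemma ipath_short: "ipath xs \<Longrightarrow> length xs < k"
proof (rule ccontr)
  assume a: "ipath xs" "\<not> length xs < k"
  have "ipath (drop n xs)" for n
    using a(1)
  proof (induction xs arbitrary: n)
    case (Cons x xs)
    then show ?case by (cases n) auto
  qed simp
  then show False using Pfree[of "drop (length xs - k) xs"] a(2) by auto
qed

text \<open>Without an edge between \<open>S\<close> and the rest, colourings of these two proper
  subsets would combine to one of \<open>V\<close>.\<close>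

lemma connected:
  assumes "S \<subseteq> V" "S \<noteq> {}" "S \<noteq> V"
  obtains x y where "x \<in> S" "y \<in> V - S" "E x y"
proof (rule ccontr)
  assume "\<not> thesis"
  then have no: "\<not> E x y" "\<not> E y x" if "x \<in> S" "y \<in> V - S" for x y
    using that that E_sym by (meson \<open>\<And>y x. \<lbrakk>x \<in> S; y \<in> V - S; E x y\<rbrakk> \<Longrightarrow> thesis\<close>)+
  obtain f g where f: "\<forall>u\<in>S. \<forall>w\<in>S. E u w \<longrightarrow> near q (f u) (f w)"
    and g: "\<forall>u\<in>V-S. \<forall>w\<in>V-S. E u w \<longrightarrow> near q (g u) (g w)"
    using crit[of S] crit[of "V - S"] assms unfolding hcol_def by (metis Diff_subset Diff_eq_empty_iff psubsetI Diff_disjoint Int_absorb1 Diff_Diff_Int Diff_empty)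
  have "hcol q V"
    unfolding hcol_def using f g no by (intro exI[of _ "\<lambda>x. if x \<in> S then f x else g x"]) auto
  then show False using notcol by blast
qed

text \<open>If \<open>w\<close> saw all neighbours of \<open>u\<close>, a colouring of
  \<open>V - {u}\<close> would extend by giving \<open>u\<close> the colour of
  \<open>w\<close>.\<close>

lemma not_dominated:
  assumes "u \<in> V" "w \<in> V" "u \<noteq> w"
  obtains x where "E u x" "\<not> E w x"
proof (rule ccontr)
  assume "\<not> thesis"
  then have dom: "E w x" if "E u x" for x using that \<open>\<And>x. \<lbrakk>E u x; \<not> E w x\<rbrakk> \<Longrightarrow> thesis\<close> by blast
  have "V - {u} \<subset> V" using assms by auto
  then obtain f where f: "\<forall>x\<in>V-{u}. \<forall>y\<in>V-{u}. E x y \<longrightarrow> near q (f x) (f y)"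
    using crit unfolding hcol_def by blast
  have "near q ((f(u := f w)) x) ((f(u := f w)) y)" if "x \<in> V" "y \<in> V" "E x y" for x y
    using that f dom[of x] dom[of y] assms E_irrefl[of u] E_irrefl[of w] E_sym[of x y] E_sym[of w x] 
    by (cases "x = u"; cases "y = u") auto
  then have "hcol q V" unfolding hcol_def by blast
  then show False using notcol by blast
qed

lemma cycle_le:
  assumes "icyc (int n) v" shows "n \<le> k"
proof -
  \<comment> \<open>One vertex of the cycle is dropped to make the path induced, so cycles of length
    \<open>k\<close> itself remain possible.\<close>
  have "ipath (arc v 0 (n - 1))" using assms by (intro ipath_arc[OF assms]) (simp add: icyc_def of_nat_diff)
  then have "n - 1 < k" using ipath_short by force
  then show ?thesis by auto
qed

text \<open>A colouring of the cycle gives \<open>q \<le> n\<close>, the absence of an induced P_k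
  gives \<open>n \<le> q + 2\<close>, and \<open>q\<close> and \<open>n\<close> are both
  odd.\<close>

lemma odd_cycle_cases:
  assumes "odd n" "icyc (int n) v"
  shows "odd q \<and> (int n = q \<or> int n = int k)"
proof -
  have nk: "n \<le> k" using assms cycle_le by blast
  have "range v \<subseteq> V" "card (range v) \<le> 3 * k + 28"
    using icyc_card[OF assms(2)] nk assms(2) by (auto simp: icyc_def)
  then have "hcol q (range v)" using local_col by blast
  then obtain f where f: "\<forall>u\<in>range v. \<forall>w\<in>range v. E u w \<longrightarrow> near q (f u) (f w)"
    unfolding hcol_def by blast
  have "near q (f (v i)) (f (v (i + 1)))" for i
    using f icyc_E[OF assms(2)] by (auto simp: near_def)
  then have "odd q" "q \<le> int n" using icyc_hom[OF assms(2,1), of q f] q3 by auto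
  moreover have "int n = q + 1 \<Longrightarrow> False" using \<open>odd q\<close> assms(1) by presburger
  moreover have "int n = q \<or> int n = q + 1 \<or> int n = q + 2"
    using \<open>q \<le> int n\<close> nk q_def by linarith
  ultimately show ?thesis using q_def by auto
qed

text \<open>Short odd closed walks and induced P_k being absent, every vertex off the cycle sees it
  exactly as some \<open>v i\<close> does, and edges join consecutive indices. The index is thus a
  homomorphism to C_k, and C_k maps to C_{k-2} by a fold.\<close>

lemma no_long_odd_girth:
  assumes c: "icyc (int k) v" and "odd k"
    and girth: "\<And>m u. odd m \<Longrightarrow> (adj_in V ^^ m) u u \<Longrightarrow> k \<le> m"
  shows False
proof -
  define W where "W m x y \<longleftrightarrow> (adj_in V ^^ m) x y" for m x y
  have WE: "W 1 x y" if "E x y" for x y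
    unfolding W_def using that E_V E_V2 by (simp only: relpowp_1) (auto simp: adj_in_def)
  have W_add: "W (m + n) x z" if "W m x y" "W n y z" for m n x y z
    using that unfolding W_def by (rule relpowp_addI)
  have W_sym: "W m y x" if "W m x y" for m x y
    using that unfolding W_def by (rule relpowp_sym[rotated]) (rule adj_in_sym)
  have arcW: "W d (v i) (v (i + int d))" for d i
  proof (induction d)
    case (Suc d)
    have "E (v (i + int d)) (v (i + int (Suc d)))" using icyc_E[OF c] by (simp add: near_def)
    then show ?case using W_add[OF Suc WE] by (simp only: Suc_eq_plus1)
  qed (simp add: W_def)
  have k5: "odd (int k)" "int k \<ge> 5" using k4 \<open>odd k\<close> by auto
  note nod = no_odd_dvd[OF k5]
  \<comment> \<open>As \<open>k\<close> is odd, the two arcs between two vertices of the cycle have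
    lengths \<open>r\<close> and \<open>k - r\<close> of different parity.\<close>
  have parity: "\<exists>d. d \<le> k \<and> (odd d \<longleftrightarrow> p) \<and> W d (v i) (v j) \<and> (int k dvd j - i - int d \<or> int k dvd j - i + int d)"
    for p i j
  proof -
    define r where "r = nat ((j - i) mod int k)"
    have r: "int r = (j - i) mod int k" "r < k" using k4 by (auto simp: r_def nat_less_iff)
    have d1: "int k dvd j - i - int r" unfolding r(1) by (simp add: minus_mod_eq_mult_div)
    have "v (i + int r) = v j" using icyc_eq[OF c, of j "i + int r"] d1 by (auto simp: algebra_simps)
    then have w1: "W r (v i) (v j)" using arcW[of r i] by simp
    have d2: "int k dvd j - i + int (k - r)" using d1 r(2)
      by (metis (no_types, lifting) add_diff_eq diff_add_eq dvd_add dvd_refl less_imp_le of_nat_diff)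
    have "v (j + int (k - r)) = v i" using icyc_eq[OF c, of "j + int (k - r)" i] d2 by (auto simp: algebra_simps)
    then have w2: "W (k - r) (v i) (v j)" using arcW[of "k - r" j] W_sym by metis
    have "odd (k - r) \<longleftrightarrow> \<not> odd r" using r(2) \<open>odd k\<close> by auto
    then show ?thesis using w1 w2 d1 d2 r(2) by (metis diff_le_self less_imp_le)
  qed
  have girth': "odd m \<Longrightarrow> W m u u \<Longrightarrow> k \<le> m" for m u using girth by (auto simp: W_def)
  \<comment> \<open>An odd arc of length \<open>d\<close> between two neighbours of \<open>x\<close>
    closes through \<open>x\<close> to an odd walk, so \<open>d + 2 \<ge> k\<close>.\<close>
  have nb: "int k dvd j - i \<or> int k dvd j - i - 2 \<or> int k dvd j - i + 2"
    if "E x (v i)" "E x (v j)" for x i j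
  proof -
    obtain d where d: "d \<le> k" "odd d" "W d (v i) (v j)" "int k dvd j - i - int d \<or> int k dvd j - i + int d"
      using parity[of True i j] by auto
    have "W (1 + d + 1) x x" using W_add[OF W_add[OF WE[OF that(1)] d(3)] WE[OF E_sym[OF that(2)]]] .
    then have "k \<le> d + 2" using girth'[of "1 + d + 1" x] d(2) by simp
    then have "d = k - 2 \<or> d = k - 1 \<or> d = k" using d(1) by linarith
    then have "d = k - 2 \<or> d = k" using d(2) \<open>odd k\<close> k4 by auto
    then have "int d = int k - 2 \<or> int d = int k" using k4 by auto
    then show ?thesis
    proof
      assume "int d = int k - 2"
      moreover have "int k dvd j - i + 2" if "int k dvd j - i - (int k - 2)" using that by algebra
      moreover have "int k dvd j - i - 2" if "int k dvd j - i + (int k - 2)" using that by algebra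
      ultimately show ?thesis using d(4) by metis
    next
      assume "int d = int k"
      moreover have "int k dvd j - i" if "int k dvd j - i - int k" using that by algebra
      moreover have "int k dvd j - i" if "int k dvd j - i + int k" using that by algebra
      ultimately show ?thesis using d(4) by metis
    qed
  qed
  define Ak where "Ak i x \<longleftrightarrow> x \<in> V \<and> x \<notin> range v \<and> E x (v (i - 1)) \<and> E x (v (i + 1))" for i x
  have attached: "\<exists>i. Ak i x" if x: "x \<in> V" "x \<notin> range v" "E x (v i)" for x i
  proof (rule ccontr)
    assume a: "\<nexists>i. Ak i x"
    have "\<not> Ak (i + 1) x" "\<not> Ak (i - 1) x" using a by blast+
    then have "\<not> E x (v (i + 2))" "\<not> E x (v (i - 2))" using x by (auto simp: Ak_def add.commute)
    moreover have "\<not> E x (v j)" if j: "j \<in> {i + 1..<i + int (k - 1)}" for j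
    proof
      assume "E x (v j)"
      with nb[OF x(3) this] consider "int k dvd j - i" | "v j = v (i + 2)" | "v j = v (i - 2)"
        using icyc_eq[OF c] by (auto simp: algebra_simps)
      then show False
      proof cases
        case 1
        then show False using dvd_smallD[of "int k" "j - i"] j k4 by (auto simp: of_nat_diff)
      qed (use calculation \<open>E x (v j)\<close> in auto)
    qed
    moreover have "ipath (arc v i (k - 1))" using ipath_arc[OF c] k4 by simp
    moreover have "x \<notin> set (arc v i (k - 1))" using x(2) by (auto simp: set_arc)
    \<comment> \<open>\<open>x\<close> and all but one vertex of the cycle form an induced path on
      \<open>k\<close> vertices.\<close>
    ultimately have "ipath (x # arc v i (k - 1))"
      using x(1,3) k4 hd_arc[of "k - 1" v i] by (auto simp: set_tl_arc)
    then show False using ipath_short k4 by fastforce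
  qed
  have Ak_nb: "int k dvd j - (i + 1) \<or> int k dvd j - (i - 1)" if "Ak i x" "E x (v j)" for i x j
  proof -
    have "int k dvd j - (i - 1) \<or> int k dvd j - (i - 1) - 2 \<or> int k dvd j - (i - 1) + 2"
      "int k dvd j - (i + 1) \<or> int k dvd j - (i + 1) - 2 \<or> int k dvd j - (i + 1) + 2"
      using that nb unfolding Ak_def by blast+
    moreover have False if "int k dvd j - (i - 1) + 2" "int k dvd j - (i + 1) - 2"
    proof -
      have "int k dvd 6" using that by algebra
      then show False using nod by blast
    qed
    moreover have False if "int k dvd j - (i - 1) + 2" "int k dvd j - (i + 1) + 2"
    proof -
      have "int k dvd 2" using that by algebra
      then show False using nod by blast
    qed
    ultimately show ?thesis by (auto simp: algebra_simps)
  qed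
  define N where "N = range v \<union> {x. \<exists>i. Ak i x}"
  have N_V: "N \<subseteq> V" using icyc_V[OF c] by (auto simp: N_def Ak_def)
  have "N = V"
  proof (rule ccontr)
    assume "N \<noteq> V"
    moreover have "N \<noteq> {}" by (auto simp: N_def)
    ultimately obtain x y where xy: "x \<in> N" "y \<in> V - N" "E x y" using connected[OF N_V] by blast
    have yv: "\<not> E y (v i)" for i using attached[of y i] xy(2) by (auto simp: N_def)
    then have "x \<notin> range v" using xy(3) E_sym by blast
    then obtain i where x: "Ak i x" using xy(1) by (auto simp: N_def)
    \<comment> \<open>The arc avoids \<open>v (i - 1)\<close> and \<open>v i\<close>, so that
      \<open>y\<close>, \<open>x\<close> and its \<open>k - 2\<close> vertices form an induced
      P_k.\<close>
    define a where "a = arc v (i + 1) (k - 2)"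
    have sa: "set a = v ` {i + 1..<i + int (k - 1)}" "hd a = v (i + 1)" "a \<noteq> []"
      "set (tl a) = v ` {i + 2..<i + int (k - 1)}"
    proof -
      have e: "i + 1 + int (k - 2) = i + int (k - 1)" "i + 1 + 1 = i + 2" using k4 by auto
      show "set a = v ` {i + 1..<i + int (k - 1)}" "set (tl a) = v ` {i + 2..<i + int (k - 1)}"
        using set_arc[of v "i + 1" "k - 2"] set_tl_arc[of v "i + 1" "k - 2"] unfolding a_def e by auto
      show "hd a = v (i + 1)" using hd_arc k4 by (simp add: a_def)
      have "length a > 0" using k4 by (simp add: a_def)
      then show "a \<noteq> []" by auto
    qed
    have "ipath a" unfolding a_def by (rule ipath_arc[OF c]) (use k4 in auto)
    moreover have "\<not> E x (v j)" if j: "j \<in> {i + 2..<i + int (k - 1)}" for j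
    proof
      assume "E x (v j)"
      then have "int k dvd j - (i + 1) \<or> int k dvd j - (i - 1)" using Ak_nb x by blast
      then show False using dvd_smallD[of "int k" "j - (i + 1)"] dvd_smallD[of "int k" "j - (i - 1)"] j k4
        by (auto simp: of_nat_diff)
    qed
    moreover have "x \<notin> set a" "y \<notin> set a" using xy(2) \<open>x \<notin> range v\<close> sa(1) by (auto simp: N_def)
    moreover have "x \<in> V" "y \<in> V" "E y x" "E x (v (i + 1))" "y \<noteq> x"
      using x xy E_sym by (auto simp: Ak_def)
    ultimately have "ipath (y # x # a)" using sa yv by auto
    then show False using ipath_short k4 by (fastforce simp: a_def)
  qed
  have AA: "int k dvd j - i - 1 \<or> int k dvd j - i + 1" if "Ak i x" "Ak j y" "E x y" for i j x y
  proof -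
    \<comment> \<open>Even arcs this time: the edge between \<open>x\<close> and \<open>y\<close>
      adds one more step to the closed walk, so \<open>d + 3 \<ge> k\<close>.\<close>
    have close: "\<exists>c\<in>{1,-1,3,-3}. int k dvd j + t - (i + s) - c" if "s \<in> {1, -1}" "t \<in> {1, -1}" for s t
    proof -
      have e: "E x (v (i + s))" "E y (v (j + t))" using \<open>Ak i x\<close> \<open>Ak j y\<close> that by (auto simp: Ak_def)
      obtain d where d: "d \<le> k" "even d" "W d (v (i + s)) (v (j + t))"
        "int k dvd j + t - (i + s) - int d \<or> int k dvd j + t - (i + s) + int d"
        using parity[of False "i + s" "j + t"] by auto
      have "W (1 + d + 1 + 1) x x"
        using W_add[OF W_add[OF W_add[OF WE[OF e(1)] d(3)] WE[OF E_sym[OF e(2)]]] WE[OF E_sym[OF \<open>E x y\<close>]]] .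
      then have "k \<le> d + 3" using girth'[of "1 + d + 1 + 1" x] d(2) by simp
      then have "d = k - 3 \<or> d = k - 2 \<or> d = k - 1 \<or> d = k" using d(1) by linarith
      then have "d = k - 3 \<or> d = k - 1" using d(2) \<open>odd k\<close> k4 by auto
      then have "int d = int k - 3 \<or> int d = int k - 1" using k4 by auto
      then have "\<exists>c. int k dvd j + t - (i + s) - c \<and> c \<in> {1,-1,3,-3}"
      proof
        assume 1: "int d = int k - 3"
        have "int k dvd j + t - (i + s) - (-3)" if "int k dvd j + t - (i + s) - (int k - 3)"
          using that by algebra
        moreover have "int k dvd j + t - (i + s) - 3" if "int k dvd j + t - (i + s) + (int k - 3)"
          using that by algebra
        ultimately show ?thesis using d(4) 1 by (metis insertCI)
      next
        assume 1: "int d = int k - 1"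
        have "int k dvd j + t - (i + s) - (-1)" if "int k dvd j + t - (i + s) - (int k - 1)"
          using that by algebra
        moreover have "int k dvd j + t - (i + s) - 1" if "int k dvd j + t - (i + s) + (int k - 1)"
          using that by algebra
        ultimately show ?thesis using d(4) 1 by (metis insertCI)
      qed
      then show ?thesis by blast
    qed
    obtain c1 where c1: "c1 \<in> {1,-1,3,-3}" "int k dvd j + 1 - (i + 1) - c1" using close[of 1 1] by blast
    obtain c2 where c2: "c2 \<in> {1,-1,3,-3}" "int k dvd j + 1 - (i + -1) - c2" using close[of "-1" 1] by blast
    obtain c3 where c3: "c3 \<in> {1,-1,3,-3}" "int k dvd j + -1 - (i + 1) - c3" using close[of 1 "-1"] by blast
    \<comment> \<open>An index difference of 3 would become 5 for another pair of attachments, and 5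
      is not congruent to 1, -1, 3 or -3 for an odd modulus from 5 on.\<close>
    have "int k dvd c1 + 2 - c2" using c1(2) c2(2) by algebra
    then have "c1 \<noteq> 3" using c2(1) nod[of "c1 + 2 - c2"] by auto
    have "int k dvd c1 - 2 - c3" using c1(2) c3(2) by algebra
    then have "c1 \<noteq> -3" using c3(1) nod[of "c1 - 2 - c3"] by auto
    then show ?thesis using c1 \<open>c1 \<noteq> 3\<close> by auto
  qed
  define ix where "ix x = (SOME i. x = v i \<or> Ak i x)" for x
  have ix: "x = v (ix x) \<or> Ak (ix x) x" if "x \<in> V" for x
  proof -
    have "\<exists>i. x = v i \<or> Ak i x" using that \<open>N = V\<close> by (auto simp: N_def)
    then show ?thesis unfolding ix_def by (rule someI_ex)
  qed
  have near_ix: "near (int k) (ix x) (ix y)" if "E x y" for x y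
  proof -
    have VA: "near (int k) (ix x) (ix y)" if "x = v (ix x)" "Ak (ix y) y" "E y x" for x y
    proof -
      have "E y (v (ix x))" using that by simp
      then show ?thesis using Ak_nb[OF that(2), of "ix x"] unfolding near_def by (auto simp: algebra_simps)
    qed
    consider "x = v (ix x)" "y = v (ix y)" | "x = v (ix x)" "Ak (ix y) y" |
      "Ak (ix x) x" "y = v (ix y)" | "Ak (ix x) x" "Ak (ix y) y"
      using ix E_V E_V2 \<open>E x y\<close> by blast
    then show ?thesis
    proof cases
      case 1
      then show ?thesis using that icyc_E[OF c] by metis
    next
      case 2
      then show ?thesis using VA that E_sym by blast
    next
      case 3
      then show ?thesis using VA that near_sym by blast
    next
      case 4
      then show ?thesis using near_sym AA that unfolding near_def by blast
    qed
  qed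
  \<comment> \<open>The fold of C_k: modulo \<open>q\<close> the residues \<open>k - 2\<close> and
    \<open>k - 1\<close> are identified with 0 and 1, and each edge of C_k still joins neighbouring
    colours.\<close>
  have fold: "near q (i mod int k) (j mod int k)" if n: "near (int k) i j" for i j
  proof -
    define r s where "r = i mod int k" and "s = j mod int k"
    have rs: "0 \<le> r" "r < int k" "0 \<le> s" "s < int k" using k4 by (auto simp: r_def s_def)
    have d: "int k dvd i - r" "int k dvd j - s" by (simp_all add: r_def s_def minus_mod_eq_mult_div)
    have "near (int k) r s" by (rule near_cong[OF n d])
    then have "r - s - 1 = 0 \<or> r - s - 1 = - int k \<or> r - s + 1 = 0 \<or> r - s + 1 = int k"
    proof -
      have "x = 0 \<or> x = - int k \<or> x = int k" if "int k dvd x" "\<bar>x\<bar> < 2 * int k" for x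
      proof -
        obtain t where t: "x = int k * t" using \<open>int k dvd x\<close> by blast
        have "\<bar>t\<bar> < 2" 
        proof (rule ccontr)
          assume "\<not> \<bar>t\<bar> < 2"
          then have "int k * 2 \<le> int k * \<bar>t\<bar>" by (intro mult_left_mono) auto
          then show False using that(2) t by (simp add: abs_mult)
        qed
        then have "t = 0 \<or> t = 1 \<or> t = -1" by auto
        then show ?thesis using t by auto
      qed
      moreover have "\<bar>r - s - 1\<bar> < 2 * int k" "\<bar>r - s + 1\<bar> < 2 * int k" using rs k4 by linarith+
      moreover have "r - s - 1 \<noteq> int k" "r - s + 1 \<noteq> - int k" using rs by linarith+
      ultimately show ?thesis using \<open>near (int k) r s\<close> unfolding near_def by blast
    qed
    then show ?thesis
    proof (elim disjE)
      assume "r - s - 1 = - int k"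
      then have "r - s + 1 = - q" by (auto simp: q_def)
      then show ?thesis unfolding near_def r_def s_def by simp
    next
      assume "r - s + 1 = int k"
      then have "r - s - 1 = q" by (auto simp: q_def)
      then show ?thesis unfolding near_def r_def s_def by simp
    qed (auto simp: near_def r_def s_def)
  qed
  have "hcol q V" unfolding hcol_def using near_ix fold by (intro exI[of _ "\<lambda>x. ix x mod int k"]) auto
  then show False using notcol by blast
qed

end

section \<open>Graphs with an induced cycle of length \<open>k - 2\<close>\<close>

text \<open>The pairs of colours that have a common neighbour in C_q: the constraint that an outside
  vertex imposes on two of its neighbours.\<close>

definition dif2 :: "int \<Rightarrow> int \<Rightarrow> int \<Rightarrow> bool" where
  "dif2 q a b \<longleftrightarrow> q dvd a - b \<or> q dvd a - b - 2 \<or> q dvd a - b + 2"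

lemma dif2_sym: "dif2 q a b \<Longrightarrow> dif2 q b a"
proof -
  have "b - a = - (a - b)" "b - a - 2 = - (a - b + 2)" "b - a + 2 = - (a - b - 2)" by auto
  then show "dif2 q a b \<Longrightarrow> dif2 q b a" unfolding dif2_def by (metis dvd_minus_iff)
qed

lemma dif2_cong: "dif2 q a b \<Longrightarrow> q dvd a - a' \<Longrightarrow> q dvd b - b' \<Longrightarrow> dif2 q a' b'"
proof -
  assume a: "dif2 q a b" "q dvd a - a'" "q dvd b - b'"
  have "q dvd a' - b'" if "q dvd a - b" using that a(2,3) by algebra
  moreover have "q dvd a' - b' - 2" if "q dvd a - b - 2" using that a(2,3) by algebra
  moreover have "q dvd a' - b' + 2" if "q dvd a - b + 2" using that a(2,3) by algebra
  ultimately show ?thesis using a(1) unfolding dif2_def by blast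
qed

lemma near_near_dif2: "near q c a \<Longrightarrow> near q c b \<Longrightarrow> dif2 q a b"
proof -
  assume a: "near q c a" "near q c b"
  have "q dvd a - b" if "q dvd c - a - 1" "q dvd c - b - 1" using that by algebra
  moreover have "q dvd a - b" if "q dvd c - a + 1" "q dvd c - b + 1" using that by algebra
  moreover have "q dvd a - b + 2" if "q dvd c - a - 1" "q dvd c - b + 1" using that by algebra
  moreover have "q dvd a - b - 2" if "q dvd c - a + 1" "q dvd c - b - 1" using that by algebra
  ultimately show ?thesis using a unfolding near_def dif2_def by blast
qed

lemma dvd_sym: "(q::int) dvd a - b \<Longrightarrow> q dvd b - a"
  by (metis dvd_minus_iff minus_diff_eq)

locale short_cycle = obstruction V E k q for V :: "'a set" and E k q +
  fixes v :: "int \<Rightarrow> 'a"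
  assumes qodd: "odd q" and q5: "q \<ge> 5" and cyc: "icyc q v"
begin

lemmas nod = no_odd_dvd[OF qodd q5]

text \<open>C_q has no triangle: three unit steps add up to 1 or 3 up to sign, which an odd
  \<open>q \<ge> 5\<close> does not divide.\<close>

lemma near_irrefl: "\<not> (near q a b \<and> near q b c \<and> near q a c)"
proof
  assume *: "near q a b \<and> near q b c \<and> near q a c"
  then obtain s t u where "s \<in> {1, -1}" "q dvd a - b - s" "t \<in> {1, -1}" "q dvd b - c - t"
    "u \<in> {1, -1}" "q dvd a - c - u" unfolding near_def by (metis diff_minus_eq_add insertCI)
  moreover from this have "q dvd s + t - u" by algebra
  ultimately show False using nod[of "s + t - u"] by auto
qed

text \<open>Three pairwise different colours would make \<open>q\<close> divide a sum of three
  numbers 2 or -2, that is 2 or 6 up to sign, and an odd \<open>q \<ge> 5\<close> divides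
  neither.\<close>

lemma dif2_three:
  assumes "dif2 q a b" "dif2 q a c" "dif2 q b c"
  shows "q dvd a - b \<or> q dvd a - c \<or> q dvd b - c"
proof (rule ccontr)
  assume n: "\<not> ?thesis"
  obtain s where s: "s \<in> {2, -2}" "q dvd a - b - s" using assms(1) n unfolding dif2_def
    by (metis diff_minus_eq_add insertCI)
  obtain t where t: "t \<in> {2, -2}" "q dvd a - c - t" using assms(2) n unfolding dif2_def
    by (metis diff_minus_eq_add insertCI)
  obtain u where u: "u \<in> {2, -2}" "q dvd b - c - u" using assms(3) n unfolding dif2_def
    by (metis diff_minus_eq_add insertCI)
  have "q dvd t - s - u" using s(2) t(2) u(2) by algebra
  then show False using nod[of "t - s - u"] s(1) t(1) u(1) by auto
qed

text \<open>Giving \<open>v i\<close> the colour \<open>i\<close> spends all the symmetry of C_q, so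
  that the colour of an attached vertex has an absolute meaning.\<close>

definition good :: "('a \<Rightarrow> int) \<Rightarrow> 'a set \<Rightarrow> bool" where
  "good f S \<longleftrightarrow> (\<forall>i. q dvd f (v i) - i) \<and>
     (\<forall>x\<in>S \<union> range v. \<forall>y\<in>S \<union> range v. E x y \<longrightarrow> near q (f x) (f y))"

lemma good_v: "good f S \<Longrightarrow> q dvd f (v i) - i" by (auto simp: good_def)
lemma good_E: "good f S \<Longrightarrow> x \<in> S \<Longrightarrow> y \<in> S \<Longrightarrow> E x y \<Longrightarrow> near q (f x) (f y)"
  by (auto simp: good_def)
lemma good_mono: "good f S \<Longrightarrow> T \<subseteq> S \<Longrightarrow> good f T" unfolding good_def by blast

lemma hcol_good:
  assumes "hcol q (S \<union> range v)"
  obtains f where "good f S"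
proof -
  from hcol_normalised[OF cyc qodd assms] obtain f where "\<And>i. q dvd f (v i) - i"
    "\<And>x y. x \<in> S \<union> range v \<Longrightarrow> y \<in> S \<union> range v \<Longrightarrow> E x y \<Longrightarrow> near q (f x) (f y)" by blast
  then have "good f S" unfolding good_def by blast
  then show ?thesis using that by blast
qed

text \<open>Adding the \<open>q\<close> vertices of the cycle gives 3q + 34, which is 3k + 28 for k
  = q + 2.\<close>

lemma local_good:
  assumes "S \<subseteq> V" "card S \<le> 2 * nat q + 34"
  obtains f where "good f S"
proof -
  have "card (S \<union> range v) \<le> card S + card (range v)" by (rule card_Un_le)
  also have "\<dots> \<le> 3 * k + 28" using icyc_card[OF cyc] assms(2) q_def k4 by auto
  finally have "hcol q (S \<union> range v)"
    using local_col[of "S \<union> range v"] assms(1) cyc by (auto simp: icyc_def)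
  then show ?thesis using hcol_good that by blast
qed

lemma small_good:
  assumes "S \<subseteq> V" "card S \<le> 34"
  obtains f where "good f S"
  using local_good[of S] assms that by auto

section \<open>Vertices by their neighbours on the cycle\<close>

definition A where "A i x \<longleftrightarrow> x \<in> V \<and> x \<notin> range v \<and> E x (v (i - 1)) \<and> E x (v (i + 1))"
definition B where "B i x \<longleftrightarrow> x \<in> V \<and> x \<notin> range v \<and> E x (v i) \<and> (\<forall>j. E x (v j) \<longrightarrow> q dvd i - j)"
definition N1 where "N1 = {x \<in> V. x \<notin> range v \<and> (\<exists>i. E x (v i))}"
definition Z where "Z = {x \<in> V. x \<notin> range v \<and> (\<forall>i. \<not> E x (v i))}"

lemma v_V: "v i \<in> V" using icyc_V[OF cyc] .
lemma v_cong: "q dvd i - j \<Longrightarrow> v i = v j" using icyc_eq[OF cyc] by blast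

lemma A_N1: "A i x \<Longrightarrow> x \<in> N1" and B_N1: "B i x \<Longrightarrow> x \<in> N1" by (auto simp: A_def B_def N1_def)

lemma B_cong: "B i x \<Longrightarrow> q dvd i - j \<Longrightarrow> B j x"
proof -
  assume a: "B i x" "q dvd i - j"
  have "q dvd j - l" if "q dvd i - l" for l using that a(2) by algebra
  then show "B j x" using a v_cong[OF a(2)] unfolding B_def by auto
qed

lemma B_unique: "B i x \<Longrightarrow> B j x \<Longrightarrow> q dvd i - j" by (auto simp: B_def)

lemma good_near_v: "good f S \<Longrightarrow> x \<in> S \<Longrightarrow> E x (v i) \<Longrightarrow> near q (f x) i"
proof -
  assume a: "good f S" "x \<in> S" "E x (v i)"
  have "near q (f x) (f (v i))" using a unfolding good_def by blast
  then show ?thesis using near_cong good_v[OF a(1)] by (metis diff_self dvd_0_right)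
qed

lemma attachments: assumes "x \<in> V" "E x (v i)" "E x (v j)" shows "dif2 q i j"
proof -
  obtain f where f: "good f {x}" using small_good[of "{x}"] assms(1) by auto
  show ?thesis
    by (rule near_near_dif2[OF good_near_v[OF f _ assms(2)] good_near_v[OF f _ assms(3)]]) simp_all
qed

text \<open>Two different attachments are at distance two on the cycle and enclose a vertex
  \<open>v i\<close>; otherwise the attachment is unique.\<close>

lemma N1_cases:
  assumes "x \<in> N1" obtains i where "A i x" | i where "B i x"
proof -
  obtain i where x: "x \<in> V" "x \<notin> range v" "E x (v i)" using assms by (auto simp: N1_def)
  show ?thesis
  proof (cases "\<forall>j. E x (v j) \<longrightarrow> q dvd i - j")
    case True
    then show ?thesis using that x by (auto simp: B_def)
  next
    case False
    then obtain j where j: "E x (v j)" "\<not> q dvd i - j" by blast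
    then have "q dvd i - j - 2 \<or> q dvd i - j + 2" using attachments[OF x(1,3), of j] by (auto simp: dif2_def)
    then show ?thesis
    proof
      assume "q dvd i - j - 2"
      then have "v i = v (j + 1 + 1)" by (intro v_cong) (simp add: algebra_simps)
      then show ?thesis using that(1)[of "j + 1"] x j by (auto simp: A_def)
    next
      assume "q dvd i - j + 2"
      then have "v i = v (j - 1 - 1)" by (intro v_cong) (simp add: algebra_simps)
      then show ?thesis using that(1)[of "j - 1"] x j by (auto simp: A_def)
    qed
  qed
qed

lemma A_color: "good f S \<Longrightarrow> x \<in> S \<Longrightarrow> A i x \<Longrightarrow> q dvd f x - i"
proof -
  assume a: "good f S" "x \<in> S" "A i x"
  have n: "near q (f x) (i - 1)" "near q (f x) (i + 1)"
    using good_near_v[OF a(1,2)] a(3) by (auto simp: A_def)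
  have False if "q dvd f x - (i - 1) + 1" "q dvd f x - (i + 1) - 1"
  proof -
    have "q dvd 4" using that by algebra
    then show False using nod by blast
  qed
  then show ?thesis using n unfolding near_def by (auto simp: algebra_simps)
qed

lemma A_nb: "A i x \<Longrightarrow> E x (v j) \<Longrightarrow> q dvd j - (i + 1) \<or> q dvd j - (i - 1)"
proof -
  assume a: "A i x" "E x (v j)"
  have "x \<in> V" using a by (auto simp: A_def)
  then obtain f where f: "good f {x}" using small_good[of "{x}"] by auto
  have 1: "q dvd f x - i" using A_color[OF f _ a(1)] by simp
  have "near q (f x) j" using good_near_v[OF f _ a(2)] by simp
  then have "near q i j" using near_cong 1 by (metis diff_self dvd_0_right)
  moreover have "q dvd j - (i - 1)" if "q dvd i - j - 1" using that by algebra
  moreover have "q dvd j - (i + 1)" if "q dvd i - j + 1" using that by algebra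
  ultimately show ?thesis unfolding near_def by blast
qed

lemma B_color:
  assumes "good f S" "x \<in> S" "B i x" shows "q dvd f x - (i - 1) \<or> q dvd f x - (i + 1)"
proof -
  have "near q (f x) i" using good_near_v[OF assms(1,2)] assms(3) by (simp add: B_def)
  then show ?thesis unfolding near_def by (auto simp: algebra_simps)
qed

lemma not_A_B: "\<not> (A i x \<and> B j x)"
proof
  assume a: "A i x \<and> B j x"
  then have "q dvd j - (i - 1)" "q dvd j - (i + 1)" by (auto simp: A_def B_def)
  then have "q dvd 2" by algebra
  then show False using nod by blast
qed

lemma triangle_free: "E x y \<Longrightarrow> E y z \<Longrightarrow> E x z \<Longrightarrow> False"
proof -
  assume e: "E x y" "E y z" "E x z"
  have "{x, y, z} \<subseteq> V" using e E_V E_V2 by blast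
  moreover have "card {x, y, z} \<le> 34" by (simp add: card_insert_if)
  ultimately obtain f where "good f {x, y, z}" using small_good by blast
  then have "near q (f x) (f y)" "near q (f y) (f z)" "near q (f x) (f z)"
    using e good_E by auto
  then show False using near_irrefl by blast
qed

text \<open>All but one vertex of the cycle, read upwards or downwards from \<open>v i\<close>. A
  vertex prepended to the path may see a cycle neighbour of \<open>v i\<close>, and the two
  directions allow either of these to be omitted.\<close>

definition up where "up i = arc v i (nat q - 1)"
definition dn where "dn i = arc (\<lambda>j. v (- j)) (- i) (nat q - 1)"

lemma range_interval: "range v = v ` {i..<i + q}"
proof -
  have "v j \<in> v ` {i..<i + q}" for j
  proof -
    have "v j = v (i + (j - i) mod q)"
    proof (rule v_cong)
      have "j - (i + (j - i) mod q) = (j - i) - (j - i) mod q" by simp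
      then show "q dvd j - (i + (j - i) mod q)" by (metis dvd_minus_mod)
    qed
    moreover have "i + (j - i) mod q \<in> {i..<i + q}" using q5 by auto
    ultimately show ?thesis by blast
  qed
  then show ?thesis by auto
qed

lemma v_inj: "a \<in> {i..<i + q} \<Longrightarrow> b \<in> {i..<i + q} \<Longrightarrow> v a = v b \<Longrightarrow> a = b"
  using icyc_eq[OF cyc, of a b] dvd_smallD[of q "a - b"] by auto

lemma v_interval_minus: "D \<subseteq> {i..<i + q} \<Longrightarrow> v ` ({i..<i + q} - D) = range v - v ` D"
  unfolding range_interval[of i]
  by (rule inj_on_image_set_diff[of v "{i..<i + q}"]) (auto intro: inj_onI v_inj)

lemma up_props: "ipath (up i)" "hd (up i) = v i" "up i \<noteq> []" "length (up i) = nat q - 1"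
  "set (up i) = range v - {v (i - 1)}" "set (tl (up i)) = range v - {v (i - 1), v i}"
proof -
  show "length (up i) = nat q - 1" by (simp add: up_def)
  then have "length (up i) > 0" using q5 by simp
  then show "up i \<noteq> []" by auto
  show "ipath (up i)" unfolding up_def by (rule ipath_arc[OF cyc]) (use q5 in auto)
  show "hd (up i) = v i" unfolding up_def using hd_arc q5 by simp
  have e: "v (i - 1) = v (i - 1 + q)" by (rule v_cong) simp
  have "set (up i) = v ` ({i..<i + q} - {i - 1 + q})"
    unfolding up_def set_arc using q5 by (intro arg_cong[where f = "\<lambda>X. v ` X"]) auto
  also have "\<dots> = range v - {v (i - 1)}" using q5 e by (subst v_interval_minus) auto
  finally show "set (up i) = range v - {v (i - 1)}" .
  have "set (tl (up i)) = v ` ({i..<i + q} - {i - 1 + q, i})"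
    unfolding up_def set_tl_arc using q5 by (intro arg_cong[where f = "\<lambda>X. v ` X"]) auto
  also have "\<dots> = range v - {v (i - 1), v i}" using q5 e by (subst v_interval_minus) auto
  finally show "set (tl (up i)) = range v - {v (i - 1), v i}" .
qed

end

context short_cycle
begin

lemma flipped: "short_cycle V E k q (\<lambda>i. v (- i))"
  using short_cycle_axioms icyc_flip[OF cyc] unfolding short_cycle_def short_cycle_axioms_def by blast

lemma range_flip: "range (\<lambda>i. v (- i)) = range v"
proof -
  have "range (\<lambda>i. v (- i)) = v ` range uminus" by (simp only: image_image)
  then show ?thesis by simp
qed

lemma dn_props: "ipath (dn i)" "hd (dn i) = v i" "dn i \<noteq> []" "length (dn i) = nat q - 1"
  "set (dn i) = range v - {v (i + 1)}" "set (tl (dn i)) = range v - {v (i + 1), v i}"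
proof -
  have d: "dn i = short_cycle.up q (\<lambda>i. v (- i)) (- i)"
    unfolding short_cycle.up_def[OF flipped] dn_def by simp
  note u = short_cycle.up_props[OF flipped, of "- i", folded d]
  show "ipath (dn i)" "dn i \<noteq> []" "length (dn i) = nat q - 1" by (fact u)+
  show "hd (dn i) = v i" "set (dn i) = range v - {v (i + 1)}" "set (tl (dn i)) = range v - {v (i + 1), v i}"
    using u range_flip by (simp_all add: add.commute)
qed

section \<open>Vertices without neighbours on the cycle\<close>

lemma length_k: "length xs = nat q + 2 \<Longrightarrow> \<not> ipath xs"
  using Pfree[of xs] q_def k4 by auto

lemma B_nbD: assumes "B i x" "E x u" "u \<in> range v" shows "u = v i"
proof -
  obtain j where j: "u = v j" using assms(3) by blast
  then have "q dvd i - j" using assms(1,2) by (simp add: B_def)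
  then show ?thesis using v_cong j by simp
qed

text \<open>The tail \<open>z\<close>, \<open>y\<close>, \<open>x\<close> followed by the
  \<open>q - 1\<close> vertices of \<open>L\<close> would be an induced path on
  \<open>q + 2 = k\<close> vertices.\<close>

lemma B_no_tail:
  assumes "B i x" "E y x" "E z y" "\<not> E z x" "z \<noteq> x" "y \<notin> range v" "z \<notin> range v"
    and L: "L = up i \<or> L = dn i" and y: "\<And>u. u \<in> set L \<Longrightarrow> \<not> E y u" and z: "\<And>u. u \<in> set L \<Longrightarrow> \<not> E z u"
  shows False
proof -
  have Lp: "ipath L" "hd L = v i" "L \<noteq> []" "length L = nat q - 1" "set L \<subseteq> range v"
    "set (tl L) \<subseteq> range v - {v i}"
    using L by (elim disjE; simp add: up_props dn_props; blast)+
  have x: "x \<in> V" "x \<notin> range v" "E x (v i)" using assms(1) by (auto simp: B_def)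
  have "\<not> E x u" if "u \<in> set (tl L)" for u using B_nbD[OF assms(1), of u] Lp(6) that by blast
  moreover have "x \<noteq> y" "y \<noteq> z" "y \<in> V" "z \<in> V" using assms(2,3) E_irrefl E_V by blast+
  ultimately have "ipath (z # y # x # L)" using assms x Lp y z by (auto simp: subset_iff)
  moreover have "length (z # y # x # L) = nat q + 2" using Lp(4) q5 by simp
  ultimately show False using length_k by blast
qed

text \<open>A vertex of type \<open>A i\<close> sees both \<open>v (i - 1)\<close> and
  \<open>v (i + 1)\<close>, so the arc has to start at \<open>v (i + 1)\<close> and keeps only
  \<open>q - 2\<close> vertices. A tail with one more vertex makes up for it.\<close>

lemma A_no_tail:
  assumes "A i x" "E y x" "E z y" "E u z" "\<not> E z x" "\<not> E u x" "\<not> E u y" "u \<noteq> x" "u \<noteq> y" "z \<noteq> x"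
    "y \<in> Z" "z \<in> Z" "u \<in> Z"
  shows False
proof -
  obtain L where L: "up i = v i # L" using up_props(2,3)[of i] by (cases "up i") auto
  have Lp: "ipath L" "set L = range v - {v (i - 1), v i}" "length L = nat q - 2"
    using up_props[of i] L by auto
  have "L \<noteq> []" using Lp(3) q5 by auto
  have "hd L = v (i + 1)"
  proof -
    have "E (v i) (hd L)" using up_props(1)[of i] L \<open>L \<noteq> []\<close> by simp
    moreover have hL: "hd L \<in> range v - {v (i - 1), v i}" using Lp(2) \<open>L \<noteq> []\<close> hd_in_set by metis
    then obtain j where j: "hd L = v j" by blast
    ultimately have "near q i j" using icyc_E[OF cyc] by simp
    moreover have "v j \<noteq> v (i - 1)" using hL j by simp
    ultimately have "v j = v (i + 1)"
      using v_cong[of "i - 1" j] v_cong[of "i + 1" j] by (auto simp: near_def algebra_simps)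
    then show ?thesis using j by simp
  qed
  have x: "x \<in> V" "x \<notin> range v" "E x (v (i + 1))" using assms(1) by (auto simp: A_def)
  have "\<not> E x w" if "w \<in> set (tl L)" for w
  proof
    assume e: "E x w"
    have wL: "w \<in> range v - {v (i - 1), v i}" using that Lp(2) \<open>L \<noteq> []\<close> list.set_sel(2) by metis
    then obtain j where j: "w = v j" by blast
    then have "w = v (i + 1) \<or> w = v (i - 1)" using A_nb[OF assms(1)] e v_cong by blast
    moreover have "v (i + 1) \<notin> set (tl L)"
      using \<open>hd L = v (i + 1)\<close> Lp(1) \<open>L \<noteq> []\<close> by (cases L) auto
    ultimately show False using that wL by blast
  qed
  moreover have "x \<notin> set L" "E x (hd L)" using x Lp(2) \<open>hd L = v (i + 1)\<close> by auto
  ultimately have "ipath (x # L)" using x(1) Lp(1) by simp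
  moreover have "x \<noteq> y" "y \<noteq> z" "u \<noteq> z" "y \<in> V" "z \<in> V" "u \<in> V" using assms(2,3,4) E_irrefl E_V by blast+
  moreover have "w \<notin> set L \<and> (\<forall>t\<in>set L. \<not> E w t)" if "w \<in> Z" for w
    using that unfolding Lp(2) by (auto simp: Z_def)
  note this[OF assms(11)] this[OF assms(12)] this[OF assms(13)]
  ultimately have "ipath (u # z # y # x # L)" using assms(2-10) by simp
  moreover have "length (u # z # y # x # L) = nat q + 2" using Lp(3) q5 by simp
  ultimately show False using length_k by blast
qed

lemma Z_no_v: "z \<in> Z \<Longrightarrow> u \<in> range v \<Longrightarrow> \<not> E z u" "z \<in> Z \<Longrightarrow> z \<notin> range v" "z \<in> Z \<Longrightarrow> z \<in> V"
  by (auto simp: Z_def)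

lemma V_cases: "x \<in> V \<Longrightarrow> x \<in> range v \<or> x \<in> N1 \<or> x \<in> Z"
  by (auto simp: N1_def Z_def)

lemma Z_N1_disj: "x \<in> Z \<Longrightarrow> x \<notin> N1" by (auto simp: N1_def Z_def)

text \<open>The vertices of \<open>Z\<close> with a neighbour in \<open>N1\<close> are closed under
  adjacency in \<open>Z\<close>, since otherwise a forbidden tail appears; connectivity then leaves
  no other vertices in \<open>Z\<close>.\<close>

lemma Z_adj_N1:
  assumes "z \<in> Z" obtains x where "x \<in> N1" "E z x"
proof -
  define Y where "Y = {z \<in> Z. \<exists>x\<in>N1. E z x}"
  have closed: "z \<in> Y" if y: "y \<in> Y" "z \<in> Z" "E z y" for y z
  proof (rule ccontr)
    assume nY: "z \<notin> Y"
    obtain x where x: "x \<in> N1" "E y x" "y \<in> Z" using y(1) by (auto simp: Y_def)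
    have zx: "\<not> E z x" "z \<noteq> x" using nY x(1) y(2) Z_N1_disj by (auto simp: Y_def)
    from x(1) show False
    proof (cases rule: N1_cases)
      case (2 i)
      then show False using B_no_tail[OF 2 x(2) y(3) zx, of "up i"] Z_no_v x(3) y(2) up_props(5)[of i] by auto
    next
      case (1 i)
      \<comment> \<open>As \<open>x\<close> does not dominate \<open>z\<close>, some neighbour of
        \<open>z\<close> can serve as the fourth vertex of the tail.\<close>
      obtain u where u: "E z u" "\<not> E x u"
        using not_dominated[of z x] zx(2) y(2) x(1) by (auto simp: Z_def N1_def)
      have "u \<in> Z" using u(1) nY y(2) V_cases[of u] E_V2 Z_no_v unfolding Y_def by blast
      moreover have "\<not> E u y" using triangle_free u(1) y(3) E_sym by blast
      moreover have "u \<noteq> x" "u \<noteq> y" using \<open>u \<in> Z\<close> x Z_N1_disj u E_sym by blast+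
      ultimately show False using A_no_tail[OF 1 x(2) y(3) E_sym[OF u(1)] zx(1)] u(2) E_sym zx(2) x(3) y(2) by blast
    qed
  qed
  define S where "S = range v \<union> N1 \<union> Y"
  have "S = V"
  proof (rule ccontr)
    assume "S \<noteq> V"
    moreover have "S \<subseteq> V" "S \<noteq> {}" using v_V by (auto simp: S_def N1_def Y_def Z_def)
    ultimately obtain x y where xy: "x \<in> S" "y \<in> V - S" "E x y" using connected by metis
    then have "y \<in> Z" using V_cases[of y] by (auto simp: S_def)
    then show False using xy closed[of x y] Z_no_v(1)[of y x] E_sym unfolding S_def Y_def by blast
  qed
  then have "z \<in> Y" using assms Z_N1_disj Z_no_v S_def by blast
  then show ?thesis using that by (auto simp: Y_def)
qed

lemma ZZ_A:
  assumes "y \<in> Z" "w \<in> Z" "E y w" "x \<in> N1" "E y x"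
  obtains i where "A i x"
  using assms(4)
proof (cases rule: N1_cases)
  case (2 i)
  have "\<not> E w x" using triangle_free assms(3,5) by blast
  moreover have "w \<noteq> x" using assms(2,4) Z_N1_disj by blast
  ultimately have False
    using B_no_tail[OF 2 assms(5) E_sym[OF assms(3)], of "up i"] assms(1,2) Z_no_v up_props(5)[of i] by auto
  then show ?thesis ..
qed (use that in blast)

text \<open>Otherwise \<open>w\<close>, \<open>y'\<close>, \<open>y\<close> would be a tail at
  \<open>x\<close>, which has type \<open>A\<close> because of the edge inside \<open>Z\<close>.
  Hence along the edges of a component of \<open>Z\<close> only two neighbourhoods in
  \<open>N1\<close> alternate.\<close>

lemma ZZZ_sub:
  assumes "y \<in> Z" "y' \<in> Z" "w \<in> Z" "E y y'" "E y' w" "x \<in> N1" "E y x"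
  shows "E w x"
proof (rule ccontr)
  assume n: "\<not> E w x"
  obtain i where i: "A i x" by (rule ZZ_A[OF assms(1,2,4,6,7)])
  have "\<not> E y' x" "\<not> E w y" using triangle_free assms E_sym by blast+
  moreover have "w \<noteq> x" "y' \<noteq> x" "w \<noteq> y" using Z_N1_disj assms n by blast+
  ultimately show False using A_no_tail[OF i assms(7) E_sym[OF assms(4)] E_sym[OF assms(5)]] n assms by blast
qed

definition nb where "nb y = {x \<in> N1. E y x}"

lemma two_values:
  assumes "X \<noteq> {}" "\<And>x y. x \<in> X \<Longrightarrow> y \<in> X \<Longrightarrow> dif2 q (f x) (f y)"
  obtains x1 x2 where "x1 \<in> X" "x2 \<in> X" "\<And>x. x \<in> X \<Longrightarrow> q dvd f x - f x1 \<or> q dvd f x - f x2"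
proof -
  obtain x1 where x1: "x1 \<in> X" using assms(1) by blast
  show ?thesis
  proof (cases "\<forall>x\<in>X. q dvd f x - f x1")
    case True
    then show ?thesis using that x1 by blast
  next
    case False
    then obtain x2 where x2: "x2 \<in> X" "\<not> q dvd f x2 - f x1" by blast
    have "q dvd f x - f x1 \<or> q dvd f x - f x2" if "x \<in> X" for x
      using dif2_three[of "f x" "f x1" "f x2"] assms(2) that x1 x2 dvd_sym by blast
    then show ?thesis using that x1 x2(1) by blast
  qed
qed

text \<open>A Helly property of C_q: colours with pairwise common neighbours take at most two
  values, and a common neighbour of these two serves all.\<close>

lemma pairwise_near:
  assumes "\<And>x y. x \<in> X \<Longrightarrow> y \<in> X \<Longrightarrow> dif2 q (f x) (f y)"
  obtains c where "\<And>x. x \<in> X \<Longrightarrow> near q c (f x)"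
proof (cases "X = {}")
  case False
  obtain x1 x2 where x12: "x1 \<in> X" "x2 \<in> X" and all: "\<And>x. x \<in> X \<Longrightarrow> q dvd f x - f x1 \<or> q dvd f x - f x2"
    using two_values[of X f] False assms by blast
  have "\<exists>c. near q c (f x1) \<and> near q c (f x2)"
    using assms[OF x12] unfolding dif2_def
  proof (elim disjE)
    assume 1: "q dvd f x1 - f x2"
    have "near q (f x1 + 1) (f x1)" by (simp add: near_def)
    moreover from this have "near q (f x1 + 1) (f x2)" using near_cong[OF _ _ 1] by simp
    ultimately show ?thesis by blast
  next
    assume "q dvd f x1 - f x2 - 2"
    then show ?thesis by (intro exI[of _ "f x1 - 1"]) (auto simp: near_def)
  next
    assume "q dvd f x1 - f x2 + 2"
    then show ?thesis by (intro exI[of _ "f x1 + 1"]) (auto simp: near_def algebra_simps)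
  qed
  then obtain c where c: "near q c (f x1)" "near q c (f x2)" by blast
  have "near q c (f x)" if "x \<in> X" for x
    using all[OF that] near_cong[OF c(1), of c "f x"] near_cong[OF c(2), of c "f x"] dvd_sym by auto
  then show ?thesis using that by blast
qed (use that in blast)

text \<open>Let \<open>W\<close> be the set of vertices on edges inside \<open>Z\<close>; minimality
  colours the rest. A component of \<open>W\<close> has only two neighbourhoods, of type
  \<open>A\<close>, with fixed colours and at most two colours each. So one edge and four
  representatives, six vertices in all, decide how the whole component is coloured.\<close>

lemma Z_independent: "y \<in> Z \<Longrightarrow> w \<in> Z \<Longrightarrow> \<not> E y w"
proof
  assume yw: "y \<in> Z" "w \<in> Z" "E y w"
  define W where "W = {w \<in> Z. \<exists>y\<in>Z. E w y}"
  have WV: "W \<subseteq> V" "W \<noteq> {}" "W \<inter> range v = {}" using yw Z_no_v by (auto simp: W_def)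
  then have "V - W \<subset> V" "(V - W) \<union> range v = V - W" using v_V by auto
  then obtain f where f: "good f (V - W)" using crit[of "V - W"] hcol_good[of "V - W"] by auto
  have fA: "q dvd f x - i" if "A i x" for i x
    using A_color[OF f _ that] A_N1[OF that] Z_N1_disj by (auto simp: W_def N1_def)
  have nb_mate: "nb b = nb c" if "a \<in> Z" "b \<in> Z" "c \<in> Z" "E a b" "E a c" for a b c
    using ZZZ_sub[of b a c] ZZZ_sub[of c a b] that E_sym unfolding nb_def by blast
  have nb_ne: "nb a \<noteq> {}" if "a \<in> Z" for a using Z_adj_N1[OF that] by (auto simp: nb_def)
  have nb_diff: "nb a \<noteq> nb b" if "a \<in> Z" "b \<in> Z" "E a b" for a b
  proof
    assume "nb a = nb b"
    then obtain x where "E a x" "E b x" using nb_ne[OF \<open>a \<in> Z\<close>] by (auto simp: nb_def)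
    then show False using triangle_free that(3) by blast
  qed
  have nb_A: "\<exists>i. A i x" if "x \<in> nb a" "a \<in> Z" "b \<in> Z" "E a b" for x a b
    using ZZ_A[of a b x] that by (auto simp: nb_def)
  have nb_f: "dif2 q (f x) (f x')" if "x \<in> nb a" "x' \<in> nb a" "a \<in> Z" "b \<in> Z" "E a b" for x x' a b
  proof -
    have "\<exists>i. A i x" "\<exists>j. A j x'" using nb_A that by blast+
    then obtain i j where ij: "A i x" "A j x'" by blast
    have "{a, x, x'} \<subseteq> V" using that Z_no_v by (auto simp: nb_def N1_def)
    moreover have "card {a, x, x'} \<le> 34" by (simp add: card_insert_if)
    ultimately obtain h where h: "good h {a, x, x'}" using small_good by blast
    have "dif2 q (h x) (h x')" using that good_E[OF h] by (intro near_near_dif2[of q "h a"]) (auto simp: nb_def)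
    moreover have "q dvd h x - i" "q dvd h x' - j" using A_color[OF h] ij by auto
    ultimately have "dif2 q i j" using dif2_cong by blast
    then show ?thesis using dif2_cong dvd_sym fA ij by blast
  qed
  \<comment> \<open>Colours are given to neighbourhoods and not to vertices, so that a whole
    component of \<open>W\<close> shares one choice.\<close>
  define ok where "ok g P \<longleftrightarrow> (\<forall>X\<in>P. \<forall>x\<in>X. near q (g X) (f x)) \<and>
    (\<forall>X\<in>P. \<forall>X'\<in>P. X \<noteq> X' \<longrightarrow> near q (g X) (g X'))" for g :: "'a set \<Rightarrow> int" and P
  have ex: "\<exists>g. ok g {nb a, nb b}" if ab: "a \<in> Z" "b \<in> Z" "E a b" for a b
  proof -
    obtain x1 x2 where x: "x1 \<in> nb a" "x2 \<in> nb a" "\<And>x. x \<in> nb a \<Longrightarrow> q dvd f x - f x1 \<or> q dvd f x - f x2"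
      using two_values[OF nb_ne[OF ab(1)], of f] nb_f ab by blast
    obtain y1 y2 where y: "y1 \<in> nb b" "y2 \<in> nb b" "\<And>x. x \<in> nb b \<Longrightarrow> q dvd f x - f y1 \<or> q dvd f x - f y2"
      using two_values[OF nb_ne[OF ab(2)], of f] nb_f ab E_sym by blast
    define S where "S = {a, b, x1, x2, y1, y2}"
    have "S \<subseteq> V" using ab x y Z_no_v by (auto simp: S_def nb_def N1_def)
    moreover have "card S \<le> 34" unfolding S_def by (auto simp: card_insert_if)
    ultimately obtain h where h: "good h S" using small_good by blast
    have hf: "q dvd h x - f x" if "x \<in> S" "A i x" for x i
    proof -
      have "q dvd h x - i" "q dvd f x - i" using A_color[OF h] fA that by auto
      then show ?thesis by algebra
    qed
    have na: "near q (h a) (f x)" if "x \<in> {x1, x2}" for x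
    proof -
      have "near q (h a) (h x)" using that x good_E[OF h] by (auto simp: S_def nb_def)
      moreover have "\<exists>i. A i x" using nb_A[of x a b] ab x that by blast
      moreover have "x \<in> S" using that by (auto simp: S_def)
      ultimately show ?thesis using near_cong hf by (metis diff_self dvd_0_right)
    qed
    have nbb: "near q (h b) (f x)" if "x \<in> {y1, y2}" for x
    proof -
      have "near q (h b) (h x)" using that y good_E[OF h] by (auto simp: S_def nb_def)
      moreover have "\<exists>i. A i x" using nb_A[of x b a] ab y that E_sym by blast
      moreover have "x \<in> S" using that by (auto simp: S_def)
      ultimately show ?thesis using near_cong hf by (metis diff_self dvd_0_right)
    qed
    have "near q (h a) (f x)" if "x \<in> nb a" for x
      using x(3)[OF that] near_cong[OF na[of x1], of "h a" "f x"] near_cong[OF na[of x2], of "h a" "f x"] dvd_sym by auto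
    moreover have "near q (h b) (f x)" if "x \<in> nb b" for x
      using y(3)[OF that] near_cong[OF nbb[of y1], of "h b" "f x"] near_cong[OF nbb[of y2], of "h b" "f x"] dvd_sym by auto
    moreover have "near q (h a) (h b)" using good_E[OF h] ab by (auto simp: S_def)
    moreover have "nb a \<noteq> nb b" using nb_diff ab by blast
    ultimately have "ok ((\<lambda>_. h b)(nb a := h a)) {nb a, nb b}" using near_sym unfolding ok_def by auto
    then show ?thesis by blast
  qed
  define mate where "mate a = (SOME b. b \<in> Z \<and> E a b)" for a
  have mate: "mate a \<in> Z \<and> E a (mate a)" if "a \<in> W" for a
    unfolding mate_def by (rule someI_ex) (use that in \<open>auto simp: W_def\<close>)
  \<comment> \<open>\<open>SOME g. ok g (P a)\<close> depends only on the set \<open>P a\<close>,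
    which is the same for both ends of an edge.\<close>
  define P where "P a = {nb a, nb (mate a)}" for a
  define F where "F a = (if a \<in> W then (SOME g. ok g (P a)) (nb a) else f a)" for a
  have okP: "ok (SOME g. ok g (P a)) (P a)" if "a \<in> W" for a
    using someI_ex[OF ex[of a "mate a"]] mate[OF that] that unfolding P_def W_def by blast
  have WN: "near q (F a) (F b)" if "a \<in> W" "b \<in> V" "b \<notin> W" "E a b" for a b
  proof -
    have aZ: "a \<in> Z" using that by (auto simp: W_def)
    have "b \<notin> range v" using Z_no_v(1)[OF aZ, of b] that(4) by blast
    moreover have "b \<notin> Z" using that(3,4) aZ E_sym unfolding W_def by blast
    ultimately have "b \<in> nb a" using that(2,4) V_cases[of b] by (auto simp: nb_def)
    moreover have "nb a \<in> P a" by (simp add: P_def)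
    ultimately have "near q ((SOME g. ok g (P a)) (nb a)) (f b)"
      using okP[OF that(1)] unfolding ok_def[of _ "P a"] by blast
    then show ?thesis using that(1,3) by (simp add: F_def)
  qed
  have "near q (F a) (F b)" if "a \<in> V" "b \<in> V" "E a b" for a b
  proof (cases "a \<in> W"; cases "b \<in> W")
    assume aW: "a \<in> W" "b \<in> W"
    have Zs: "a \<in> Z" "b \<in> Z" using aW by (auto simp: W_def)
    have "nb (mate a) = nb b" "nb (mate b) = nb a"
      using nb_mate[of a "mate a" b] nb_mate[of b "mate b" a] mate aW Zs that(3) E_sym by blast+
    then have PP: "P a = {nb a, nb b}" "P b = P a" by (auto simp: P_def)
    have "nb a \<noteq> nb b" using nb_diff Zs that by blast
    then have "near q ((SOME g. ok g (P a)) (nb a)) ((SOME g. ok g (P a)) (nb b))"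
      using okP[OF aW(1)] PP(1) unfolding ok_def[of _ "P a"] by blast
    then show ?thesis using aW PP(2) by (simp add: F_def)
  next
    assume "a \<in> W" "b \<notin> W"
    then show ?thesis using WN that by blast
  next
    assume "a \<notin> W" "b \<in> W"
    then show ?thesis using WN[of b a] near_sym that E_sym by blast
  next
    assume "a \<notin> W" "b \<notin> W"
    then show ?thesis using good_E[OF f, of a b] that by (simp add: F_def)
  qed
  then have "hcol q V" unfolding hcol_def by blast
  then show False using notcol by blast
qed


section \<open>Implications between low and high choices\<close>

definition stepE where "stepE x x' \<longleftrightarrow> (\<exists>i. B i x \<and> B (i + 1) x' \<and> E x x')"
definition stepZ where "stepZ x x' \<longleftrightarrow> (\<exists>i. B i x \<and> B (i + 2) x' \<and> (\<exists>y\<in>Z. E y x \<and> E y x'))"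
text \<open>Low at \<open>x\<close> means \<open>i - 1\<close>. A high \<open>x'\<close> would then
  differ from it by 4, in the case of a common neighbour, or by 3, in the case of an edge; neither
  is possible in C_q, so \<open>x'\<close> is low too.\<close>

definition step where "step x x' \<longleftrightarrow> stepE x x' \<or> stepZ x x'"
text \<open>A forcing is certified by at most two further vertices: the other partner of a
  constraint and, for constraints through \<open>Z\<close>, the common neighbour. The bound keeps
  the set that refutes a chain small.\<close>

definition FL where "FL x \<longleftrightarrow> (\<exists>i S. B i x \<and> S \<subseteq> V \<and> card S \<le> 2 \<and>
  (\<forall>f. good f (insert x S) \<longrightarrow> q dvd f x - (i - 1)))"
definition FH where "FH x \<longleftrightarrow> (\<exists>i S. B i x \<and> S \<subseteq> V \<and> card S \<le> 2 \<and>
  (\<forall>f. good f (insert x S) \<longrightarrow> q dvd f x - (i + 1)))"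

lemma near_sign: assumes "near q a b" obtains t where "t \<in> {1, -1}" "q dvd a - b - t"
  using assms unfolding near_def by (metis diff_minus_eq_add insertCI)

lemma dif2_sign: assumes "dif2 q a b" obtains t where "t \<in> {0, 2, -2}" "q dvd a - b - t"
  using assms unfolding dif2_def by (metis diff_minus_eq_add diff_zero insertCI)

lemma B_sign:
  assumes "good f S" "x \<in> S" "B i x" obtains s where "s \<in> {1, -1}" "q dvd f x - (i + s)"
proof -
  have "q dvd f x - (i + -1) \<or> q dvd f x - (i + 1)" using B_color[OF assms] by simp
  then show ?thesis using that by blast
qed

lemma B_V: "B i x \<Longrightarrow> x \<in> V" and B_not_v: "B i x \<Longrightarrow> x \<notin> range v" by (auto simp: B_def)

text \<open>With the colours written as \<open>i + s\<close> and \<open>j + s'\<close>, an edge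
  becomes one congruence in signs, from which the possible values of \<open>j - i\<close> and the
  cases that force \<open>s\<close> and \<open>s'\<close> are read off.\<close>

lemma edge_signs:
  assumes "good f S" "x \<in> S" "x' \<in> S" "B i x" "B j x'" "E x x'"
  obtains s s' t where "s \<in> {1, -1}" "s' \<in> {1, -1}" "t \<in> {1, -1}"
    "q dvd f x - (i + s)" "q dvd f x' - (j + s')" "q dvd j - i - (s - s' - t)"
proof -
  obtain s where s: "s \<in> {1, -1}" "q dvd f x - (i + s)" using B_sign[OF assms(1,2,4)] by blast
  obtain s' where s': "s' \<in> {1, -1}" "q dvd f x' - (j + s')" using B_sign[OF assms(1,3,5)] by blast
  obtain t where t: "t \<in> {1, -1}" "q dvd f x - f x' - t"
    using near_sign[OF good_E[OF assms(1-3,6)]] by blast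
  have "q dvd j - i - (s - s' - t)" using s(2) s'(2) t(2) by algebra
  then show ?thesis using that s s' t by blast
qed

lemma common_signs:
  assumes "good f S" "x \<in> S" "x' \<in> S" "y \<in> S" "B i x" "B j x'" "E y x" "E y x'"
  obtains s s' t where "s \<in> {1, -1}" "s' \<in> {1, -1}" "t \<in> {0, 2, -2}"
    "q dvd f x - (i + s)" "q dvd f x' - (j + s')" "q dvd j - i - (s - s' - t)"
proof -
  obtain s where s: "s \<in> {1, -1}" "q dvd f x - (i + s)" using B_sign[OF assms(1,2,5)] by blast
  obtain s' where s': "s' \<in> {1, -1}" "q dvd f x' - (j + s')" using B_sign[OF assms(1,3,6)] by blast
  have "dif2 q (f x) (f x')"
    using near_near_dif2[OF good_E[OF assms(1,4,2,7)] good_E[OF assms(1,4,3,8)]] .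
  then obtain t where t: "t \<in> {0, 2, -2}" "q dvd f x - f x' - t" using dif2_sign by blast
  have "q dvd j - i - (s - s' - t)" using s(2) s'(2) t(2) by algebra
  then show ?thesis using that s s' t by blast
qed

lemma edge_diff:
  assumes "B i x" "B j x'" "E x x'"
  obtains d where "d \<in> {1, -1, 3, -3}" "q dvd j - i - d"
proof -
  have "{x, x'} \<subseteq> V" "card {x, x'} \<le> 34" using assms B_V by (auto simp: card_insert_if)
  then obtain f where f: "good f {x, x'}" using small_good by blast
  obtain s s' t where st: "s \<in> {1, -1}" "s' \<in> {1, -1}" "t \<in> {1, -1}" "q dvd j - i - (s - s' - t)"
    by (rule edge_signs[OF f _ _ assms]) auto
  have "s - s' - t \<in> {1, -1, 3, -3}" using st(1-3) by auto
  then show ?thesis using that st(4) by blast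
qed

lemma common_diff:
  assumes "B i x" "B j x'" "E y x" "E y x'"
  obtains d where "d \<in> {0, 2, -2, 4, -4}" "q dvd j - i - d"
proof -
  have "{x, x', y} \<subseteq> V" "card {x, x', y} \<le> 34" using assms B_V E_V by (auto simp: card_insert_if)
  then obtain f where f: "good f {x, x', y}" using small_good by blast
  obtain s s' t where st: "s \<in> {1, -1}" "s' \<in> {1, -1}" "t \<in> {0, 2, -2}" "q dvd j - i - (s - s' - t)"
    by (rule common_signs[OF f _ _ _ assms]) auto
  have "s - s' - t \<in> {0, 2, -2, 4, -4}" using st(1-3) by auto
  then show ?thesis using that st(4) by blast
qed

text \<open>3 is the extreme value of \<open>s - s' - t\<close> and is attained only for
  \<open>s = 1\<close> and \<open>s' = -1\<close>, so both choices are forced.\<close>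

lemma edge_forced:
  assumes "B i x" "B j x'" "E x x'" "q dvd j - i - 3"
  shows "FH x" "FL x'"
proof -
  have *: "q dvd f x - (i + 1) \<and> q dvd f x' - (j - 1)" if f: "good f S" "x \<in> S" "x' \<in> S" for f S
  proof -
    obtain s s' t where st: "s \<in> {1, -1}" "s' \<in> {1, -1}" "t \<in> {1, -1}"
      "q dvd f x - (i + s)" "q dvd f x' - (j + s')" "q dvd j - i - (s - s' - t)"
      by (rule edge_signs[OF f assms(1-3)])
    have "q dvd s - s' - t - 3" using st(6) assms(4) by algebra
    then have "s - s' - t = 3" using st(1-3) nod[of "s - s' - t - 3"] by auto
    then have "s = 1" "s' = -1" using st(1-3) by auto
    then show ?thesis using st(4,5) by simp
  qed
  show "FH x" unfolding FH_def
    by (rule exI[of _ i], rule exI[of _ "{x'}"]) (use assms * B_V in auto)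
  show "FL x'" unfolding FL_def
    by (rule exI[of _ j], rule exI[of _ "{x}"]) (use assms * B_V in auto)
qed

lemma common_forced:
  assumes "B i x" "B j x'" "E y x" "E y x'" "q dvd j - i - 4"
  shows "FH x" "FL x'"
proof -
  have *: "q dvd f x - (i + 1) \<and> q dvd f x' - (j - 1)" if f: "good f S" "x \<in> S" "x' \<in> S" "y \<in> S" for f S
  proof -
    obtain s s' t where st: "s \<in> {1, -1}" "s' \<in> {1, -1}" "t \<in> {0, 2, -2}"
      "q dvd f x - (i + s)" "q dvd f x' - (j + s')" "q dvd j - i - (s - s' - t)"
      by (rule common_signs[OF f assms(1-4)])
    have "q dvd s - s' - t - 4" using st(6) assms(5) by algebra
    then have "s - s' - t = 4" using st(1-3) nod[of "s - s' - t - 4"] by auto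
    then have "s = 1" "s' = -1" using st(1-3) by auto
    then show ?thesis using st(4,5) by simp
  qed
  have c: "card {a, b} \<le> 2" for a b :: 'a by (simp add: card_insert_if)
  show "FH x" unfolding FH_def
    by (rule exI[of _ i], rule exI[of _ "{x', y}"]) (use assms(1-4) * B_V E_V c in auto)
  show "FL x'" unfolding FL_def
    by (rule exI[of _ j], rule exI[of _ "{x, y}"]) (use assms(1-4) * B_V E_V c in auto)
qed

lemma stepE_low:
  assumes "good f S" "x \<in> S" "x' \<in> S" "B i x" "B (i + 1) x'" "E x x'" "q dvd f x - (i - 1)"
  shows "q dvd f x' - (i + 1 - 1)"
proof -
  obtain s s' t where st: "s \<in> {1, -1}" "s' \<in> {1, -1}" "t \<in> {1, -1}"
      "q dvd f x - (i + s)" "q dvd f x' - (i + 1 + s')" "q dvd i + 1 - i - (s - s' - t)"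
    by (rule edge_signs[OF assms(1-6)])
  have "q dvd s + 1" using st(4) assms(7) by algebra
  then have "s = -1" using st(1) nod[of "s + 1"] by auto
  then have "s' \<noteq> 1" using st(3,6) nod[of "i + 1 - i - (s - s' - t)"] by auto
  then show ?thesis using st(2,5) by auto
qed

lemma stepZ_low:
  assumes "good f S" "x \<in> S" "x' \<in> S" "y \<in> S" "B i x" "B (i + 2) x'" "E y x" "E y x'" "q dvd f x - (i - 1)"
  shows "q dvd f x' - (i + 2 - 1)"
proof -
  obtain s s' t where st: "s \<in> {1, -1}" "s' \<in> {1, -1}" "t \<in> {0, 2, -2}"
      "q dvd f x - (i + s)" "q dvd f x' - (i + 2 + s')" "q dvd i + 2 - i - (s - s' - t)"
    by (rule common_signs[OF assms(1-8)])
  have "q dvd s + 1" using st(4) assms(9) by algebra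
  then have "s = -1" using st(1) nod[of "s + 1"] by auto
  then have "s' \<noteq> 1" using st(3,6) nod[of "i + 2 - i - (s - s' - t)"] by auto
  then show ?thesis using st(2,5) by auto
qed

text \<open>The arc starting next to the far end of the step can omit the only cycle vertex that the
  near end sees, so \<open>y\<close> and the step would extend it to an induced P_k. Edge steps and
  steps through \<open>Z\<close> therefore never meet in a chain.\<close>

lemma stepE_no_Z:
  assumes "stepE x x'" "y \<in> Z" shows "\<not> E y x" "\<not> E y x'"
proof -
  obtain i where i: "B i x" "B (i + 1) x'" "E x x'" using assms(1) by (auto simp: stepE_def)
  have r: "x \<notin> range v" "x' \<notin> range v" "y \<notin> range v" using i assms(2) B_not_v Z_no_v by blast+
  have ne: "y \<noteq> x" "y \<noteq> x'" using assms(2) i B_N1 Z_N1_disj by blast+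
  show "\<not> E y x"
  proof
    assume e: "E y x"
    have "\<not> E y x'" using triangle_free e i(3) by blast
    moreover have "\<not> E x u" if "u \<in> set (up (i + 1))" for u
      using B_nbD[OF i(1)] that up_props(5)[of "i + 1"] by auto
    moreover have "\<not> E y u" if "u \<in> set (up (i + 1))" for u
      using Z_no_v(1)[OF assms(2)] that up_props(5)[of "i + 1"] by blast
    ultimately show False using B_no_tail[OF i(2,3) e _ ne(2) r(1,3), of "up (i + 1)"] by blast
  qed
  show "\<not> E y x'"
  proof
    assume e: "E y x'"
    have "\<not> E y x" using triangle_free e i(3) E_sym by blast
    moreover have "\<not> E x' u" if "u \<in> set (dn i)" for u
      using B_nbD[OF i(2)] that dn_props(5)[of i] by auto
    moreover have "\<not> E y u" if "u \<in> set (dn i)" for u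
      using Z_no_v(1)[OF assms(2)] that dn_props(5)[of i] by blast
    ultimately show False using B_no_tail[OF i(1) E_sym[OF i(3)] e _ ne(1) r(2,3), of "dn i"] by blast
  qed
qed

text \<open>If \<open>y2\<close> misses \<open>x0\<close>, then \<open>y2\<close>,
  \<open>x1\<close>, \<open>y1\<close>, \<open>x0\<close> and all vertices of the cycle except
  \<open>v (i + 1)\<close> and \<open>v (i + 2)\<close> form an induced P_k. If \<open>y2\<close>
  sees \<open>x0\<close>, it is a common neighbour of vertices whose classes differ by 4, which
  forces \<open>x2\<close>.\<close>

lemma stepZ_stepZ:
  assumes "stepZ x0 x1" "stepZ x1 x2" shows "FL x2"
proof -
  obtain i y1 where i: "B i x0" "B (i + 2) x1" "y1 \<in> Z" "E y1 x0" "E y1 x1"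
    using assms(1) by (auto simp: stepZ_def)
  obtain j y2 where j: "B j x1" "B (j + 2) x2" "y2 \<in> Z" "E y2 x1" "E y2 x2"
    using assms(2) by (auto simp: stepZ_def)
  have d: "q dvd (j + 2) - i - 4" using B_unique[OF j(1) i(2)] by (simp add: algebra_simps)
  have "E y2 x0"
  proof (rule ccontr)
    assume n: "\<not> E y2 x0"
    define L where "L = arc (\<lambda>j. v (- j)) (- i) (nat q - 2)"
    have cf: "icyc q (\<lambda>j. v (- j))" using icyc_flip[OF cyc] .
    have L: "ipath L" "length L = nat q - 2" "hd L = v i" "set L = (\<lambda>j. v (- j)) ` {- i..< - i + int (nat q - 2)}"
      "set (tl L) = (\<lambda>j. v (- j)) ` {- i + 1..< - i + int (nat q - 2)}"
      unfolding L_def using ipath_arc[OF cf, of "nat q - 2" "- i"] q5 by (auto simp: set_arc set_tl_arc hd_arc)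
    have "L \<noteq> []" using L(2) q5 by auto
    have L2: "v (i + 2) \<notin> set L"
    proof
      assume "v (i + 2) \<in> set L"
      then obtain m where m: "m \<in> {- i..< - i + int (nat q - 2)}" "v (i + 2) = v (- m)" using L(4) by auto
      then have "q dvd i + 2 - - m" using icyc_eq[OF cyc] by blast
      then show False using dvd_smallD[of q "i + 2 - - m"] m(1) q5 by auto
    qed
    have Li: "v i \<notin> set (tl L)"
    proof
      assume "v i \<in> set (tl L)"
      then obtain m where m: "m \<in> {- i + 1..< - i + int (nat q - 2)}" "v i = v (- m)" using L(5) by auto
      then have "q dvd i - - m" using icyc_eq[OF cyc] by blast
      then show False using dvd_smallD[of q "i - - m"] m(1) q5 by auto
    qed
    have Lr: "set L \<subseteq> range v" "set (tl L) \<subseteq> range v" using L(4,5) by auto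
    have x0L: "\<not> E x0 u" if "u \<in> set (tl L)" for u using B_nbD[OF i(1), of u] that Li Lr by blast
    have x1L: "\<not> E x1 u" if "u \<in> set L" for u using B_nbD[OF i(2), of u] that L2 Lr by blast
    have nr: "x0 \<notin> set L" "x1 \<notin> set L" "y1 \<notin> set L" "y2 \<notin> set L"
      using Lr(1) B_not_v[OF i(1)] B_not_v[OF i(2)] Z_no_v(2)[OF i(3)] Z_no_v(2)[OF j(3)] by blast+
    have yL: "\<not> E y1 u" "\<not> E y2 u" if "u \<in> set L" for u
      using Z_no_v(1)[OF i(3)] Z_no_v(1)[OF j(3)] that Lr(1) by blast+
    have "ipath (x0 # L)" using L(1,3) x0L nr(1) B_V[OF i(1)] i(1) by (simp add: B_def)
    moreover have "y1 \<noteq> x0" "x1 \<noteq> y1" "y2 \<noteq> x1" using i j E_irrefl by blast+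
    moreover have "\<not> E x1 x0" using triangle_free i(4,5) E_sym by blast
    moreover have "x1 \<noteq> x0"
    proof
      assume "x1 = x0"
      then have "q dvd i - (i + 2)" using B_unique i by blast
      then show False using nod[of "i - (i + 2)"] by auto
    qed
    moreover have "y2 \<noteq> x0" "y2 \<noteq> y1" using i j n Z_N1_disj B_N1 by blast+
    moreover have "\<not> E y2 y1" using Z_independent i j by blast
    ultimately have "ipath (y2 # x1 # y1 # x0 # L)"
      using i(3-5) j(3,4) n E_sym[OF i(5)] x1L yL nr B_V[OF i(2)] Z_no_v(3) by auto
    moreover have "length (y2 # x1 # y1 # x0 # L) = nat q + 2" using L(2) q5 by simp
    ultimately show False using length_k by blast
  qed
  then show ?thesis using common_forced(2)[OF i(1) j(2) _ j(5) d] by blast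
qed

text \<open>Each edge step raises the class by one, so after \<open>Q = q\<close> steps the chain is
  back in the class of \<open>p 0\<close>. Then \<open>p 0\<close>, \<open>v i\<close>,
  \<open>p Q\<close>, \<open>p (Q + 1)\<close>, \<open>p (Q + 2)\<close> and an arc of
  \<open>q - 3\<close> vertices from \<open>v (i + 2)\<close> form an induced path on
  \<open>q + 2 = k\<close> vertices.\<close>

lemma no_long_E_chain:
  assumes n: "n \<ge> nat q + 3"
    and E_step: "\<And>t. t < n \<Longrightarrow> stepE (p t) (p (Suc t))"
    and ind: "\<And>i j. i < j \<Longrightarrow> j \<le> n \<Longrightarrow> stepE (p i) (p j) \<Longrightarrow> j = Suc i"
    and H: "\<And>i. i \<le> n \<Longrightarrow> FH (p i) \<Longrightarrow> i = n"
    and inj: "inj_on p {..n}"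
  shows False
proof -
  obtain i where "B i (p 0)" using E_step[of 0] n by (auto simp: stepE_def)
  have pB: "B (i + int t) (p t)" if "t \<le> n" for t
    using that
  proof (induction t)
    case (Suc t)
    obtain j where j: "B j (p t)" "B (j + 1) (p (Suc t))" using E_step[of t] Suc by (auto simp: stepE_def)
    have "q dvd j - (i + int t)" using B_unique[OF j(1)] Suc by auto
    then have "q dvd (j + 1) - (i + int (Suc t))" by (simp add: algebra_simps)
    then show ?case using B_cong[OF j(2)] by blast
  qed (use \<open>B i (p 0)\<close> in simp)
  have pE: "E (p t) (p (Suc t))" if "t < n" for t using E_step[OF that] by (auto simp: stepE_def)
  define Q where "Q = nat q"
  have Q: "int Q = q" "Q \<ge> 5" using q5 by (auto simp: Q_def)
  \<comment> \<open>Strictness matters: the vertices used must come before the end of the chain, as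
    only \<open>p n\<close> may be forced high.\<close>
  have nn: "Q + 2 < n" using n by (simp add: Q_def)
  have bi: "B i (p Q)" "B (i + 1) (p (Q + 1))" "B (i + 2) (p (Q + 2))"
    using B_cong[OF pB[of Q], of i] B_cong[OF pB[of "Q + 1"], of "i + 1"]
      B_cong[OF pB[of "Q + 2"], of "i + 2"] n Q by (auto simp: Q_def)
  have b0: "B i (p 0)" by fact
  \<comment> \<open>Classes at distance 2 can be joined only if 2 is congruent to -3, that is for
    \<open>q = 5\<close>; the reversed edge then has difference 3 and forces \<open>p t\<close>
    high.\<close>
  have no2: "\<not> E (p s) (p t)" if st: "s < t" "t < n" "B j (p s)" "B (j + 2) (p t)" for s t j
  proof
    assume e: "E (p s) (p t)"
    obtain d where d: "d \<in> {1, -1, 3, -3}" "q dvd j + 2 - j - d" by (rule edge_diff[OF st(3,4) e])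
    have "d = -3" using d nod[of "j + 2 - j - d"] by auto
    then have "q dvd j - (j + 2) - 3" using d(2) by simp
    then have "FH (p t)" using edge_forced(1)[OF st(4,3) E_sym[OF e]] by blast
    then show False using H[of t] st by auto
  qed
  have no0: "\<not> E (p 0) (p Q)"
  proof
    assume e: "E (p 0) (p Q)"
    obtain d where d: "d \<in> {1, -1, 3, -3}" "q dvd i - i - d" by (rule edge_diff[OF b0 bi(1) e])
    then show False using nod[of "i - i - d"] by auto
  qed
  \<comment> \<open>This edge would be a step that skips \<open>Q\<close> vertices of a chain
    without shortcuts.\<close>
  have no1: "\<not> E (p 0) (p (Q + 1))"
  proof
    assume e: "E (p 0) (p (Q + 1))"
    then have "stepE (p 0) (p (Q + 1))" using b0 bi by (auto simp: stepE_def)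
    then have "Q + 1 = Suc 0" by (rule ind[rotated 2]) (use nn in simp_all)
    then show False using Q(2) by simp
  qed
  \<comment> \<open>The arc leaves out \<open>v (i - 1)\<close>, \<open>v i\<close> and
    \<open>v (i + 1)\<close>, so \<open>v i\<close> sees none of it.\<close>
  define a where "a = arc v (i + 2) (nat q - 3)"
  have a: "ipath a" "length a = nat q - 3" "hd a = v (i + 2)" "set a = v ` {i + 2..<i + 2 + int (nat q - 3)}"
    "set (tl a) = v ` {i + 3..<i + 2 + int (nat q - 3)}"
    unfolding a_def using ipath_arc[OF cyc, of "nat q - 3" "i + 2"] q5 set_tl_arc[of v "i + 2" "nat q - 3"]
    by (auto simp: set_arc hd_arc)
  have "a \<noteq> []" using a(2) q5 by auto
  have na: "v m \<notin> set a" if "m \<in> {i, i + 1}" for m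
  proof
    assume "v m \<in> set a"
    then obtain l where l: "l \<in> {i + 2..<i + 2 + int (nat q - 3)}" "v m = v l" using a(4) by auto
    then have "q dvd m - l" using icyc_eq[OF cyc] by blast
    then show False using dvd_smallD[of q "m - l"] l(1) q5 that by auto
  qed
  have nta: "v (i + 2) \<notin> set (tl a)"
    using a(1,3) \<open>a \<noteq> []\<close> by (cases a) auto
  have ar: "set a \<subseteq> range v" "set (tl a) \<subseteq> range v" using a(4,5) by auto
  have vi: "\<not> E (v i) u" if "u \<in> set a" for u
  proof
    assume e: "E (v i) u"
    obtain l where l: "l \<in> {i + 2..<i + 2 + int (nat q - 3)}" "u = v l" using a(4) \<open>u \<in> set a\<close> by auto
    then have "near q i l" using e icyc_E[OF cyc] by blast
    then show False using dvd_smallD[of q "i - l - 1"] dvd_smallD[of q "i - l + 1"] l(1) q5 by (auto simp: near_def)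
  qed
  have pV: "p t \<in> V" "p t \<notin> range v" if "t \<le> n" for t using pB[OF that] B_V B_not_v by blast+
  have pne: "p s \<noteq> p t" if "s \<le> n" "t \<le> n" "s \<noteq> t" for s t using inj_onD[OF inj, of s t] that by auto
  have ba: "\<not> E x u" if "B m x" "m \<in> {i, i + 1}" "u \<in> set a" for x m u
    using B_nbD[OF that(1), of u] na[OF that(2)] that(3) ar by blast
  have bE: "E x (v m)" if "B m x" for x m using that by (simp add: B_def)
  have vne: "v m \<noteq> p t" "p t \<noteq> v m" if "t \<le> n" for t m using pV(2)[OF that] by (metis rangeI)+
  have nr: "p t \<notin> set a" if "t \<le> n" for t using pV(2)[OF that] ar(1) by blast
  have c: "\<not> E (p (Q + 2)) u" if "u \<in> set (tl a)" for u
    using B_nbD[OF bi(3), of u] that nta ar(2) by blast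
  have 1: "ipath (p (Q + 2) # a)"
    using a(1,3) pV(1)[of "Q + 2"] nr[of "Q + 2"] nn bE[OF bi(3)] c by simp
  have 2: "ipath (p (Q + 1) # p (Q + 2) # a)"
    using 1 pV(1)[of "Q + 1"] nr[of "Q + 1"] nn pE[of "Q + 1"] pne[of "Q + 1" "Q + 2"] ba[OF bi(2)] by simp
  have "\<not> E (p Q) (p (Q + 2))" using no2[OF _ _ bi(1,3)] nn by simp
  then have 3: "ipath (p Q # p (Q + 1) # p (Q + 2) # a)"
    using 2 pV(1)[of Q] nr[of Q] nn pE[of Q] pne[of Q "Q + 1"] pne[of Q "Q + 2"] ba[OF bi(1)] by simp
  have "E (v i) (p Q)" using bE[OF bi(1)] E_sym by blast
  moreover have "\<not> E (v i) (p (Q + 1))"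
  proof
    assume "E (v i) (p (Q + 1))"
    then have "q dvd i + 1 - i" using bi(2) E_sym unfolding B_def by blast
    then show False using nod[of "i + 1 - i"] by auto
  qed
  moreover have "\<not> E (v i) (p (Q + 2))"
  proof
    assume "E (v i) (p (Q + 2))"
    then have "q dvd i + 2 - i" using bi(3) E_sym unfolding B_def by blast
    then show False using nod[of "i + 2 - i"] by auto
  qed
  moreover have "v i \<notin> {p Q, p (Q + 1), p (Q + 2)}"
    using vne[of Q i] vne[of "Q + 1" i] vne[of "Q + 2" i] nn by simp
  ultimately have 4: "ipath (v i # p Q # p (Q + 1) # p (Q + 2) # a)"
    using 3 v_V na[of i] vi by simp
  have "p 0 \<notin> {p Q, p (Q + 1), p (Q + 2)}" using pne[of 0 Q] pne[of 0 "Q + 1"] pne[of 0 "Q + 2"] nn Q by auto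
  moreover have "p 0 \<noteq> v i" "p 0 \<notin> set a" using vne[of 0 i] nr[of 0] by auto
  moreover have "\<not> E (p 0) (p (Q + 2))" using no2[OF _ _ b0 bi(3)] nn by simp
  ultimately have "ipath (p 0 # v i # p Q # p (Q + 1) # p (Q + 2) # a)"
    using 4 no0 no1 bE[OF b0] ba[OF b0] B_V[OF b0] by simp
  moreover have "nat q \<ge> 5" using q5 by simp
  then have "length (p 0 # v i # p Q # p (Q + 1) # p (Q + 2) # a) = nat q + 2" using a(2) by simp
  ultimately show False using length_k by blast
qed

text \<open>A shortest chain with at least two steps consists of edge steps: two consecutive steps
  through \<open>Z\<close> would force a vertex other than the first one low, and the kinds do not
  mix. Long chains of edges being impossible, the chain, its common neighbours and the certificates
  fit into one colourable set, where low spreads from one end to the other.\<close>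

lemma no_chain:
  assumes "FL a" "step\<^sup>*\<^sup>* a b" "FH b" shows False
proof -
  obtain n and p :: "nat \<Rightarrow> 'a" where p: "FL (p 0)" "FH (p n)" "\<And>i. i < n \<Longrightarrow> step (p i) (p (Suc i))"
    "\<And>i j. i < j \<Longrightarrow> j \<le> n \<Longrightarrow> step (p i) (p j) \<Longrightarrow> j = Suc i"
    "\<And>i. i \<le> n \<Longrightarrow> FL (p i) \<Longrightarrow> i = 0"
    "\<And>i. i \<le> n \<Longrightarrow> FH (p i) \<Longrightarrow> i = n" "inj_on p {..n}"
    by (rule shortest_chain[OF assms(2), of "Collect FL" "Collect FH"]) (use assms in auto)
  have two: "stepE (p t) (p (Suc t)) \<and> stepE (p (Suc t)) (p (Suc (Suc t)))" if "Suc t < n" for t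
  proof -
    have s: "step (p t) (p (Suc t))" "step (p (Suc t)) (p (Suc (Suc t)))" using p(3) that by auto
    have "\<not> FL (p (Suc (Suc t)))" using p(5)[of "Suc (Suc t)"] that by auto
    then have "\<not> (stepZ (p t) (p (Suc t)) \<and> stepZ (p (Suc t)) (p (Suc (Suc t))))" using stepZ_stepZ by blast
    moreover have "\<not> (stepZ x y \<and> stepE y z)" "\<not> (stepE x y \<and> stepZ y z)" for x y z
      using stepE_no_Z unfolding stepZ_def by blast+
    ultimately show ?thesis using s unfolding step_def by blast
  qed
  have "n < nat q + 3"
  proof (rule ccontr)
    assume "\<not> n < nat q + 3"
    then have n: "n \<ge> nat q + 3" by simp
    have "stepE (p t) (p (Suc t))" if "t < n" for t
    proof (cases t)
      case 0
      then show ?thesis using two[of 0] n q5 by auto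
    next
      case (Suc s)
      then show ?thesis using two[of s] that by auto
    qed
    then show False using no_long_E_chain[OF n, of p] p unfolding step_def by blast
  qed
  obtain i0 S0 where S0: "B i0 (p 0)" "S0 \<subseteq> V" "card S0 \<le> 2"
    "\<And>f. good f (insert (p 0) S0) \<Longrightarrow> q dvd f (p 0) - (i0 - 1)" using p(1) unfolding FL_def by blast
  obtain i1 S1 where S1: "B i1 (p n)" "S1 \<subseteq> V" "card S1 \<le> 2"
    "\<And>f. good f (insert (p n) S1) \<Longrightarrow> q dvd f (p n) - (i1 + 1)" using p(2) unfolding FH_def by blast
  \<comment> \<open>For an edge step \<open>y\<close> is a dummy, so that one function serves all
    steps.\<close>
  have "\<exists>y\<in>V. stepE (p t) (p (Suc t)) \<or>
      (\<exists>i. B i (p t) \<and> B (i + 2) (p (Suc t)) \<and> E y (p t) \<and> E y (p (Suc t)))" if "t < n" for t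
    using p(3)[OF that] B_V Z_no_v(3) unfolding step_def stepZ_def stepE_def by blast
  then obtain y where y: "\<And>t. t < n \<Longrightarrow> y t \<in> V" "\<And>t. t < n \<Longrightarrow> stepE (p t) (p (Suc t)) \<or>
      (\<exists>i. B i (p t) \<and> B (i + 2) (p (Suc t)) \<and> E (y t) (p t) \<and> E (y t) (p (Suc t)))" by metis
  have pV: "p t \<in> V" if "t \<le> n" for t
  proof (cases t)
    case 0
    then show ?thesis using S0(1) B_V by simp
  next
    case (Suc s)
    then have "step (p s) (p t)" using p(3)[of s] that by simp
    then show ?thesis using B_V unfolding step_def stepZ_def stepE_def by blast
  qed
  \<comment> \<open>At most \<open>2 * n + 1\<close> chain vertices and common neighbours plus four
    certificate vertices, where \<open>n \<le> q + 2\<close>.\<close>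
  define S where "S = (p ` {..n} \<union> y ` {..<n}) \<union> (S0 \<union> S1)"
  have "card (p ` {..n} \<union> y ` {..<n}) \<le> Suc n + n"
    using card_Un_le[of "p ` {..n}" "y ` {..<n}"] card_image_le[of "{..n}" p] card_image_le[of "{..<n}" y] by simp
  moreover have "card (S0 \<union> S1) \<le> 4" using card_Un_le[of S0 S1] S0(3) S1(3) by simp
  ultimately have "card S \<le> 2 * nat q + 34"
    using card_Un_le[of "p ` {..n} \<union> y ` {..<n}" "S0 \<union> S1"] \<open>n < nat q + 3\<close> unfolding S_def by linarith
  moreover have "S \<subseteq> V" using pV y(1) S0(2) S1(2) by (auto simp: S_def)
  ultimately obtain f where f: "good f S" using local_good by blast
  have low: "\<exists>i. B i (p t) \<and> q dvd f (p t) - (i - 1)" if "t \<le> n" for t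
    using that
  proof (induction t)
    case 0
    have "insert (p 0) S0 \<subseteq> S" by (auto simp: S_def)
    then show ?case using S0(1,4) good_mono[OF f] by blast
  next
    case (Suc t)
    then obtain i where i: "B i (p t)" "q dvd f (p t) - (i - 1)" by auto
    have pS: "p t \<in> S" "p (Suc t) \<in> S" "y t \<in> S" using Suc.prems by (auto simp: S_def)
    have tr: "q dvd f (p t) - (j - 1)" if "B j (p t)" for j
    proof -
      have "q dvd i - j" using B_unique i(1) that by blast
      then show ?thesis using i(2) by algebra
    qed
    from y(2)[of t] Suc.prems consider "stepE (p t) (p (Suc t))" |
      "\<exists>i. B i (p t) \<and> B (i + 2) (p (Suc t)) \<and> E (y t) (p t) \<and> E (y t) (p (Suc t))" by auto
    then show ?case
    proof cases
      case 1
      then obtain j where "B j (p t)" "B (j + 1) (p (Suc t))" "E (p t) (p (Suc t))" by (auto simp: stepE_def)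
      then show ?thesis using stepE_low[OF f pS(1,2)] tr by blast
    next
      case 2
      then show ?thesis using stepZ_low[OF f pS] tr by blast
    qed
  qed
  obtain i where i: "B i (p n)" "q dvd f (p n) - (i - 1)" using low by blast
  have "insert (p n) S1 \<subseteq> S" by (auto simp: S_def)
  then have "q dvd f (p n) - (i1 + 1)" using S1(4) good_mono[OF f] by blast
  moreover have "q dvd i - i1" using B_unique i(1) S1(1) by blast
  ultimately have "q dvd 2" using i(2) by algebra
  then show False using nod by blast
qed

section \<open>The colouring and its verification\<close>

definition low where "low x \<longleftrightarrow> (\<exists>a. FL a \<and> step\<^sup>*\<^sup>* a x)"
text \<open>The least solution of the implications: high is the default, low is used only where a
  chain demands it.\<close>

definition val where "val i x = (if low x then i - 1 else i + 1)"
text \<open>Indices are determined only modulo \<open>q\<close>; the choice commits to one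
  representative.\<close>

definition F where "F x = (SOME c. (\<exists>i. x = v i \<and> c = i) \<or> (\<exists>i. A i x \<and> c = i) \<or> (\<exists>i. B i x \<and> c = val i x))"

lemma F_spec:
  assumes "x \<in> range v \<or> x \<in> N1"
  shows "(\<exists>i. x = v i \<and> F x = i) \<or> (\<exists>i. A i x \<and> F x = i) \<or> (\<exists>i. B i x \<and> F x = val i x)"
  unfolding F_def
proof (rule someI_ex)
  show "\<exists>c. (\<exists>i. x = v i \<and> c = i) \<or> (\<exists>i. A i x \<and> c = i) \<or> (\<exists>i. B i x \<and> c = val i x)"
    using assms N1_cases[of x] by (metis rangeE)
qed

lemma F_v: "q dvd F (v i) - i"
proof -
  have "\<not> A j (v i)" "\<not> B j (v i)" for j by (auto simp: A_def B_def)
  then obtain j where "v i = v j" "F (v i) = j" using F_spec[of "v i"] by blast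
  then show ?thesis using icyc_eq[OF cyc] dvd_sym by metis
qed

lemma F_A: assumes "A i x" shows "q dvd F x - i"
proof -
  have "x \<notin> range v" "x \<in> N1" using assms A_N1 by (auto simp: A_def)
  then obtain j where j: "A j x" "F x = j" using F_spec[of x] not_A_B assms by blast
  obtain f where f: "good f {x}" using small_good[of "{x}"] assms by (auto simp: A_def)
  have "q dvd f x - i" "q dvd f x - j" using A_color[OF f] assms j by auto
  then show ?thesis using j(2) by algebra
qed

lemma F_B: assumes "B i x" shows "q dvd F x - val i x"
proof -
  have "x \<notin> range v" "x \<in> N1" using assms B_N1 B_not_v by blast+
  then obtain j where j: "B j x" "F x = val j x" using F_spec[of x] not_A_B assms by blast
  have "q dvd j - i" using B_unique assms j(1) by blast
  then show ?thesis using j(2) by (simp add: val_def)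
qed

lemma low_not_FH: "low x \<Longrightarrow> \<not> FH x" using no_chain unfolding low_def by blast
lemma FL_low: "FL x \<Longrightarrow> low x" unfolding low_def by blast
lemma low_step: "low x \<Longrightarrow> step x x' \<Longrightarrow> low x'"
  unfolding low_def by (meson rtranclp.rtrancl_into_rtrancl)

text \<open>The partner \<open>x'\<close> has a fixed colour. If \<open>x\<close> has type
  \<open>B\<close> and its value violated \<open>Q\<close>, every colouring of \<open>x\<close>,
  \<open>x'\<close> and \<open>S\<close> would give \<open>x\<close> the other value, so
  \<open>x\<close> would be forced against \<open>low\<close>. \<open>Q\<close> stands for adjacency
  and for having a common neighbour.\<close>

lemma pair_with_A:
  assumes "x \<in> N1" "A j x'" "S \<subseteq> V" "card S \<le> 1"
    and Q: "\<And>f. good f (insert x (insert x' S)) \<Longrightarrow> Q (f x) (f x')"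
    and Qcong: "\<And>a b a' b'. Q a b \<Longrightarrow> q dvd a - a' \<Longrightarrow> q dvd b - b' \<Longrightarrow> Q a' b'"
  shows "Q (F x) (F x')"
proof -
  have x'V: "x' \<in> V" "x \<in> V" using assms(1,2) by (auto simp: A_def N1_def)
  have "finite S" using assms(3) finV finite_subset by blast
  then have c: "card (insert x' S) \<le> 2" "card (insert x (insert x' S)) \<le> 34"
    using assms(4) by (auto simp: card_insert_if)
  have tr: "Q (F x) (F x')" if "good f (insert x (insert x' S))" "q dvd f x - F x" for f
  proof -
    have "q dvd f x' - j" using A_color[OF that(1) _ assms(2)] by simp
    moreover have "q dvd F x' - j" using F_A assms(2) by blast
    ultimately have "q dvd f x' - F x'" by algebra
    then show ?thesis using Qcong Q that by blast
  qed
  from assms(1) show ?thesis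
  proof (cases rule: N1_cases)
    case (1 i)
    obtain f where f: "good f (insert x (insert x' S))"
      using small_good[of "insert x (insert x' S)"] x'V assms(3) c by auto
    have "q dvd f x - i" "q dvd F x - i" using A_color[OF f _ 1] F_A[OF 1] by auto
    then have "q dvd f x - F x" by algebra
    then show ?thesis using tr f by blast
  next
    case (2 i)
    show ?thesis
    proof (rule ccontr)
      assume n: "\<not> Q (F x) (F x')"
      have *: "\<not> q dvd f x - val i x" if "good f (insert x (insert x' S))" for f
      proof
        assume "q dvd f x - val i x"
        then have "q dvd f x - F x" using F_B[OF 2] by algebra
        then show False using tr n that by blast
      qed
      have bc: "q dvd f x - (i - 1) \<or> q dvd f x - (i + 1)" if "good f (insert x (insert x' S))" for f
        using B_color[OF that _ 2] by simp
      show False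
      proof (cases "low x")
        case True
        then have "\<forall>f. good f (insert x (insert x' S)) \<longrightarrow> q dvd f x - (i + 1)"
          using * bc by (auto simp: val_def)
        then have "FH x" unfolding FH_def using 2 c(1) x'V assms(3) by (intro exI[of _ i] exI[of _ "insert x' S"]) auto
        then show False using True low_not_FH by blast
      next
        case False
        then have "\<forall>f. good f (insert x (insert x' S)) \<longrightarrow> q dvd f x - (i - 1)"
          using * bc by (auto simp: val_def)
        then have "FL x" unfolding FL_def using 2 c(1) x'V assms(3) by (intro exI[of _ i] exI[of _ "insert x' S"]) auto
        then show False using False FL_low by blast
      qed
    qed
  qed
qed

text \<open>Difference 1 is a step and difference 3 forces both ends; negative differences are
  covered by exchanging the ends.\<close>

lemma F_near_BB:
  assumes "B i x" "B j x'" "E x x'" "q dvd j - i - 1 \<or> q dvd j - i - 3"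
  shows "near q (F x) (F x')"
proof -
  have "near q (val i x) (val j x')"
    using assms(4)
  proof
    assume d: "q dvd j - i - 1"
    then have "B (i + 1) x'" using B_cong[OF assms(2), of "i + 1"] by (simp add: algebra_simps)
    then have "step x x'" using assms by (auto simp: step_def stepE_def)
    then have "low x' \<or> \<not> low x" using low_step by blast
    moreover have "q dvd i + 1 - (j - 1) - 1" "q dvd i - 1 - (j - 1) + 1" "q dvd i + 1 - (j + 1) + 1"
      using d by algebra+
    then have "near q (i + 1) (j - 1)" "near q (i - 1) (j - 1)" "near q (i + 1) (j + 1)"
      unfolding near_def by blast+
    ultimately show ?thesis by (auto simp: val_def)
  next
    assume d: "q dvd j - i - 3"
    have "FH x" "FL x'" using edge_forced[OF assms(1-3) d] .
    then have "\<not> low x" "low x'" using low_not_FH FL_low by blast+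
    moreover have "q dvd i + 1 - (j - 1) + 1" using d by algebra
    ultimately show ?thesis by (simp add: val_def near_def)
  qed
  then show ?thesis using near_cong F_B[OF assms(1)] F_B[OF assms(2)] dvd_sym by blast
qed

text \<open>Difference 0 allows every pair of choices, difference 2 is a step through
  \<open>Z\<close>, and difference 4 forces both ends.\<close>

lemma F_dif2_BB:
  assumes "B i x" "B j x'" "E y x" "E y x'" "y \<in> Z" "q dvd j - i \<or> q dvd j - i - 2 \<or> q dvd j - i - 4"
  shows "dif2 q (F x) (F x')"
proof -
  have "dif2 q (val i x) (val j x')"
    using assms(6)
  proof (elim disjE)
    assume d: "q dvd j - i"
    have "q dvd i + 1 - (j + 1)" "q dvd i - 1 - (j - 1)" "q dvd i + 1 - (j - 1) - 2" "q dvd i - 1 - (j + 1) + 2"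
      using d by algebra+
    then show ?thesis by (auto simp: val_def dif2_def)
  next
    assume d: "q dvd j - i - 2"
    then have "B (i + 2) x'" using B_cong[OF assms(2), of "i + 2"] by (simp add: algebra_simps)
    then have "step x x'" using assms by (auto simp: step_def stepZ_def)
    then have "low x' \<or> \<not> low x" using low_step by blast
    moreover have "q dvd i + 1 - (j - 1)" "q dvd i - 1 - (j - 1) + 2" "q dvd i + 1 - (j + 1) + 2"
      using d by algebra+
    ultimately show ?thesis by (auto simp: val_def dif2_def)
  next
    assume d: "q dvd j - i - 4"
    have "FH x" "FL x'" using common_forced[OF assms(1-4) d] .
    then have "\<not> low x" "low x'" using low_not_FH FL_low by blast+
    moreover have "q dvd i + 1 - (j - 1) + 2" using d by algebra
    ultimately show ?thesis by (simp add: val_def dif2_def)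
  qed
  then show ?thesis using dif2_cong F_B[OF assms(1)] F_B[OF assms(2)] dvd_sym by blast
qed

lemma F_near:
  assumes "x \<in> N1" "x' \<in> N1" "E x x'" shows "near q (F x) (F x')"
proof -
  have A: "near q (F x) (F x')" if "x \<in> N1" "A j x'" "E x x'" for x x' j
    by (rule pair_with_A[OF that(1,2), of "{}" "near q"])
      (use that(3) good_E near_cong in \<open>auto\<close>)
  from assms(1) show ?thesis
  proof (cases rule: N1_cases)
    case (1 i)
    then show ?thesis using A[OF assms(2) 1] E_sym near_sym assms(3) by blast
  next
    case Bi: (2 i)
    from assms(2) show ?thesis
    proof (cases rule: N1_cases)
      case (1 j)
      then show ?thesis using A assms by blast
    next
      case Bj: (2 j)
      obtain d where d: "d \<in> {1, -1, 3, -3}" "q dvd j - i - d" by (rule edge_diff[OF Bi Bj assms(3)])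
      have "q dvd i - j - (- d)" using d(2) by algebra
      then show ?thesis
        using F_near_BB[OF Bi Bj assms(3)] near_sym[OF F_near_BB[OF Bj Bi E_sym[OF assms(3)]]] d by auto
    qed
  qed
qed

lemma F_dif2:
  assumes "x \<in> N1" "x' \<in> N1" "E y x" "E y x'" "y \<in> Z" shows "dif2 q (F x) (F x')"
proof -
  have A: "dif2 q (F x) (F x')" if "x \<in> N1" "A j x'" "E y x" "E y x'" for x x' j
  proof (rule pair_with_A[OF that(1,2), of "{y}" "dif2 q"])
    show "dif2 q (f x) (f x')" if "good f (insert x (insert x' {y}))" for f
      using good_E[OF that, of y x] good_E[OF that, of y x'] \<open>E y x\<close> \<open>E y x'\<close>
      by (intro near_near_dif2[of q "f y"]) auto
  qed (use assms(5) Z_no_v dif2_cong in auto)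
  from assms(1) show ?thesis
  proof (cases rule: N1_cases)
    case (1 i)
    then show ?thesis using A[OF assms(2) 1] dif2_sym assms by blast
  next
    case Bi: (2 i)
    from assms(2) show ?thesis
    proof (cases rule: N1_cases)
      case (1 j)
      then show ?thesis using A assms by blast
    next
      case Bj: (2 j)
      obtain d where d: "d \<in> {0, 2, -2, 4, -4}" "q dvd j - i - d" by (rule common_diff[OF Bi Bj assms(3,4)])
      have "q dvd i - j - (- d)" using d(2) by algebra
      then show ?thesis
        using F_dif2_BB[OF Bi Bj assms(3-5)] dif2_sym[OF F_dif2_BB[OF Bj Bi assms(4,3,5)]] d by auto
    qed
  qed
qed

lemma F_near_v: "x \<in> N1 \<Longrightarrow> E x (v i) \<Longrightarrow> near q (F x) (F (v i))"
proof -
  assume a: "x \<in> N1" "E x (v i)"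
  have "near q (F x) i"
    using a(1)
  proof (cases rule: N1_cases)
    case (1 j)
    have "near q j i" using A_nb[OF 1 a(2)] unfolding near_def
    proof
      assume "q dvd i - (j + 1)"
      then have "q dvd j - i + 1" by algebra
      then show "q dvd j - i - 1 \<or> q dvd j - i + 1" ..
    next
      assume "q dvd i - (j - 1)"
      then have "q dvd j - i - 1" by algebra
      then show "q dvd j - i - 1 \<or> q dvd j - i + 1" ..
    qed
    then show ?thesis using near_cong[OF _ dvd_sym[OF F_A[OF 1]]] by simp
  next
    case (2 j)
    then have "q dvd j - i" using a(2) by (auto simp: B_def)
    then have "near q (val j x) i"
      unfolding val_def near_def by (cases "low x") (simp_all add: algebra_simps)
    then show ?thesis using near_cong[OF _ dvd_sym[OF F_B[OF 2]]] by simp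
  qed
  then show ?thesis using near_cong[OF _ _ dvd_sym[OF F_v]] by simp
qed

text \<open>\<open>Z\<close> is independent, so its vertices can be coloured last and one by one, as
  the colours of the neighbours of each have a common neighbour in C_q.\<close>

lemma short_cycle_False: False
proof -
  define G where "G x = (if x \<in> Z then (SOME c. \<forall>u\<in>nb x. near q c (F u)) else F x)" for x
  have ZG: "near q (G z) (G u)" if "z \<in> Z" "E z u" for z u
  proof -
    have "u \<notin> Z" using Z_independent that by blast
    moreover have "u \<notin> range v" using Z_no_v(1)[OF that(1)] that(2) by blast
    ultimately have u: "u \<in> nb z" "G u = F u"
      using V_cases[of u] E_V2[OF that(2)] that(2) by (auto simp: nb_def G_def)
    have "\<exists>c. \<forall>u\<in>nb z. near q c (F u)"
    proof -
      have "dif2 q (F x) (F y)" if "x \<in> nb z" "y \<in> nb z" for x y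
        using F_dif2[of x y z] that \<open>z \<in> Z\<close> by (auto simp: nb_def)
      then obtain c where "\<And>x. x \<in> nb z \<Longrightarrow> near q c (F x)" using pairwise_near[of "nb z" F] by blast
      then show ?thesis by blast
    qed
    then have "\<forall>u\<in>nb z. near q (SOME c. \<forall>u\<in>nb z. near q c (F u)) (F u)" by (rule someI_ex)
    then show ?thesis using u that(1) by (simp add: G_def)
  qed
  have "near q (G x) (G y)" if xy: "E x y" for x y
  proof (cases "x \<in> Z \<or> y \<in> Z")
    case True
    then show ?thesis using ZG xy E_sym near_sym by blast
  next
    case False
    then have G: "G x = F x" "G y = F y" by (auto simp: G_def)
    have "x \<in> range v \<or> x \<in> N1" "y \<in> range v \<or> y \<in> N1" using False V_cases E_V[OF xy] E_V2[OF xy] by blast+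
    then consider i j where "x = v i" "y = v j" | i where "x = v i" "y \<in> N1" | i where "x \<in> N1" "y = v i"
      | "x \<in> N1" "y \<in> N1" by blast
    then show ?thesis
    proof cases
      case (1 i j)
      then have "near q i j" using xy icyc_E[OF cyc] by blast
      then show ?thesis using near_cong dvd_sym[OF F_v] G 1 by simp
    next
      case (2 i)
      then show ?thesis using F_near_v[OF 2(2), of i] near_sym xy E_sym G by simp
    next
      case (3 i)
      then show ?thesis using F_near_v xy G by simp
    next
      case 4
      then show ?thesis using F_near xy G by simp
    qed
  qed
  then have "hcol q V" unfolding hcol_def by blast
  then show False using notcol by blast
qed

end

section \<open>The case \<open>k = 5\<close> with an induced five-cycle\<close>

context ugraph
begin

text \<open>The bound on colours holds at every element of the type, so permuting colours never has
  to ask where a vertex lies.\<close>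

definition c3 :: "('a \<Rightarrow> nat) \<Rightarrow> 'a set \<Rightarrow> bool" where
  "c3 f S \<longleftrightarrow> (\<forall>x. f x < 3) \<and> (\<forall>u\<in>S. \<forall>w\<in>S. E u w \<longrightarrow> f u \<noteq> f w)"

lemma c3_E: "c3 f S \<Longrightarrow> x \<in> S \<Longrightarrow> y \<in> S \<Longrightarrow> E x y \<Longrightarrow> f x \<noteq> f y" by (auto simp: c3_def)
lemma c3_lt: "c3 f S \<Longrightarrow> f x < 3" by (auto simp: c3_def)

lemma near_3: "near 3 a b \<longleftrightarrow> a mod 3 \<noteq> b mod 3"
  unfolding near_def by presburger

lemma hcol_c3: "hcol 3 S \<longleftrightarrow> (\<exists>f. c3 f S)"
proof
  assume "hcol 3 S"
  then obtain f :: "'a \<Rightarrow> int" where f: "\<forall>u\<in>S. \<forall>w\<in>S. E u w \<longrightarrow> f u mod 3 \<noteq> f w mod 3"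
    unfolding hcol_def near_3 by blast
  have "nat (f u mod 3) \<noteq> nat (f w mod 3)" if "f u mod 3 \<noteq> f w mod 3" for u w
    using that by (simp add: eq_nat_nat_iff)
  then have "c3 (\<lambda>u. nat (f u mod 3)) S" using f unfolding c3_def by (auto simp: nat_less_iff)
  then show "\<exists>f. c3 f S" by blast
next
  assume "\<exists>f. c3 f S"
  then obtain f where f: "c3 f S" by blast
  have "int (f u) mod 3 \<noteq> int (f w) mod 3" if "u \<in> S" "w \<in> S" "E u w" for u w
    using c3_E[OF f that] c3_lt[OF f, of u] c3_lt[OF f, of w] by simp
  then show "hcol 3 S" unfolding hcol_def near_3 by (intro exI[of _ "\<lambda>u. int (f u)"]) blast
qed

lemma c3_permute:
  assumes f: "c3 f S" and "f u \<noteq> f w" and ab: "a < 3" "b < 3" "a \<noteq> (b::nat)"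
  obtains g where "c3 g S" "g u = a" "g w = b" "\<And>x y. g x = g y \<longleftrightarrow> f x = f y"
proof -
  \<comment> \<open>The colours 0, 1, 2 add up to 3, so \<open>3 - a - b\<close> is the third
    colour.\<close>
  define p where "p c = (if c = f u then a else if c = f w then b else 3 - a - b)" for c
  have lt: "p c < 3" for c using ab by (auto simp: p_def)
  have third: "c = 3 - i - j" if "c < 3" "i < 3" "j < 3" "c \<noteq> i" "c \<noteq> j" "i \<noteq> j" for c i j :: nat
    using that by auto
  have fuw: "f u < 3" "f w < 3" using c3_lt[OF f] by auto
  have h: "3 - a - b \<noteq> a" "3 - a - b \<noteq> b" "3 - f u - f w \<noteq> f u" "3 - f u - f w \<noteq> f w"
  proof -
    have "3 - x - y \<noteq> x \<and> 3 - x - y \<noteq> y" if "x < 3" "y < 3" "x \<noteq> y" for x y :: nat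
      using that by presburger
    then show "3 - a - b \<noteq> a" "3 - a - b \<noteq> b" "3 - f u - f w \<noteq> f u" "3 - f u - f w \<noteq> f w"
      using ab fuw \<open>f u \<noteq> f w\<close> by blast+
  qed
  obtain w3 a3 where w3: "w3 = 3 - f u - f w" "a3 = 3 - a - b" by blast
  have pv: "p (f u) = a" "p (f w) = b" "p w3 = a3"
    using h(3,4) \<open>f u \<noteq> f w\<close> by (simp_all add: p_def w3)
  have inj: "p c = p c' \<longleftrightarrow> c = c'" if "c < 3" "c' < 3" for c c'
  proof -
    have "c = f u \<or> c = f w \<or> c = w3" "c' = f u \<or> c' = f w \<or> c' = w3"
      using third that fuw \<open>f u \<noteq> f w\<close> w3 by blast+
    then show ?thesis using pv h[folded w3] ab(3) \<open>f u \<noteq> f w\<close> by metis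
  qed
  have inj_f: "p (f x) = p (f y) \<longleftrightarrow> f x = f y" for x y using inj c3_lt[OF f] by blast
  have "c3 (\<lambda>x. p (f x)) S" unfolding c3_def using lt inj_f c3_E[OF f] by blast
  then show ?thesis using that[of "\<lambda>x. p (f x)"] pv(1,2) inj_f by blast
qed

lemma odd_icyc_not_bip:
  assumes c: "icyc (int n) v" and "odd n"
  shows "\<not> bip (range v)"
proof
  assume "bip (range v)"
  then obtain b :: "'a \<Rightarrow> bool" where b: "\<forall>u\<in>range v. \<forall>w\<in>range v. E u w \<longrightarrow> b u \<noteq> b w"
    unfolding bip_def by blast
  have "(b (v (int i)) = b (v 0)) = even i" for i
  proof (induction i)
    case (Suc i)
    have "E (v (int i)) (v (int (Suc i)))" using icyc_E[OF c] by (simp add: near_def)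
    then have "b (v (int i)) \<noteq> b (v (int (Suc i)))" using b by blast
    then show ?case using Suc by auto
  qed simp
  from this[of n] have "b (v (int n)) \<noteq> b (v 0)" using \<open>odd n\<close> by simp
  moreover have "v (int n) = v 0" using icyc_eq[OF c] by simp
  ultimately show False by simp
qed

lemma two_colours_bip:
  assumes f: "c3 f S" and "\<And>u. u \<in> W \<Longrightarrow> f u \<noteq> c" "W \<subseteq> S" "c < 3"
  shows "bip W"
  unfolding bip_def
proof (intro exI[of _ "\<lambda>u. f u = (c + 1) mod 3"] ballI impI)
  fix u w assume uw: "u \<in> W" "w \<in> W" "E u w"
  have "f u \<noteq> f w" using c3_E[OF f _ _ uw(3)] uw(1,2) assms(3) by blast
  moreover have "f u \<noteq> c" "f w \<noteq> c" "f u < 3" "f w < 3" using uw(1,2) assms(2) c3_lt[OF f] by blast+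
  moreover have "c = 0 \<or> c = 1 \<or> c = 2" using \<open>c < 3\<close> by auto
  ultimately show "(f u = (c + 1) mod 3) \<noteq> (f w = (c + 1) mod 3)" by auto
qed

end

locale obstruction5 = obstruction V E 5 3 for V :: "'a set" and E
begin

text \<open>For \<open>k = 5\<close> the bound 3k + 28 is 43.\<close>

lemma local_c3: assumes "S \<subseteq> V" "card S \<le> 43" obtains f where "c3 f S"
  using local_col[of S] assms hcol_c3 by auto

lemma not_c3: "\<not> c3 f V" using notcol hcol_c3 by blast
lemma crit_c3: assumes "S \<subset> V" obtains f where "c3 f S" using crit[OF assms] hcol_c3 by blast

lemma no_P5:
  assumes "E a b" "E b c" "E c d" "E d e" "\<not> E a c" "\<not> E a d" "\<not> E a e" "\<not> E b d" "\<not> E b e" "\<not> E c e"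
  shows "a = c \<or> a = d \<or> a = e \<or> b = d \<or> b = e \<or> c = e"
proof (rule ccontr)
  assume "\<not> ?thesis"
  then have "ipath [a, b, c, d, e]"
    using assms E_V[OF assms(1)] E_V[OF assms(2)] E_V[OF assms(3)] E_V[OF assms(4)] E_V2[OF assms(4)]
      E_irrefl[of a] E_irrefl[of b] E_irrefl[of c] E_irrefl[of d] by (auto simp: E_irrefl)
  then show False using Pfree[of "[a, b, c, d, e]"] by simp
qed

lemma P5_free:
  assumes "E a b" "E b c" "E c d" "E d e" "\<not> E a c" "\<not> E a d" "\<not> E a e" "\<not> E b d" "\<not> E b e" "\<not> E c e"
  shows False
proof -
  have "a \<noteq> c" "a \<noteq> d" "a \<noteq> e" "b \<noteq> d" "b \<noteq> e" "c \<noteq> e" using assms E_sym by blast+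
  then show False using no_P5[OF assms] by blast
qed

lemma no_K4: assumes "E a b" "E a c" "E a d" "E b c" "E b d" "E c d" shows False
proof -
  have "{a, b, c, d} \<subseteq> V" using assms E_V E_V2 by blast
  moreover have "card {a, b, c, d} \<le> 43" by (simp add: card_insert_if)
  ultimately obtain f where f: "c3 f {a, b, c, d}" using local_c3 by blast
  have "f a \<noteq> f b" "f a \<noteq> f c" "f a \<noteq> f d" "f b \<noteq> f c" "f b \<noteq> f d" "f c \<noteq> f d"
    using c3_E[OF f] assms by auto
  then show False using c3_lt[OF f, of a] c3_lt[OF f, of b] c3_lt[OF f, of c] c3_lt[OF f, of d] by auto
qed

text \<open>An odd cycle among the neighbours of \<open>x\<close> would give an odd wheel with at
  most six vertices, which is not 3-colourable.\<close>

lemma nbhd_bip: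
  assumes "W \<subseteq> V" "\<And>w. w \<in> W \<Longrightarrow> E x w"
  shows "bip W"
proof (rule ccontr)
  assume "\<not> bip W"
  then obtain n v where v: "odd n" "icyc (int n) v" "range v \<subseteq> W"
    using shortest_odd_cycle assms(1) by metis
  have "n \<le> 5" using cycle_le v(2) by blast
  have "card (insert x (range v)) \<le> 43"
    using icyc_card[OF v(2)] icyc_finite[OF v(2)] \<open>n \<le> 5\<close> by (simp add: card_insert_if)
  moreover have "insert x (range v) \<subseteq> V" using v(3) assms E_V by blast
  ultimately obtain f where f: "c3 f (insert x (range v))" using local_c3 by blast
  have "f w \<noteq> f x" if "w \<in> range v" for w
    using c3_E[OF f, of x w] that v(3) assms(2) by force
  then have "bip (range v)" using two_colours_bip[OF f, of "range v" "f x"] c3_lt[OF f] by blast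
  then show False using odd_icyc_not_bip v by blast
qed

end

text \<open>A five-cycle has several 3-colouring patterns, so one of them, with \<open>d0\<close> as
  the vertex whose colour occurs once, is fixed by assumption. Six vertices are what a conflict
  needs: an induced path of at most four and a determined vertex at either end.\<close>

locale five_cycle = obstruction5 V E for V :: "'a set" and E +
  fixes d0 d1 d2 d3 d4 :: 'a
  assumes edges: "E d0 d1" "E d1 d2" "E d2 d3" "E d3 d4" "E d4 d0"
    and nonedges: "\<not> E d0 d2" "\<not> E d0 d3" "\<not> E d1 d3" "\<not> E d1 d4" "\<not> E d2 d4"
    and extend: "\<And>S. S \<subseteq> V \<Longrightarrow> card S \<le> 6 \<Longrightarrow> \<exists>f. c3 f ({d0, d1, d2, d3, d4} \<union> S) \<and>
      f d0 = 0 \<and> f d1 = 1 \<and> f d2 = 2 \<and> f d3 = 1 \<and> f d4 = 2"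
begin

lemmas edges' = edges[THEN E_sym]
lemma nonedges': "\<not> E d2 d0" "\<not> E d3 d0" "\<not> E d3 d1" "\<not> E d4 d1" "\<not> E d4 d2"
  using nonedges E_sym by blast+

definition D where "D = {d0, d1, d2, d3, d4}"
definition good where "good f S \<longleftrightarrow> c3 f (D \<union> S) \<and> f d0 = 0 \<and> f d1 = 1 \<and> f d2 = 2 \<and> f d3 = 1 \<and> f d4 = 2"

lemma local_good: assumes "S \<subseteq> V" "card S \<le> 6" obtains f where "good f S"
  using extend[OF assms] unfolding good_def D_def by blast

lemma good_E: "good f S \<Longrightarrow> x \<in> D \<union> S \<Longrightarrow> y \<in> D \<union> S \<Longrightarrow> E x y \<Longrightarrow> f x \<noteq> f y"
  unfolding good_def using c3_E by blast
lemma good_lt: "good f S \<Longrightarrow> f x < 3" by (auto simp: good_def c3_def)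
lemma good_d: assumes "good f S" shows "f d0 = 0" "f d1 = 1" "f d2 = 2" "f d3 = 1" "f d4 = 2"
  using assms by (auto simp: good_def)

lemma D_V: "D \<subseteq> V" using edges E_V by (auto simp: D_def)

definition N1 where "N1 = {x \<in> V - D. \<exists>d\<in>D. E x d}"
definition Z where "Z = V - D - N1"
text \<open>\<open>U\<close> and \<open>U'\<close> collect the attached vertices whose colour the
  pattern leaves open: they see only colour 1, respectively only colour 2. The colour open to both
  classes is 0.\<close>

definition U where "U = {x \<in> V - D. E x d1 \<and> E x d3 \<and> \<not> E x d0 \<and> \<not> E x d2 \<and> \<not> E x d4}"
definition U' where "U' = {x \<in> V - D. E x d2 \<and> E x d4 \<and> \<not> E x d0 \<and> \<not> E x d1 \<and> \<not> E x d3}"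
definition det where "det x c \<longleftrightarrow> x \<in> V \<and> (\<forall>f S. good f S \<longrightarrow> x \<in> D \<union> S \<longrightarrow> f x = c)"

lemma det_f: "det x c \<Longrightarrow> good f S \<Longrightarrow> x \<in> D \<union> S \<Longrightarrow> f x = c" by (auto simp: det_def)
lemma det_V: "det x c \<Longrightarrow> x \<in> V" by (auto simp: det_def)

lemma det_lt: assumes "det x c" shows "c < 3"
proof -
  obtain f where f: "good f {x}" using local_good[of "{x}"] det_V[OF assms] by auto
  have "f x = c" using det_f[OF assms f] by simp
  then show ?thesis using good_lt[OF f, of x] by simp
qed

lemma det_D: assumes "x \<in> D" shows "\<exists>c. det x c"
proof -
  have V: "d0 \<in> V" "d1 \<in> V" "d2 \<in> V" "d3 \<in> V" "d4 \<in> V" using D_V by (auto simp: D_def)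
  have "det d0 0" "det d1 1" "det d2 2" "det d3 1" "det d4 2"
    unfolding det_def using V by (simp_all add: good_d)
  then show ?thesis using assms unfolding D_def by blast
qed

lemma U_colour: assumes "good f S" "u \<in> S" "u \<in> U" shows "f u = 0 \<or> f u = 2"
  using good_E[OF assms(1), of u d1] good_d(2)[OF assms(1)] assms good_lt[OF assms(1), of u]
  by (auto simp: U_def D_def)

lemma U'_colour: assumes "good f S" "u \<in> S" "u \<in> U'" shows "f u = 0 \<or> f u = 1"
  using good_E[OF assms(1), of u d2] good_d(3)[OF assms(1)] assms good_lt[OF assms(1), of u]
  by (auto simp: U'_def D_def)

text \<open>A vertex seeing two colours on the cycle is determined. One seeing a single colour must
  see both vertices of that colour, since a single attachment starts an induced P_5 around the
  cycle; this also rules out seeing \<open>d0\<close> alone.\<close>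

lemma N1_cases: assumes "x \<in> N1" shows "x \<in> U \<or> x \<in> U' \<or> (\<exists>c. det x c)"
proof -
  have x: "x \<in> V" "x \<notin> D" using assms by (auto simp: N1_def)
  have f: "f x < 3 \<and> (E x d0 \<longrightarrow> f x \<noteq> 0) \<and> (E x d1 \<or> E x d3 \<longrightarrow> f x \<noteq> 1) \<and> (E x d2 \<or> E x d4 \<longrightarrow> f x \<noteq> 2)"
    if "good f S" "x \<in> D \<union> S" for f S
  proof -
    have "E x d \<Longrightarrow> f x \<noteq> f d" if "d \<in> D" for d
      using good_E[OF \<open>good f S\<close> \<open>x \<in> D \<union> S\<close>] that by blast
    then have "E x d0 \<Longrightarrow> f x \<noteq> f d0" "E x d1 \<Longrightarrow> f x \<noteq> f d1" "E x d2 \<Longrightarrow> f x \<noteq> f d2"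
      "E x d3 \<Longrightarrow> f x \<noteq> f d3" "E x d4 \<Longrightarrow> f x \<noteq> f d4" by (simp_all add: D_def)
    then show ?thesis unfolding good_d[OF that(1)] using good_lt[OF that(1)] by blast
  qed
  have lt3: "a = 0 \<or> a = 1 \<or> a = 2" if "a < 3" for a :: nat using that by auto
  have c0: "det x 0" if "E x d1 \<or> E x d3" "E x d2 \<or> E x d4"
    unfolding det_def using x(1) that f lt3 by blast
  have c1: "det x 1" if "E x d0" "E x d2 \<or> E x d4"
    unfolding det_def using x(1) that f lt3 by blast
  have c2: "det x 2" if "E x d0" "E x d1 \<or> E x d3"
    unfolding det_def using x(1) that f lt3 by blast
  have ex: "E x d0 \<or> E x d1 \<or> E x d2 \<or> E x d3 \<or> E x d4" using assms by (auto simp: N1_def D_def)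
  have n0: False if "E x d0" "\<not> E x d1" "\<not> E x d2" "\<not> E x d3"
    using P5_free[OF that(1) edges(1,2,3)] that nonedges by blast
  have n1: False if "E x d1" "\<not> E x d2" "\<not> E x d3" "\<not> E x d4"
    using P5_free[OF that(1) edges(2,3,4)] that nonedges by blast
  have n3: False if "E x d3" "\<not> E x d4" "\<not> E x d0" "\<not> E x d1"
    using P5_free[OF that(1) edges(4,5,1)] that nonedges nonedges' by blast
  have n2: False if "E x d2" "\<not> E x d3" "\<not> E x d4" "\<not> E x d0"
    using P5_free[OF that(1) edges(3,4,5)] that nonedges nonedges' by blast
  have n4: False if "E x d4" "\<not> E x d0" "\<not> E x d1" "\<not> E x d2"
    using P5_free[OF that(1) edges(5,1,2)] that nonedges nonedges' by blast
  show ?thesis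
  proof (cases "E x d0")
    case True
    then show ?thesis using c1 c2 n0 by blast
  next
    case False
    consider "E x d1 \<or> E x d3" "E x d2 \<or> E x d4" | "\<not> E x d2" "\<not> E x d4" | "\<not> E x d1" "\<not> E x d3" by blast
    then show ?thesis
    proof cases
      case 1
      then show ?thesis using c0 by blast
    next
      case 2
      then have "E x d1" "E x d3" using ex False n1 n3 by blast+
      then show ?thesis using x False 2 by (simp add: U_def)
    next
      case 3
      then have "E x d2" "E x d4" using ex False n2 n4 by blast+
      then show ?thesis using x False 3 by (simp add: U'_def)
    qed
  qed
qed

text \<open>The cycle shows all three colours, so \<open>x\<close> misses a vertex of it, and
  somewhere a neighbour is next to a non-neighbour. Preceded by two vertices of \<open>Z\<close>, of
  which only one sees \<open>x\<close>, this gives an induced P_5.\<close>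

lemma N1_mixed: assumes "x \<in> N1"
  obtains a b where "a \<in> D" "b \<in> D" "E a b" "E x a" "\<not> E x b"
proof -
  have x: "x \<in> V" "\<exists>d\<in>D. E x d" using assms by (auto simp: N1_def)
  obtain f where f: "good f {x}" using local_good[of "{x}"] x(1) by auto
  have m: "d0 \<in> D" "d1 \<in> D" "d2 \<in> D" "d3 \<in> D" "d4 \<in> D" by (auto simp: D_def)
  have "E x d0 \<Longrightarrow> f x \<noteq> 0" "E x d1 \<Longrightarrow> f x \<noteq> 1" "E x d2 \<Longrightarrow> f x \<noteq> 2"
    using good_E[OF f, of x d0] good_E[OF f, of x d1] good_E[OF f, of x d2] good_d[OF f] m by auto
  then have n: "\<not> E x d0 \<or> \<not> E x d1 \<or> \<not> E x d2" using good_lt[OF f, of x] by linarith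
  have ex: "E x d0 \<or> E x d1 \<or> E x d2 \<or> E x d3 \<or> E x d4" using x(2) by (auto simp: D_def)
  consider "E x d0" "E x d1" | "E x d0" "\<not> E x d1" | "\<not> E x d0" "E x d1" | "\<not> E x d0" "E x d4"
    | "\<not> E x d1" "E x d2" | "\<not> E x d4" "E x d3" using ex by blast
  then show ?thesis
  proof cases
    case 1
    then show ?thesis using n that[OF m(2,3) edges(2)] by blast
  next
    case 2
    then show ?thesis using that[OF m(1,2) edges(1)] by blast
  next
    case 3
    then show ?thesis using that[OF m(2,1) edges'(1)] by blast
  next
    case 4
    then show ?thesis using that[OF m(5,1) edges(5)] by blast
  next
    case 5
    then show ?thesis using that[OF m(3,2) edges'(2)] by blast
  next
    case 6
    then show ?thesis using that[OF m(4,5) edges(4)] by blast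
  qed
qed

section \<open>Vertices without neighbours on the five-cycle\<close>

lemma Z_no_D: "z \<in> Z \<Longrightarrow> d \<in> D \<Longrightarrow> \<not> E z d" by (auto simp: Z_def N1_def)
lemma Z_V: "z \<in> Z \<Longrightarrow> z \<in> V" by (auto simp: Z_def)

lemma Z_homogeneous: assumes "z \<in> Z" "y \<in> Z" "x \<in> N1" "E y x" "E z y" shows "E z x"
proof (rule ccontr)
  assume n: "\<not> E z x"
  obtain a b where ab: "a \<in> D" "b \<in> D" "E a b" "E x a" "\<not> E x b" by (rule N1_mixed[OF assms(3)])
  have "\<not> E z a" "\<not> E z b" "\<not> E y a" "\<not> E y b" using Z_no_D assms(1,2) ab(1,2) by blast+
  then show False using P5_free[OF assms(5,4) ab(4,3)] n ab(5) by blast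
qed

text \<open>Preceded by \<open>y\<close>, the induced path \<open>x\<close>, \<open>d1\<close>,
  \<open>d0\<close>, \<open>d4\<close> for \<open>U\<close>, or \<open>x\<close>, \<open>d4\<close>,
  \<open>d0\<close>, \<open>d1\<close> for \<open>U'\<close>, would be a P_5. Hence the neighbours
  of \<open>Z\<close> in \<open>N1\<close> are all determined.\<close>

lemma Z_no_U: assumes "y \<in> Z" "E y x" shows "x \<notin> U" "x \<notin> U'"
proof -
  have n: "\<not> E y d0" "\<not> E y d1" "\<not> E y d4" using Z_no_D[OF assms(1)] by (auto simp: D_def)
  show "x \<notin> U"
  proof
    assume "x \<in> U"
    then have u: "E x d1" "\<not> E x d0" "\<not> E x d4" by (auto simp: U_def)
    show False by (rule P5_free[OF assms(2) u(1) edges'(1,5)]) (use n u nonedges in auto)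
  qed
  show "x \<notin> U'"
  proof
    assume "x \<in> U'"
    then have u: "E x d4" "\<not> E x d0" "\<not> E x d1" by (auto simp: U'_def)
    show False by (rule P5_free[OF assms(2) u(1) edges(5,1)]) (use n u nonedges nonedges' in auto)
  qed
qed

definition nb where "nb z = {x \<in> N1. E z x}"

lemma nb_nonempty: assumes "z \<in> Z" shows "nb z \<noteq> {}"
proof -
  define Y where "Y = {z \<in> Z. nb z \<noteq> {}}"
  define S where "S = D \<union> N1 \<union> Y"
  have "S = V"
  proof (rule ccontr)
    assume "S \<noteq> V"
    moreover have "S \<subseteq> V" "S \<noteq> {}" using D_V by (auto simp: S_def N1_def Y_def Z_def D_def)
    ultimately obtain x y where xy: "x \<in> S" "y \<in> V - S" "E x y" using connected by metis
    then have y: "y \<in> Z" "y \<notin> Y" by (auto simp: S_def Z_def)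
    then have "x \<notin> D" "x \<notin> N1" using Z_no_D[OF y(1), of x] E_sym[OF xy(3)] by (auto simp: Y_def nb_def)
    then have "x \<in> Y" using xy(1) by (auto simp: S_def)
    then obtain u where "u \<in> N1" "E x u" "x \<in> Z" by (auto simp: Y_def nb_def)
    then have "E y u" using Z_homogeneous[OF y(1), of x u] E_sym[OF xy(3)] by blast
    then show False using y \<open>u \<in> N1\<close> by (auto simp: Y_def nb_def)
  qed
  then show ?thesis using assms by (auto simp: S_def Y_def Z_def)
qed

lemma nb_eq: assumes "z \<in> Z" "y \<in> Z" "E z y" shows "nb z = nb y"
proof -
  have "E y x" if "x \<in> N1" "E z x" for x using Z_homogeneous[OF assms(2,1) that E_sym[OF assms(3)]] .
  moreover have "E z x" if "x \<in> N1" "E y x" for x using Z_homogeneous[OF assms(1,2) that assms(3)] .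
  ultimately show ?thesis unfolding nb_def by blast
qed

text \<open>Neighbourhoods in \<open>N1\<close> are constant along edges of \<open>Z\<close>, so an
  odd cycle in \<open>Z\<close> would lie in the neighbourhood of a single vertex.\<close>

lemma Z_bip: "bip Z"
proof (rule ccontr)
  assume "\<not> bip Z"
  moreover have "Z \<subseteq> V" by (auto simp: Z_def)
  ultimately obtain n v where v: "odd n" "icyc (int n) v" "range v \<subseteq> Z" by (rule shortest_odd_cycle)
  have st: "nb (v i) = nb (v (i + 1))" for i
  proof -
    have "E (v i) (v (i + 1))" using icyc_E[OF v(2)] by (simp add: near_def)
    moreover have "v i \<in> Z" "v (i + 1) \<in> Z" using v(3) by blast+
    ultimately show ?thesis using nb_eq by blast
  qed
  have nv: "nb (v (int i)) = nb (v 0)" for i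
  proof (induction i)
    case (Suc i)
    then show ?case using st[of "int i"] by (simp add: add.commute)
  qed simp
  have all: "nb (v i) = nb (v 0)" for i
  proof -
    have "0 \<le> i mod int n" using v(2) by (simp add: icyc_def)
    then show ?thesis using nv[of "nat (i mod int n)"] icyc_mod[OF v(2), of i] by simp
  qed
  obtain x where x: "x \<in> nb (v 0)" using nb_nonempty v(3) by blast
  have "E x w" if "w \<in> range v" for w
    using that x all E_sym unfolding nb_def by blast
  then have "bip (range v)" using nbhd_bip[of "range v" x] v(3) Z_V by blast
  then show False using odd_icyc_not_bip v by blast
qed

text \<open>Determined neighbours prescribe values of the bipartition of \<open>W\<close>. Two
  conflicting prescriptions are joined by an induced path of at most four vertices, and with their
  determined vertices this makes six. The last conclusion limits the use of the colour 0.\<close>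

lemma class_colouring:
  assumes W: "W \<subseteq> V" "bip W" and col: "\<And>f S u. good f S \<Longrightarrow> u \<in> S \<Longrightarrow> u \<in> W \<Longrightarrow> f u = 0 \<or> f u = c" "c \<noteq> 0"
  obtains h :: "'a \<Rightarrow> nat" where "\<And>x y. x \<in> W \<Longrightarrow> y \<in> W \<Longrightarrow> E x y \<Longrightarrow> h x \<noteq> h y"
    "\<And>u. u \<in> W \<Longrightarrow> h u = 0 \<or> h u = c" "\<And>u x e. u \<in> W \<Longrightarrow> E u x \<Longrightarrow> det x e \<Longrightarrow> h u \<noteq> e"
    "\<And>u. u \<in> W \<Longrightarrow> (\<And>w. w \<in> W \<Longrightarrow> \<not> E u w) \<Longrightarrow> h u = 0 \<Longrightarrow> \<exists>x. E u x \<and> det x c"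
proof -
  define P where "P u t \<longleftrightarrow> (\<exists>x. E u x \<and> (if t then det x 0 else det x c))" for u t
  obtain g :: "'a \<Rightarrow> bool" where g: "\<And>x y. x \<in> W \<Longrightarrow> y \<in> W \<Longrightarrow> E x y \<Longrightarrow> g x \<noteq> g y"
    "\<And>u t. u \<in> W \<Longrightarrow> P u t \<Longrightarrow> g u = t"
  proof (rule bip_extend[OF W(2), of P])
    fix u u' t t' and b :: "'a \<Rightarrow> bool"
    assume P: "P u t" "P u' t'" and u: "u \<in> W" "u' \<in> W" "conn W u u'"
      and b: "\<And>x y. x \<in> W \<Longrightarrow> y \<in> W \<Longrightarrow> E x y \<Longrightarrow> b x \<noteq> b y"
    obtain xs where xs: "xs \<noteq> []" "hd xs = u" "last xs = u'" "set xs \<subseteq> W" "ipath xs"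
      by (rule conn_ipath[OF u(3,1) W(1)])
    obtain x x' where x: "E u x" "if t then det x 0 else det x c" "E u' x'" "if t' then det x' 0 else det x' c"
      using P unfolding P_def by blast
    define S where "S = set xs \<union> {x, x'}"
    have "length xs \<le> 4" using ipath_short[OF xs(5)] by simp
    then have "card (set xs) \<le> 4" using card_length[of xs] by simp
    moreover have "card {x, x'} \<le> 2" by (simp add: card_insert_if)
    ultimately have "card S \<le> 6" unfolding S_def using card_Un_le[of "set xs" "{x, x'}"] by linarith
    moreover have "S \<subseteq> V" using xs(4) W(1) x E_V2 by (auto simp: S_def)
    ultimately obtain f where f: "good f S" using local_good by blast
    have m: "u \<in> set xs" "u' \<in> set xs" using xs(1-3) by auto
    have fc: "f w = 0 \<or> f w = c" if "w \<in> set xs" for w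
      using col(1)[OF f, of w] that xs(4) by (auto simp: S_def)
    have "((f (hd xs) = c) = b (hd xs)) = ((f (last xs) = c) = b (last xs))"
    proof (rule alternating_ipath[OF xs(5,1)])
      fix w w' assume ww: "w \<in> set xs" "w' \<in> set xs" "E w w'"
      then show "b w \<noteq> b w'" using b xs(4) by blast
      have "f w \<noteq> f w'" using good_E[OF f] ww by (auto simp: S_def)
      then show "(f w = c) \<noteq> (f w' = c)" using fc ww by metis
    qed
    moreover have "(f u = c) = t"
      using good_E[OF f, of u x] det_f[OF _ f, of x] x(1,2) m(1) fc[of u] col(2) by (auto simp: S_def split: if_splits)
    moreover have "(f u' = c) = t'"
      using good_E[OF f, of u' x'] det_f[OF _ f, of x'] x(3,4) m(2) fc[of u'] col(2) by (auto simp: S_def split: if_splits)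
    ultimately show "(t = t') = (b u = b u')" using xs(2,3) by auto
  qed blast
  \<comment> \<open>A vertex isolated in \<open>W\<close> gets \<open>c\<close> by default: 0 is the
    only colour that \<open>U\<close> and \<open>U'\<close> share, so it is used only under
    compulsion.\<close>
  define h where "h u = (if \<exists>w\<in>W. E u w then (if g u then c else 0)
    else if \<exists>x. E u x \<and> det x c then 0 else c)" for u
  show ?thesis
  proof (rule that[of h])
    fix u x e assume u: "u \<in> W" "E u x" "det x e"
    show "h u \<noteq> e"
    proof (cases "\<exists>w\<in>W. E u w")
      case True
      have "P u True" if "e = 0" using u that by (auto simp: P_def)
      moreover have "P u False" if "e = c" using u that unfolding P_def by (intro exI[of _ x]) simp
      ultimately show ?thesis using g(2)[OF u(1)] col(2) True by (auto simp: h_def)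
    next
      case False
      show ?thesis
      proof
        assume e: "h u = e"
        then have "e \<noteq> c" using u False unfolding h_def by (metis col(2))
        then obtain y where y: "E u y" "det y c" "e = 0" using e False unfolding h_def by (auto split: if_splits)
        have "{u, x, y} \<subseteq> V" "card {u, x, y} \<le> 6"
          using u y W(1) E_V2 by (auto simp: card_insert_if)
        then obtain f where f: "good f {u, x, y}" using local_good by blast
        have "f x = e" by (rule det_f[OF u(3) f]) simp
        moreover have "f y = c" by (rule det_f[OF y(2) f]) simp
        moreover have "f u \<noteq> f x" "f u \<noteq> f y" using good_E[OF f _ _ u(2)] good_E[OF f _ _ y(1)] by simp_all
        ultimately show False using col(1)[OF f, of u] u(1) y(3) by simp
      qed
    qed
  next
    fix x y assume xy: "x \<in> W" "y \<in> W" "E x y"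
    then have "\<exists>w\<in>W. E x w" "\<exists>w\<in>W. E y w" using E_sym by blast+
    then show "h x \<noteq> h y" using g(1)[OF xy] col(2) by (auto simp: h_def)
  next
    fix u assume "u \<in> W" "\<And>w. w \<in> W \<Longrightarrow> \<not> E u w" "h u = 0"
    then show "\<exists>x. E u x \<and> det x c" using col(2) by (auto simp: h_def split: if_splits)
  qed (auto simp: h_def)
qed

text \<open>A vertex of \<open>U'\<close> attached to an edge of \<open>U\<close> is attached to both of its ends, so no constraint
  can travel through that edge.\<close>

lemma U_edge_complete: assumes "p \<in> U" "p' \<in> U" "E p p'" "w \<in> U'" "E w p" shows "E w p'"
proof (rule ccontr)
  assume n: "\<not> E w p'"
  have a: "E w d4" "\<not> E w d0" "\<not> E p d0" "\<not> E p d4" "\<not> E p' d0" "\<not> E p' d4" using assms by (auto simp: U_def U'_def)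
  show False by (rule P5_free[OF E_sym[OF assms(3)] E_sym[OF assms(5)] a(1) edges(5)]) (use n a E_sym in blast)+
qed

lemma U'_edge_complete: assumes "p \<in> U'" "p' \<in> U'" "E p p'" "w \<in> U" "E w p" shows "E w p'"
proof (rule ccontr)
  assume n: "\<not> E w p'"
  have a: "E w d1" "\<not> E w d0" "\<not> E p d0" "\<not> E p d1" "\<not> E p' d0" "\<not> E p' d1" using assms by (auto simp: U_def U'_def)
  show False by (rule P5_free[OF E_sym[OF assms(3)] E_sym[OF assms(5)] a(1) edges'(1)]) (use n a E_sym in blast)+
qed

section \<open>Compatibility of the two open classes\<close>

lemma U_bip: "bip U" by (rule nbhd_bip[of U d1]) (auto simp: U_def intro: E_sym)
lemma U'_bip: "bip U'" by (rule nbhd_bip[of U' d2]) (auto simp: U'_def intro: E_sym)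

lemma U_U'_disjoint: "x \<in> U \<Longrightarrow> x \<notin> U'" by (auto simp: U_def U'_def)
lemma U_V: "U \<subseteq> V" "U' \<subseteq> V" by (auto simp: U_def U'_def)

text \<open>An edge between \<open>U\<close> and \<open>U'\<close> can fail only if both ends have
  colour 0. Each end then lies on an edge of its own class or is compelled by a determined
  neighbour. Edges on both sides would form a K_4, and every other combination contradicts a
  colouring of four vertices.\<close>

lemma outside_Z_colouring:
  obtains F :: "'a \<Rightarrow> nat" where "\<And>x y. x \<in> V - Z \<Longrightarrow> y \<in> V - Z \<Longrightarrow> E x y \<Longrightarrow> F x \<noteq> F y"
    "\<And>x. x \<in> V - Z \<Longrightarrow> F x < 3" "\<And>x. x \<in> V - Z \<Longrightarrow> x \<notin> U \<Longrightarrow> x \<notin> U' \<Longrightarrow> det x (F x)"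
proof -
  obtain h :: "'a \<Rightarrow> nat" where h: "\<And>x y. x \<in> U \<Longrightarrow> y \<in> U \<Longrightarrow> E x y \<Longrightarrow> h x \<noteq> h y"
    "\<And>u. u \<in> U \<Longrightarrow> h u = 0 \<or> h u = 2" "\<And>u x e. u \<in> U \<Longrightarrow> E u x \<Longrightarrow> det x e \<Longrightarrow> h u \<noteq> e"
    "\<And>u. u \<in> U \<Longrightarrow> (\<And>w. w \<in> U \<Longrightarrow> \<not> E u w) \<Longrightarrow> h u = 0 \<Longrightarrow> \<exists>x. E u x \<and> det x 2"
    by (rule class_colouring[OF U_V(1) U_bip, of 2]) (use U_colour in \<open>blast+ | simp\<close>)+
  obtain h' :: "'a \<Rightarrow> nat" where h': "\<And>x y. x \<in> U' \<Longrightarrow> y \<in> U' \<Longrightarrow> E x y \<Longrightarrow> h' x \<noteq> h' y"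
    "\<And>u. u \<in> U' \<Longrightarrow> h' u = 0 \<or> h' u = 1" "\<And>u x e. u \<in> U' \<Longrightarrow> E u x \<Longrightarrow> det x e \<Longrightarrow> h' u \<noteq> e"
    "\<And>u. u \<in> U' \<Longrightarrow> (\<And>w. w \<in> U' \<Longrightarrow> \<not> E u w) \<Longrightarrow> h' u = 0 \<Longrightarrow> \<exists>x. E u x \<and> det x 1"
    by (rule class_colouring[OF U_V(2) U'_bip, of 1]) (use U'_colour in \<open>blast+ | simp\<close>)+
  have four: "\<exists>f. good f {a, b, x, y}" if "a \<in> V" "b \<in> V" "x \<in> V" "y \<in> V" for a b x y
  proof -
    have "card {a, b, x, y} \<le> 6" by (simp add: card_insert_if)
    then show ?thesis using local_good[of "{a, b, x, y}"] that by blast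
  qed
  have cross: "h u \<noteq> h' w" if uw: "u \<in> U" "w \<in> U'" "E u w" for u w
  proof
    assume "h u = h' w"
    then have z: "h u = 0" "h' w = 0" using h(2)[OF uw(1)] h'(2)[OF uw(2)] by auto
    have wu: "E w u" using E_sym uw(3) by blast
    have uwV: "u \<in> V" "w \<in> V" using uw U_V by blast+
    consider u' where "u' \<in> U" "E u u'" | "\<And>u'. u' \<in> U \<Longrightarrow> \<not> E u u'" by blast
    then show False
    proof cases
      case (1 u')
      have wu': "E w u'" using U_edge_complete[OF uw(1) 1 uw(2) wu] .
      have "\<not> E w w'" if w': "w' \<in> U'" for w'
      proof
        assume e: "E w w'"
        have "E u w'" using U'_edge_complete[OF uw(2) w' e uw(1,3)] .
        moreover have "E u' w'" using U'_edge_complete[OF uw(2) w' e 1(1) E_sym[OF wu']] .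
        ultimately show False using no_K4[OF 1(2) uw(3) _ E_sym[OF wu'] _ e] by blast
      qed
      \<comment> \<open>\<open>u\<close> and \<open>u'\<close> use 0 and 2 and \<open>w\<close> sees
        both, so \<open>w\<close> needs colour 1, which \<open>y\<close> takes.\<close>
      then obtain y where y: "E w y" "det y 1" using h'(4)[OF uw(2) _ z(2)] by blast
      obtain f where f: "good f {u, u', w, y}"
        using four[of u u' w y] uwV 1(1) U_V det_V[OF y(2)] by blast
      have "f u = 0 \<or> f u = 2" "f u' = 0 \<or> f u' = 2" "f w = 0 \<or> f w = 1"
        using U_colour[OF f] U'_colour[OF f] uw 1 by auto
      moreover have "f u \<noteq> f u'" "f u \<noteq> f w" "f w \<noteq> f u'" "f w \<noteq> f y"
        using good_E[OF f _ _ uw(3)] good_E[OF f _ _ 1(2)] good_E[OF f _ _ wu'] good_E[OF f _ _ y(1)] by simp_all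
      moreover have "f y = 1" by (rule det_f[OF y(2) f]) simp
      ultimately show False by auto
    next
      case 2
      then obtain x where x: "E u x" "det x 2" using h(4)[OF uw(1) _ z(1)] by blast
      consider w' where "w' \<in> U'" "E w w'" | "\<And>w'. w' \<in> U' \<Longrightarrow> \<not> E w w'" by blast
      then show False
      proof cases
        case (1 w')
        have uw': "E u w'" using U'_edge_complete[OF uw(2) 1 uw(1,3)] .
        obtain f where f: "good f {u, x, w, w'}"
          using four[of u x w w'] uwV 1(1) U_V det_V[OF x(2)] by blast
        have "f u = 0 \<or> f u = 2" "f w' = 0 \<or> f w' = 1" "f w = 0 \<or> f w = 1"
          using U_colour[OF f] U'_colour[OF f] uw 1 by auto
        moreover have "f w \<noteq> f w'" "f u \<noteq> f w" "f u \<noteq> f w'" "f u \<noteq> f x"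
          using good_E[OF f _ _ uw(3)] good_E[OF f _ _ 1(2)] good_E[OF f _ _ uw'] good_E[OF f _ _ x(1)] by simp_all
        moreover have "f x = 2" by (rule det_f[OF x(2) f]) simp
        ultimately show False by auto
      next
        case no: 2
        then obtain y where y: "E w y" "det y 1" using h'(4)[OF uw(2) _ z(2)] by blast
        obtain f where f: "good f {u, w, x, y}"
          using four[of u w x y] uwV det_V[OF x(2)] det_V[OF y(2)] by blast
        have "f u = 0 \<or> f u = 2" "f w = 0 \<or> f w = 1"
          using U_colour[OF f] U'_colour[OF f] uw by auto
        moreover have "f u \<noteq> f w" "f u \<noteq> f x" "f w \<noteq> f y"
          using good_E[OF f _ _ uw(3)] good_E[OF f _ _ x(1)] good_E[OF f _ _ y(1)] by simp_all
        moreover have "f x = 2" by (rule det_f[OF x(2) f]) simp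
        moreover have "f y = 1" by (rule det_f[OF y(2) f]) simp
        ultimately show False by auto
      qed
    qed
  qed
  define F where "F x = (if x \<in> U then h x else if x \<in> U' then h' x else (SOME c. det x c))" for x
  have Fdet: "det x (F x)" if "x \<in> V - Z" "x \<notin> U" "x \<notin> U'" for x
  proof -
    have "\<exists>c. det x c" using N1_cases[of x] det_D[of x] that by (auto simp: Z_def)
    then have "det x (SOME c. det x c)" by (rule someI_ex)
    then show ?thesis using that by (simp add: F_def)
  qed
  have FU: "F x = h x" if "x \<in> U" for x using that by (simp add: F_def)
  have FU': "F x = h' x" if "x \<in> U'" for x using that U_U'_disjoint by (auto simp: F_def)
  show ?thesis
  proof (rule that[of F])
    fix x y assume xy: "x \<in> V - Z" "y \<in> V - Z" "E x y"
    have *: "F x \<noteq> F y" if "x \<in> U \<or> x \<in> U'" "y \<notin> U" "y \<notin> U'" "E x y" "y \<in> V - Z" for x y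
      using that h(3)[of x y "F y"] h'(3)[of x y "F y"] Fdet[of y] FU FU' by auto
    have **: "F x \<noteq> F y" if "x \<in> U" "y \<in> U'" "E x y" for x y
      using cross[OF that] that FU FU' by simp
    consider "x \<in> U" "y \<in> U" | "x \<in> U'" "y \<in> U'" | "x \<in> U" "y \<in> U'" | "x \<in> U'" "y \<in> U" |
      "x \<in> U \<or> x \<in> U'" "y \<notin> U" "y \<notin> U'" | "y \<in> U \<or> y \<in> U'" "x \<notin> U" "x \<notin> U'" |
      "x \<notin> U" "x \<notin> U'" "y \<notin> U" "y \<notin> U'" by blast
    then show "F x \<noteq> F y"
    proof cases
      case 1
      then show ?thesis using h(1) xy(3) FU by simp
    next
      case 2
      then show ?thesis using h'(1) xy(3) FU' by simp
    next
      case 3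
      then show ?thesis using ** xy(3) by blast
    next
      case 4
      then show ?thesis using **[of y x] E_sym[OF xy(3)] by simp
    next
      case 5
      then show ?thesis using *[of x y] xy by blast
    next
      case 6
      then show ?thesis using *[of y x] xy(1) E_sym[OF xy(3)] by simp
    next
      case 7
      have "{x, y} \<subseteq> V" "card {x, y} \<le> 6" using xy by (auto simp: card_insert_if)
      then obtain f where f: "good f {x, y}" using local_good by blast
      have "f x = F x" by (rule det_f[OF Fdet f]) (use xy 7 in auto)
      moreover have "f y = F y" by (rule det_f[OF Fdet f]) (use xy 7 in auto)
      moreover have "f x \<noteq> f y" by (rule good_E[OF f _ _ xy(3)]) simp_all
      ultimately show ?thesis by simp
    qed
  next
    fix x assume x: "x \<in> V - Z"
    show "F x < 3"
      using h(2)[of x] h'(2)[of x] FU FU' Fdet[OF x] det_lt by (cases "x \<in> U"; cases "x \<in> U'") auto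
  qed (rule Fdet)
qed

text \<open>A vertex on an edge of \<open>Z\<close> sees a single colour in \<open>N1\<close>, which
  leaves the other two to alternate along the component. A vertex isolated in \<open>Z\<close> has a
  free colour, because its neighbours are determined and three of them with different colours would
  be a local obstruction.\<close>

lemma five_cycle_False: False
proof -
  obtain F :: "'a \<Rightarrow> nat" where F: "\<And>x y. x \<in> V - Z \<Longrightarrow> y \<in> V - Z \<Longrightarrow> E x y \<Longrightarrow> F x \<noteq> F y"
    "\<And>x. x \<in> V - Z \<Longrightarrow> F x < 3" "\<And>x. x \<in> V - Z \<Longrightarrow> x \<notin> U \<Longrightarrow> x \<notin> U' \<Longrightarrow> det x (F x)"
    by (rule outside_Z_colouring) blast
  have nbF: "det x (F x)" if "z \<in> Z" "x \<in> nb z" for z x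
    using F(3)[of x] Z_no_U[OF that(1), of x] that(2) by (auto simp: nb_def N1_def Z_def)
  obtain b :: "'a \<Rightarrow> bool" where b: "\<And>x y. x \<in> Z \<Longrightarrow> y \<in> Z \<Longrightarrow> E x y \<Longrightarrow> b x \<noteq> b y"
    using Z_bip unfolding bip_def by blast
  define c where "c z = F (SOME x. x \<in> nb z)" for z
  have some: "(SOME x. x \<in> nb z) \<in> nb z" if "z \<in> Z" for z
    using nb_nonempty[OF that] by (simp add: some_in_eq)
  \<comment> \<open>Both ends of the edge see \<open>x\<close> and \<open>x0\<close>, so these share
    the third colour.\<close>
  have mono: "F x = c z" if z: "z \<in> Z" "y \<in> Z" "E z y" "x \<in> nb z" for z y x
  proof -
    define x0 where "x0 = (SOME x. x \<in> nb z)"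
    have x0: "x0 \<in> nb z" using some[OF z(1)] by (simp add: x0_def)
    have "nb y = nb z" using nb_eq z by blast
    then have e: "E z x" "E y x" "E z x0" "E y x0" using z(4) x0 unfolding nb_def by blast+
    have "{z, y, x, x0} \<subseteq> V" "card {z, y, x, x0} \<le> 6"
      using z x0 Z_V by (auto simp: nb_def N1_def card_insert_if)
    then obtain f where f: "good f {z, y, x, x0}" using local_good by blast
    have "f x = F x" "f x0 = F x0" using det_f[OF nbF[OF z(1)] f] z(4) x0 by simp_all
    moreover have "f z \<noteq> f y" "f z \<noteq> f x" "f y \<noteq> f x" "f z \<noteq> f x0" "f y \<noteq> f x0"
      using good_E[OF f _ _ z(3)] e[THEN good_E[OF f, rotated 2]] by simp_all
    ultimately show ?thesis
      using good_lt[OF f, of z] good_lt[OF f, of y] good_lt[OF f, of x] good_lt[OF f, of x0]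
      unfolding c_def x0_def[symmetric] by linarith
  qed
  have free: "\<exists>a<3. a \<notin> F ` nb z" if z: "z \<in> Z" for z
  proof (rule ccontr)
    assume "\<not> ?thesis"
    then have "0 \<in> F ` nb z" "1 \<in> F ` nb z" "2 \<in> F ` nb z" by auto
    then obtain x y w where x: "x \<in> nb z" "F x = 0" "y \<in> nb z" "F y = 1" "w \<in> nb z" "F w = 2" by auto
    have "{z, x, y, w} \<subseteq> V" "card {z, x, y, w} \<le> 6"
      using z x Z_V by (auto simp: nb_def N1_def card_insert_if)
    then obtain f where f: "good f {z, x, y, w}" using local_good by blast
    have "f x = F x" "f y = F y" "f w = F w" using det_f[OF nbF[OF z] f] x by simp_all
    then have "f x = 0" "f y = 1" "f w = 2" using x by simp_all
    moreover have "E z x" "E z y" "E z w" using x by (simp_all add: nb_def)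
    then have "f z \<noteq> f x" "f z \<noteq> f y" "f z \<noteq> f w" using good_E[OF f, of z] by simp_all
    ultimately show False using good_lt[OF f, of z] by linarith
  qed
  define G where "G x = (if x \<notin> Z then F x else if \<exists>y\<in>Z. E x y
    then (if b x then (c x + 1) mod 3 else (c x + 2) mod 3) else (SOME a. a < 3 \<and> a \<notin> F ` nb x))" for x
  have ZG: "G z \<noteq> G x" if z: "z \<in> Z" "E z x" for z x
  proof (cases "x \<in> Z")
    case True
    have "nb z = nb x" using nb_eq z True by blast
    then have "c z = c x" by (simp add: c_def)
    moreover have "b z \<noteq> b x" using b z True by blast
    moreover have "\<exists>y\<in>Z. E z y" "\<exists>y\<in>Z. E x y" using z True E_sym by blast+
    moreover have "(a + 1) mod 3 \<noteq> (a + 2) mod 3" for a :: nat by presburger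
    ultimately show ?thesis using z(1) True unfolding G_def by metis
  next
    case False
    have "x \<in> N1" using False z Z_no_D[OF z(1), of x] E_V2[OF z(2)] by (auto simp: Z_def)
    then have nbx: "x \<in> nb z" using z by (simp add: nb_def)
    show ?thesis
    proof (cases "\<exists>y\<in>Z. E z y")
      case True
      then have "F x = c z" using mono z(1) nbx by blast
      moreover have "(a + 1) mod 3 \<noteq> a" "(a + 2) mod 3 \<noteq> a" for a :: nat by presburger+
      ultimately show ?thesis using z(1) False True unfolding G_def by metis
    next
      case no: False
      have "(SOME a. a < 3 \<and> a \<notin> F ` nb z) < 3 \<and> (SOME a. a < 3 \<and> a \<notin> F ` nb z) \<notin> F ` nb z"
        by (rule someI_ex) (use free[OF z(1)] in blast)
      then show ?thesis using z(1) False no nbx unfolding G_def by auto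
    qed
  qed
  have Glt: "G x < 3" if "x \<in> V" for x
  proof -
    have "(SOME a. a < 3 \<and> a \<notin> F ` nb x) < 3 \<and> (SOME a. a < 3 \<and> a \<notin> F ` nb x) \<notin> F ` nb x" if "x \<in> Z"
      by (rule someI_ex) (use free[OF that] in blast)
    then show ?thesis using F(2)[of x] that unfolding G_def by auto
  qed
  have "G x \<noteq> G y" if xy: "x \<in> V" "y \<in> V" "E x y" for x y
  proof (cases "x \<in> Z \<or> y \<in> Z")
    case True
    then show ?thesis using ZG[of x y] ZG[of y x] xy(3) E_sym[OF xy(3)] by auto
  next
    case False
    then show ?thesis using F(1) xy by (simp add: G_def)
  qed
  then have "c3 (\<lambda>x. if x \<in> V then G x else 0) V" using Glt unfolding c3_def by auto
  then show False using not_c3 by blast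
qed

end

context obstruction5
begin

text \<open>Colour classes have at most two vertices, so their sizes are 2, 2, 1. The disjuncts put
  the singleton at \<open>a\<close>, \<open>b\<close>, \<open>c\<close>, \<open>d\<close>,
  \<open>e\<close> in turn.\<close>

lemma c5_singleton:
  assumes "a < 3" "b < 3" "c < 3" "d < 3" "e < (3::nat)" "a \<noteq> b" "b \<noteq> c" "c \<noteq> d" "d \<noteq> e" "e \<noteq> a"
  shows "b = d \<and> c = e \<or> c = e \<and> d = a \<or> d = a \<and> e = b \<or> e = b \<and> a = c \<or> a = c \<and> b = d"
proof -
  have "x = 0 \<or> x = 1 \<or> x = 2" if "x < 3" for x :: nat using that by auto
  note lt3 = this
  consider "a = c" | "b = d" "a \<noteq> c" | "a \<noteq> c" "b \<noteq> d" by blast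
  then show ?thesis
  proof cases
    case 1
    then show ?thesis
      using lt3[OF assms(1)] lt3[OF assms(2)] lt3[OF assms(4)] lt3[OF assms(5)] assms(6-10) by auto
  next
    case 2
    then have "e = c" using lt3[OF assms(1)] lt3[OF assms(2)] lt3[OF assms(3)] lt3[OF assms(5)] assms(6-10) by auto
    then show ?thesis using 2 by simp
  next
    case 3
    then have "d = a" using lt3[OF assms(1)] lt3[OF assms(2)] lt3[OF assms(3)] lt3[OF assms(4)] assms(6-10) by auto
    moreover have "e = b \<or> e = c" using lt3[OF assms(1)] lt3[OF assms(2)] lt3[OF assms(3)] lt3[OF assms(5)] 3 assms(6-10) by auto
    ultimately show ?thesis by auto
  qed
qed

text \<open>A 3-coloured five-cycle has exactly one colour of multiplicity one. If the pattern with that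
  colour at position \<open>s\<close> had an obstruction for every \<open>s\<close>, their union would be a small set that
  is not 3-colourable; so some pattern extends to all small sets.\<close>

lemma no_five_cycle: assumes c: "icyc 5 d" shows False
proof -
  define pat where "pat s f \<longleftrightarrow> f (d s) = 0 \<and> f (d (s + 1)) = 1 \<and> f (d (s + 2)) = 2 \<and>
    f (d (s + 3)) = 1 \<and> f (d (s + 4)) = (2::nat)" for s f
  have "\<exists>s. \<forall>S. S \<subseteq> V \<longrightarrow> card S \<le> 6 \<longrightarrow> (\<exists>f. c3 f (range d \<union> S) \<and> pat s f)"
  proof (rule ccontr)
    assume "\<not> ?thesis"
    then have "\<forall>s. \<exists>S. S \<subseteq> V \<and> card S \<le> 6 \<and> (\<forall>f. c3 f (range d \<union> S) \<longrightarrow> \<not> pat s f)"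
      by (simp only: not_ex not_all not_imp de_Morgan_conj de_Morgan_disj not_not imp_conv_disj simp_thms)
    from choice[OF this] obtain B where "\<forall>s. B s \<subseteq> V \<and> card (B s) \<le> 6 \<and>
      (\<forall>f. c3 f (range d \<union> B s) \<longrightarrow> \<not> pat s f)" ..
    then have B: "\<And>s. B s \<subseteq> V" "\<And>s. card (B s) \<le> 6"
      "\<And>s f. c3 f (range d \<union> B s) \<Longrightarrow> \<not> pat s f" by simp_all
    \<comment> \<open>Five obstructions of at most six vertices and the cycle itself: at most 35
      vertices, within the bound 43.\<close>
    define S where "S = range d \<union> (\<Union>s\<in>{0..<5}. B s)"
    have "card (\<Union>s\<in>{0..<5::int}. B s) \<le> (\<Sum>s\<in>{0..<5}. card (B s))" by (rule card_UN_le) simp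
    also have "\<dots> \<le> (\<Sum>s\<in>{0..<5::int}. 6)" by (rule sum_mono) (rule B(2))
    finally have "card (\<Union>s\<in>{0..<5}. B s) \<le> 30" by simp
    then have "card S \<le> 43"
      using card_Un_le[of "range d" "\<Union>s\<in>{0..<5}. B s"] icyc_card[OF c] unfolding S_def by simp
    moreover have "S \<subseteq> V" using B(1) icyc_V[OF c] by (auto simp: S_def)
    ultimately obtain f where f: "c3 f S" using local_c3 by blast
    have ne: "f (d i) \<noteq> f (d j)" if "near 5 i j" for i j
      using c3_E[OF f, of "d i" "d j"] icyc_E[OF c] that by (auto simp: S_def)
    have d5: "d (i + 5) = d i" for i using icyc_eq[OF c] by simp
    have "\<exists>s\<in>{0..<5}. f (d (s + 1)) = f (d (s + 3)) \<and> f (d (s + 2)) = f (d (s + 4))"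
    proof -
      have "f (d 0) \<noteq> f (d 1)" "f (d 1) \<noteq> f (d 2)" "f (d 2) \<noteq> f (d 3)" "f (d 3) \<noteq> f (d 4)" "f (d 4) \<noteq> f (d 0)"
        by (rule ne, simp add: near_def)+
      note p = c5_singleton[OF c3_lt[OF f] c3_lt[OF f] c3_lt[OF f] c3_lt[OF f] c3_lt[OF f] this]
      have d': "d 5 = d 0" "d 6 = d 1" "d 7 = d 2" "d 8 = d 3"
        using d5[of 0] d5[of 1] d5[of 2] d5[of 3] by simp_all
      define R where "R s \<longleftrightarrow> f (d (s + 1)) = f (d (s + 3)) \<and> f (d (s + 2)) = f (d (s + 4))" for s
      have "R 0 \<or> R 1 \<or> R 2 \<or> R 3 \<or> R 4" using p d' unfolding R_def by auto
      then have "\<exists>s\<in>{0..<5}. R s" by (elim disjE) (rule bexI, assumption, simp)+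
      then show ?thesis unfolding R_def .
    qed
    then obtain s where s: "s \<in> {0..<5}" "f (d (s + 1)) = f (d (s + 3))" "f (d (s + 2)) = f (d (s + 4))" by blast
    have n: "f (d s) \<noteq> f (d (s + 1))" "f (d (s + 1)) \<noteq> f (d (s + 2))" "f (d (s + 4)) \<noteq> f (d s)"
      by (rule ne, simp add: near_def)+
    obtain g where g: "c3 g S" "g (d s) = 0" "g (d (s + 1)) = 1" "\<And>x y. g x = g y \<longleftrightarrow> f x = f y"
      by (rule c3_permute[OF f n(1), of 0 1]) auto
    have "g (d (s + 4)) \<noteq> 0" "g (d (s + 4)) \<noteq> 1" using g n s(3) by metis+
    then have "g (d (s + 4)) = 2" using c3_lt[OF g(1), of "d (s + 4)"] by linarith
    then have "pat s g" using g s(2,3) unfolding pat_def by metis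
    moreover have "c3 g (range d \<union> B s)" using g(1) s(1) unfolding c3_def S_def by blast
    ultimately show False using B(3) by blast
  qed
  then obtain s where s: "\<And>S. S \<subseteq> V \<Longrightarrow> card S \<le> 6 \<Longrightarrow> \<exists>f. c3 f (range d \<union> S) \<and> pat s f" by blast
  have "five_cycle V E (d s) (d (s + 1)) (d (s + 2)) (d (s + 3)) (d (s + 4))"
  proof unfold_locales
    fix S assume S: "S \<subseteq> V" "card S \<le> 6"
    obtain f where f: "c3 f (range d \<union> S)" "pat s f" using s[OF S] by blast
    have "c3 f ({d s, d (s + 1), d (s + 2), d (s + 3), d (s + 4)} \<union> S)"
      using f(1) unfolding c3_def by blast
    then show "\<exists>f. c3 f ({d s, d (s + 1), d (s + 2), d (s + 3), d (s + 4)} \<union> S) \<and> f (d s) = 0 \<and>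
      f (d (s + 1)) = 1 \<and> f (d (s + 2)) = 2 \<and> f (d (s + 3)) = 1 \<and> f (d (s + 4)) = 2"
      using f(2) unfolding pat_def by blast
  qed (simp_all add: icyc_E[OF c] near_def)
  then show False by (rule five_cycle.five_cycle_False)
qed

end

section \<open>The case \<open>k = 5\<close> without five-cycles\<close>

context obstruction5
begin

text \<open>Packs five explicit vertices into the periodic form in which five-cycles have been
  excluded.\<close>

lemma C5_free:
  assumes "E a b" "E b c" "E c d" "E d e" "E e a" "\<not> E a c" "\<not> E a d" "\<not> E b d" "\<not> E b e" "\<not> E c e"
  shows False
proof -
  have ne: "a \<noteq> b" "a \<noteq> c" "a \<noteq> d" "a \<noteq> e" "b \<noteq> c" "b \<noteq> d" "b \<noteq> e" "c \<noteq> d" "c \<noteq> e" "d \<noteq> e"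
    using assms E_sym E_irrefl by blast+
  define w where "w r = (if r = 0 then a else if r = 1 then b else if r = 2 then c else if r = 3 then d else e)" for r :: int
  have m: "i mod 5 = 0 \<or> i mod 5 = 1 \<or> i mod 5 = 2 \<or> i mod 5 = 3 \<or> i mod 5 = 4" for i :: int
    by presburger
  have E': "E b a" "E c b" "E d c" "E e d" "E a e" "\<not> E c a" "\<not> E d a" "\<not> E d b" "\<not> E e b" "\<not> E e c"
    using assms E_sym by blast+
  have w_E: "E (w r) (w s) \<longleftrightarrow> r = (s + 1) mod 5 \<or> s = (r + 1) mod 5"
    if "r = 0 \<or> r = 1 \<or> r = 2 \<or> r = 3 \<or> r = 4" "s = 0 \<or> s = 1 \<or> s = 2 \<or> s = 3 \<or> s = 4" for r s
    using that by (elim disjE) (simp_all add: w_def assms E' E_irrefl)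
  have w_eq: "w r = w s \<longleftrightarrow> r = s"
    if "r = 0 \<or> r = 1 \<or> r = 2 \<or> r = 3 \<or> r = 4" "s = 0 \<or> s = 1 \<or> s = 2 \<or> s = 3 \<or> s = 4" for r s
    using that by (elim disjE) (simp_all add: w_def ne ne[symmetric])
  have "icyc 5 (\<lambda>i. w (i mod 5))"
    unfolding icyc_def
  proof (intro conjI allI)
    fix i j :: int
    show "w (i mod 5) = w (j mod 5) \<longleftrightarrow> 5 dvd i - j" using w_eq[OF m m] by (simp add: mod_eq_dvd_iff)
    have "i mod 5 = (j mod 5 + 1) mod 5 \<longleftrightarrow> 5 dvd i - j - 1"
      by (simp add: mod_simps mod_eq_dvd_iff algebra_simps)
    moreover have "j mod 5 = (i mod 5 + 1) mod 5 \<longleftrightarrow> 5 dvd j - i - 1"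
      by (simp add: mod_simps mod_eq_dvd_iff algebra_simps)
    moreover have "5 dvd j - i - 1 \<longleftrightarrow> 5 dvd i - j + 1"
      using dvd_minus_iff[of 5 "i - j + 1"] by (simp add: algebra_simps)
    ultimately show "E (w (i mod 5)) (w (j mod 5)) \<longleftrightarrow> near 5 i j"
      using w_E[OF m m] unfolding near_def by simp
  next
    have "w r \<in> V" for r unfolding w_def using assms(1-4) E_V E_V2 by auto
    then show "range (\<lambda>i. w (i mod 5)) \<subseteq> V" by blast
  qed simp
  then show False by (rule no_five_cycle)
qed

text \<open>A shortest odd cycle has at most five vertices, and length 5 is already
  excluded.\<close>

lemma triangle_free_bip:
  assumes "W \<subseteq> V" and tri: "\<And>x y z. x \<in> W \<Longrightarrow> y \<in> W \<Longrightarrow> z \<in> W \<Longrightarrow> E x y \<Longrightarrow> E y z \<Longrightarrow> E x z \<Longrightarrow> False"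
  shows "bip W"
proof (rule ccontr)
  assume "\<not> bip W"
  then obtain n v where v: "odd n" "icyc (int n) v" "range v \<subseteq> W"
    using shortest_odd_cycle assms(1) by metis
  have "n \<le> 5" "n \<ge> 3" using cycle_le v(2) by (auto simp: icyc_def)
  then have "n = 3 \<or> n = 4 \<or> n = 5" by auto
  then have "n = 3 \<or> n = 5" using v(1) by auto
  then show False
  proof
    assume "n = 3"
    then have "E (v 0) (v 1)" "E (v 1) (v 2)" "E (v 0) (v 2)"
      using icyc_E[OF v(2)] by (simp_all add: near_def)
    then show False using tri v(3) by blast
  next
    assume "n = 5"
    then show False using no_five_cycle v(2) by simp
  qed
qed

section \<open>Dominating cliques and star cutsets\<close>

definition clique where "clique K \<longleftrightarrow> K \<subseteq> V \<and> (\<forall>x\<in>K. \<forall>y\<in>K. x \<noteq> y \<longrightarrow> E x y)"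
lemma cliqueD: "clique K \<Longrightarrow> x \<in> K \<Longrightarrow> y \<in> K \<Longrightarrow> x \<noteq> y \<Longrightarrow> E x y" by (simp add: clique_def)

definition Nbh where "Nbh K = K \<union> {y. \<exists>x\<in>K. E x y}"

lemma Nbh_V: "K \<subseteq> V \<Longrightarrow> Nbh K \<subseteq> V" using E_V2 by (auto simp: Nbh_def)

lemma V_nonempty: "V \<noteq> {}" using big by auto

text \<open>A clique whose closed neighbourhood is largest is dominating: if \<open>u\<close> is not dominated and \<open>x\<close>
  is a dominated neighbour of \<open>u\<close>, replace the non-neighbours of \<open>x\<close> in the clique by \<open>x\<close>. A vertex
  \<open>y\<close> lost that way would yield a path or a five-cycle \<open>u x p q y\<close>.\<close>

lemma dominating_clique: obtains K where "clique K" "Nbh K = V"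
proof -
  define C where "C = {K. clique K}"
  have fin: "finite C" unfolding C_def clique_def using finV by (auto intro: finite_subset[of _ "Pow V"])
  have "{} \<in> C" by (simp add: C_def clique_def)
  obtain v0 where v0: "v0 \<in> V" using V_nonempty by blast
  define M where "M = Max ((\<lambda>K. card (Nbh K)) ` C)"
  have "M \<in> (\<lambda>K. card (Nbh K)) ` C" unfolding M_def using fin \<open>{} \<in> C\<close> by (intro Max_in) auto
  then obtain K where K: "K \<in> C" "card (Nbh K) = M" by auto
  have max: "card (Nbh K') \<le> card (Nbh K)" if "K' \<in> C" for K'
    unfolding K(2) M_def using fin that by (intro Max_ge) auto
  have cl: "clique K" using K(1) by (simp add: C_def)
  have NK: "Nbh K \<subseteq> V" using cl Nbh_V by (simp add: clique_def)
  have ne: "Nbh K \<noteq> {}"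
  proof
    assume "Nbh K = {}"
    then have "card (Nbh {v0}) \<le> 0" using max[of "{v0}"] v0 by (simp add: C_def clique_def)
    moreover have "finite (Nbh {v0})" using Nbh_V[of "{v0}"] v0 finV finite_subset by blast
    ultimately have "Nbh {v0} = {}" by simp
    then show False by (auto simp: Nbh_def)
  qed
  have "Nbh K = V"
  proof (rule ccontr)
    assume "Nbh K \<noteq> V"
    then obtain x u where xu: "x \<in> Nbh K" "u \<in> V - Nbh K" "E x u" using connected[OF NK ne] by blast
    have uK: "\<not> E u k" "u \<noteq> k" if "k \<in> K" for k using xu(2) that E_sym by (auto simp: Nbh_def)
    have "x \<notin> K" using xu(2,3) by (auto simp: Nbh_def)
    then obtain p where p: "p \<in> K" "E x p" using xu(1) E_sym by (auto simp: Nbh_def)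
    define K' where "K' = insert x {k \<in> K. E x k}"
    have "clique K'" using cl E_V[OF xu(3)] E_sym unfolding clique_def K'_def by auto
    moreover have "y \<in> Nbh K'" if y: "y \<in> Nbh K" for y
    proof (rule ccontr)
      assume n: "y \<notin> Nbh K'"
      then have ny: "y \<noteq> x" "\<not> E x y" "\<not> E p y" "y \<noteq> p" using p by (auto simp: Nbh_def K'_def)
      have "y \<notin> K" using cliqueD[OF cl p(1), of y] ny(3,4) by metis
      then obtain r where r: "r \<in> K" "E r y" using y by (auto simp: Nbh_def)
      then have xr: "\<not> E x r" using n by (auto simp: Nbh_def K'_def)
      then have "r \<noteq> p" using p(2) by blast
      then have pr: "E p r" using cliqueD[OF cl p(1) r(1)] by metis
      have ux: "E u x" using xu(3) E_sym by blast
      show False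
      proof (cases "E u y")
        case True
        show False by (rule C5_free[OF ux p(2) pr r(2) E_sym[OF True]]) (use uK(1)[OF p(1)] uK(1)[OF r(1)] xr ny(2,3) in simp_all)
      next
        case False
        show False by (rule P5_free[OF ux p(2) pr r(2)]) (use False uK(1)[OF p(1)] uK(1)[OF r(1)] xr ny(2,3) in simp_all)
      qed
    qed
    moreover have "u \<in> Nbh K'" using xu(3) by (auto simp: Nbh_def K'_def)
    ultimately have "insert u (Nbh K) \<subseteq> Nbh K'" "clique K'" by blast+
    moreover from this have "finite (Nbh K')" using Nbh_V[of K'] finV finite_subset by (auto simp: clique_def)
    ultimately have "card (insert u (Nbh K)) \<le> card (Nbh K')" by (intro card_mono) auto
    moreover have "finite (Nbh K)" using NK finV finite_subset by blast
    ultimately have "card (Nbh K) < card (Nbh K')" using xu(2) by simp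
    then show False using max[of K'] \<open>clique K'\<close> by (simp add: C_def)
  qed
  then show ?thesis using that cl by blast
qed

lemma c3_zero: assumes "c3 f S" obtains g where "c3 g S" "g a = 0"
proof -
  have inj: "(x + (3 - a)) mod 3 = (y + (3 - a)) mod 3 \<longleftrightarrow> x = y" if "x < 3" "y < 3" "a < 3" for x y a :: nat
  proof -
    have "z = 0 \<or> z = 1 \<or> z = 2" if "z < 3" for z :: nat using that by auto
    from this[OF that(1)] this[OF that(2)] this[OF that(3)] show ?thesis by (elim disjE) simp_all
  qed
  have "c3 (\<lambda>x. (f x + (3 - f a)) mod 3) S"
    unfolding c3_def
  proof (intro conjI allI ballI impI)
    fix u w assume "u \<in> S" "w \<in> S" "E u w"
    then have "f u \<noteq> f w" using c3_E[OF assms] by blast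
    then show "(f u + (3 - f a)) mod 3 \<noteq> (f w + (3 - f a)) mod 3"
      using inj[OF c3_lt[OF assms, of u] c3_lt[OF assms, of w] c3_lt[OF assms, of a]] by blast
  qed simp
  then show ?thesis by (rule that) (use c3_lt[OF assms, of a] in simp)
qed

text \<open>There is no star cutset: colour the two sides with the same colour on \<open>a\<close>. Removing that
  colour class from both leaves a triangle-free, hence bipartite, graph.\<close>

lemma no_star_cutset:
  assumes "a \<in> V" and L: "L = {x \<in> V. x \<noteq> a \<and> \<not> E a x}" and l: "l \<in> L" "l' \<in> L"
  shows "conn L l l'"
proof (rule ccontr)
  assume n: "\<not> conn L l l'"
  define L1 where "L1 = {x \<in> L. conn L l x}"
  have l1: "l \<in> L1" "l' \<notin> L1" using l n by (auto simp: L1_def)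
  have no: "\<not> E x y" "\<not> E y x" if "x \<in> L1" "y \<in> L - L1" for x y
  proof -
    have False if "E x y"
    proof -
      have "adj_in L x y" using \<open>x \<in> L1\<close> \<open>y \<in> L - L1\<close> that by (auto simp: adj_in_def L1_def)
      then have "conn L l y" using \<open>x \<in> L1\<close> by (auto simp: L1_def)
      then show False using \<open>y \<in> L - L1\<close> by (simp add: L1_def)
    qed
    then show "\<not> E x y" "\<not> E y x" using E_sym by blast+
  qed
  have L1L: "L1 \<subseteq> L" by (auto simp: L1_def)
  have LV: "L \<subseteq> V" using L by auto
  obtain f1 where f1: "c3 f1 (V - (L - L1))" "f1 a = 0"
  proof -
    have "V - (L - L1) \<subset> V" using l l1 LV by blast
    then obtain f where "c3 f (V - (L - L1))" by (rule crit_c3)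
    then show ?thesis using c3_zero that by blast
  qed
  obtain f2 where f2: "c3 f2 (V - L1)" "f2 a = 0"
  proof -
    have "V - L1 \<subset> V" using l1 L1L LV by blast
    then obtain f where "c3 f (V - L1)" by (rule crit_c3)
    then show ?thesis using c3_zero that by blast
  qed
  have aL: "a \<notin> L" using L by simp
  define S where "S = insert a ({x \<in> L1. f1 x = 0} \<union> {x \<in> L - L1. f2 x = 0})"
  have S_ind: "\<not> E x y" if "x \<in> S" "y \<in> S" for x y
  proof
    assume e: "E x y"
    have aS: "\<not> E a z" "\<not> E z a" if "z \<in> S" for z using that L L1L E_sym E_irrefl by (auto simp: S_def)
    then have "x \<noteq> a" "y \<noteq> a" using e that by blast+
    then have "x \<in> L1 \<and> f1 x = 0 \<or> x \<in> L - L1 \<and> f2 x = 0" "y \<in> L1 \<and> f1 y = 0 \<or> y \<in> L - L1 \<and> f2 y = 0"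
      using that by (auto simp: S_def)
    moreover have "x \<in> L1 \<longleftrightarrow> y \<in> L1"
      using no(1)[of x y] no(2)[of y x] e calculation by (metis Diff_iff)
    ultimately consider "x \<in> L1" "y \<in> L1" "f1 x = 0" "f1 y = 0" | "x \<in> L - L1" "y \<in> L - L1" "f2 x = 0" "f2 y = 0"
      by (metis Diff_iff)
    then show False
    proof cases
      case 1
      then have "x \<in> V - (L - L1)" "y \<in> V - (L - L1)" using LV L1L by blast+
      then show False using c3_E[OF f1(1) _ _ e] 1 by simp
    next
      case 2
      then have "x \<in> V - L1" "y \<in> V - L1" using LV by blast+
      then show False using c3_E[OF f2(1) _ _ e] 2 by simp
    qed
  qed
  have nz1: "f1 x \<noteq> 0" if "x \<in> V - (L - L1)" "x \<notin> S" for x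
  proof (cases "x \<in> L1")
    case True
    then show ?thesis using that by (simp add: S_def)
  next
    case False
    have "x \<noteq> a" using that(2) by (simp add: S_def)
    then have "E a x" using that(1) False L by blast
    moreover have "a \<in> V - (L - L1)" using assms(1) aL by blast
    ultimately show ?thesis using c3_E[OF f1(1) _ that(1), of a] f1(2) by simp
  qed
  have nz2: "f2 x \<noteq> 0" if "x \<in> V - L1" "x \<notin> S" for x
  proof (cases "x \<in> L")
    case True
    then show ?thesis using that by (simp add: S_def)
  next
    case False
    have "x \<noteq> a" using that(2) by (simp add: S_def)
    then have "E a x" using that(1) False L by blast
    moreover have "a \<in> V - L1" using assms(1) aL L1L by blast
    ultimately show ?thesis using c3_E[OF f2(1) _ that(1), of a] f2(2) by simp
  qed
  have three: False if f: "c3 f T" "x \<in> T" "y \<in> T" "z \<in> T" "E x y" "E y z" "E x z" "f x \<noteq> 0" "f y \<noteq> 0" "f z \<noteq> 0"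
    for f T x y z
    using c3_E[OF f(1,2,3,5)] c3_E[OF f(1,3,4,6)] c3_E[OF f(1,2,4,7)] f(8-10)
      c3_lt[OF f(1), of x] c3_lt[OF f(1), of y] c3_lt[OF f(1), of z] by linarith
  have "bip (V - S)"
  proof (rule triangle_free_bip)
    fix x y z assume m: "x \<in> V - S" "y \<in> V - S" "z \<in> V - S" and e: "E x y" "E y z" "E x z"
    \<comment> \<open>No edge joins \<open>L1\<close> to \<open>L - L1\<close>, so a triangle lies
      on one side, where its three vertices would have to share the colours 1 and 2.\<close>
    have "\<not> (u \<in> L1 \<and> w \<in> L - L1)" "\<not> (w \<in> L1 \<and> u \<in> L - L1)" if "E u w" for u w
      using no(1)[of u w] no(2)[of w u] that by blast+
    note this[OF e(1)] this[OF e(2)] this[OF e(3)]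
    then have "(x \<in> V - (L - L1) \<and> y \<in> V - (L - L1) \<and> z \<in> V - (L - L1)) \<or> (x \<in> V - L1 \<and> y \<in> V - L1 \<and> z \<in> V - L1)"
      using m by blast
    then show False
    proof
      assume *: "x \<in> V - (L - L1) \<and> y \<in> V - (L - L1) \<and> z \<in> V - (L - L1)"
      then have "f1 x \<noteq> 0" "f1 y \<noteq> 0" "f1 z \<noteq> 0" using nz1 m by blast+
      then show False using three[OF f1(1) _ _ _ e] * by blast
    next
      assume *: "x \<in> V - L1 \<and> y \<in> V - L1 \<and> z \<in> V - L1"
      then have "f2 x \<noteq> 0" "f2 y \<noteq> 0" "f2 z \<noteq> 0" using nz2 m by blast+
      then show False using three[OF f2(1) _ _ _ e] * by blast
    qed
  qed blast
  then obtain b :: "'a \<Rightarrow> bool" where b: "\<And>x y. x \<in> V - S \<Longrightarrow> y \<in> V - S \<Longrightarrow> E x y \<Longrightarrow> b x \<noteq> b y"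
    unfolding bip_def by blast
  have "c3 (\<lambda>x. if x \<in> S then 0 else if b x then 1 else 2) V"
    unfolding c3_def using b S_ind by auto
  then show False using not_c3 by blast
qed

text \<open>Colour \<open>w\<close> by 1 and \<open>a\<close> by 2. Then \<open>L\<close> has the
  colours 0 and 2, \<open>M\<close> has 0 and 1, and a conflict between them is an edge with both
  ends 0. Each of the four ways to orient the two bipartitions has such an edge; induced paths of at
  most four vertices tie its ends to a base vertex on either side.\<close>

lemma no_dominating_edge:
  assumes wa: "E w a" and common: "\<And>x. E w x \<Longrightarrow> E a x \<Longrightarrow> False" and dom: "\<And>x. x \<in> V \<Longrightarrow> E w x \<or> E a x"
  shows False
proof -
  define L where "L = {x \<in> V. x \<noteq> a \<and> \<not> E a x}"
  define M where "M = {x \<in> V. x \<noteq> w \<and> \<not> E w x}"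
  have V: "w \<in> V" "a \<in> V" using wa E_V E_V2 by blast+
  have LV: "L \<subseteq> V" "M \<subseteq> V" by (auto simp: L_def M_def)
  have Lw: "E w x" "\<not> E a x" "x \<noteq> w" "x \<noteq> a" if "x \<in> L" for x
  proof -
    show "\<not> E a x" "x \<noteq> a" using that by (simp_all add: L_def)
    then show "E w x" using dom[of x] that by (auto simp: L_def)
    then show "x \<noteq> w" using E_irrefl by blast
  qed
  have Ma: "E a x" "\<not> E w x" "x \<noteq> w" "x \<noteq> a" if "x \<in> M" for x
  proof -
    show "\<not> E w x" "x \<noteq> w" using that by (simp_all add: M_def)
    then show "E a x" using dom[of x] that by (auto simp: M_def)
    then show "x \<noteq> a" using E_irrefl by blast
  qed
  have split: "x = w \<or> x = a \<or> x \<in> L \<or> x \<in> M" if "x \<in> V" for x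
    using that common[of x] unfolding L_def M_def by blast
  obtain bL :: "'a \<Rightarrow> bool" where bL: "\<And>x y. x \<in> L \<Longrightarrow> y \<in> L \<Longrightarrow> E x y \<Longrightarrow> bL x \<noteq> bL y"
  proof -
    have "bip L" by (rule nbhd_bip[OF LV(1) Lw(1)])
    then show ?thesis using that unfolding bip_def by blast
  qed
  obtain bM :: "'a \<Rightarrow> bool" where bM: "\<And>x y. x \<in> M \<Longrightarrow> y \<in> M \<Longrightarrow> E x y \<Longrightarrow> bM x \<noteq> bM y"
  proof -
    have "bip M" by (rule nbhd_bip[OF LV(2) Ma(1)])
    then show ?thesis using that unfolding bip_def by blast
  qed
  \<comment> \<open>\<open>t\<close> and \<open>s\<close> say which side of each bipartition
    receives colour 0.\<close>
  have bad: "\<exists>l m. l \<in> L \<and> m \<in> M \<and> E l m \<and> bL l = t \<and> bM m = s" for t s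
  proof (rule ccontr)
    assume none: "\<not> ?thesis"
    define F :: "'a \<Rightarrow> nat" where "F x = (if x = w then 1 else if x = a then 2 else
      if x \<in> L then (if bL x = t then 0 else 2) else (if bM x = s then 0 else 1))" for x
    have Fw: "F w = 1" and Fa: "F a = 2" using wa E_irrefl by (auto simp: F_def)
    have FL: "F x = (if bL x = t then 0 else 2)" if "x \<in> L" for x using Lw[OF that] that by (simp add: F_def)
    have FM: "F x = (if bM x = s then 0 else 1)" if "x \<in> M" for x
      using Ma[OF that] Lw(2)[of x] by (auto simp: F_def)
    have half: "F x \<noteq> F y" if h: "E x y" "x = w \<or> x = a \<or> x \<in> L" "y = a \<or> y \<in> L \<or> y \<in> M" "x = w \<or> y \<noteq> a" for x y
    proof -
      consider "x = w" "y = a" | "x = w" "y \<in> L" | "x = w" "y \<in> M" | "x = a" "y \<in> L" | "x = a" "y \<in> M"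
        | "x \<in> L" "y \<in> L" | "x \<in> L" "y \<in> M" using h(2-4) by blast
      then show ?thesis
      proof cases
        case 1
        then show ?thesis using Fw Fa by simp
      next
        case 2
        then show ?thesis using Fw FL by simp
      next
        case 3
        then show ?thesis using Ma(2) h(1) by blast
      next
        case 4
        then show ?thesis using Lw(2) h(1) by blast
      next
        case 5
        then show ?thesis using Fa FM by simp
      next
        case 6
        then show ?thesis using FL bL h(1) by auto
      next
        case 7
        then show ?thesis using FL FM none h(1) by auto
      qed
    qed
    have MM: "F x \<noteq> F y" if "E x y" "x \<in> M" "y \<in> M" for x y using FM bM that by auto
    have "F x \<noteq> F y" if e: "E x y" for x y
    proof -
      have sp: "x = w \<or> x = a \<or> x \<in> L \<or> x \<in> M" "y = w \<or> y = a \<or> y \<in> L \<or> y \<in> M"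
        using split E_V[OF e] E_V2[OF e] by blast+
      have ww: "\<not> (x = w \<and> y = w)" "\<not> (x = a \<and> y = a)" using e E_irrefl by blast+
      have la: "\<not> (x \<in> L \<and> y = a)" "\<not> (y \<in> L \<and> x = a)" using Lw(2) e E_sym by blast+
      consider "x \<in> M" "y \<in> M" | "x = w \<or> x = a \<or> x \<in> L" "y = a \<or> y \<in> L \<or> y \<in> M" "x = w \<or> y \<noteq> a"
        | "y = w \<or> y = a \<or> y \<in> L" "x = a \<or> x \<in> L \<or> x \<in> M" "y = w \<or> x \<noteq> a"
        using sp ww la by blast
      then show ?thesis
      proof cases
        case 1
        then show ?thesis using MM e by blast
      next
        case 2
        then show ?thesis using half e by blast
      next
        case 3
        then show ?thesis using half[of y x] E_sym[OF e] by simp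
      qed
    qed
    then have "c3 F V" unfolding c3_def by (auto simp: F_def)
    then show False using not_c3 by blast
  qed
  then obtain l m where lm: "\<And>t s. l t s \<in> L" "\<And>t s. m t s \<in> M" "\<And>t s. E (l t s) (m t s)"
    "\<And>t s. bL (l t s) = t" "\<And>t s. bM (m t s) = s" by metis
  have "\<exists>xs. xs \<noteq> [] \<and> hd xs = l True True \<and> last xs = l t s \<and> set xs \<subseteq> L \<and> ipath xs" for t s
    using conn_ipath[OF no_star_cutset[OF V(2) L_def lm(1) lm(1)] lm(1) LV(1)] by metis
  then obtain P where P: "\<And>t s. P t s \<noteq> []" "\<And>t s. hd (P t s) = l True True" "\<And>t s. last (P t s) = l t s"
    "\<And>t s. set (P t s) \<subseteq> L" "\<And>t s. ipath (P t s)" by metis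
  have "\<exists>xs. xs \<noteq> [] \<and> hd xs = m True True \<and> last xs = m t s \<and> set xs \<subseteq> M \<and> ipath xs" for t s
    using conn_ipath[OF no_star_cutset[OF V(1) M_def lm(2) lm(2)] lm(2) LV(2)] by metis
  then obtain Q where Q: "\<And>t s. Q t s \<noteq> []" "\<And>t s. hd (Q t s) = m True True" "\<And>t s. last (Q t s) = m t s"
    "\<And>t s. set (Q t s) \<subseteq> M" "\<And>t s. ipath (Q t s)" by metis
  define R where "R t s = set (P t s) \<union> set (Q t s)" for t s
  have R8: "card (R t s) \<le> 8" for t s
  proof -
    have "card (set (P t s)) \<le> 4" "card (set (Q t s)) \<le> 4"
      using card_length[of "P t s"] card_length[of "Q t s"] ipath_short[OF P(5), of t s] ipath_short[OF Q(5), of t s] by auto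
    then show ?thesis unfolding R_def using card_Un_le[of "set (P t s)" "set (Q t s)"] by linarith
  qed
  \<comment> \<open>Two vertices and four pairs of paths with at most 8 vertices each: 34 in
    all.\<close>
  define S where "S = {w, a} \<union> ((R True True \<union> R True False) \<union> (R False True \<union> R False False))"
  have RS: "R t s \<subseteq> S" for t s by (cases t; cases s) (auto simp: S_def)
  have "card {w, a} \<le> 2" by (simp add: card_insert_if)
  then have "card S \<le> 43"
    using card_Un_le[of "{w, a}" "(R True True \<union> R True False) \<union> (R False True \<union> R False False)"]
      card_Un_le[of "R True True \<union> R True False" "R False True \<union> R False False"]
      card_Un_le[of "R True True" "R True False"] card_Un_le[of "R False True" "R False False"]
      R8[of True True] R8[of True False] R8[of False True] R8[of False False] unfolding S_def by linarith
  moreover have "S \<subseteq> V" using V P(4) Q(4) LV unfolding S_def R_def by blast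
  ultimately obtain f0 where f0: "c3 f0 S" using local_c3 by blast
  have "f0 w \<noteq> f0 a" using c3_E[OF f0 _ _ wa] by (simp add: S_def)
  then obtain f where f: "c3 f S" "f w = 1" "f a = 2" by (rule c3_permute[OF f0, of w a 1 2]) auto
  have fL: "f x = 0 \<or> f x = 2" if "x \<in> S" "x \<in> L" for x
    using c3_E[OF f(1) _ that(1) Lw(1)[OF that(2)]] f(2) c3_lt[OF f(1), of x] by (auto simp: S_def)
  have fM: "f x = 0 \<or> f x = 1" if "x \<in> S" "x \<in> M" for x
    using c3_E[OF f(1) _ that(1) Ma(1)[OF that(2)]] f(3) c3_lt[OF f(1), of x] by (auto simp: S_def)
  have PL: "((f (l True True) = 0) = bL (l True True)) = ((f (l t s) = 0) = bL (l t s))" for t s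
  proof -
    have sub: "set (P t s) \<subseteq> S" "set (P t s) \<subseteq> L" using RS[of t s] P(4) by (auto simp: R_def)
    have "((f (hd (P t s)) = 0) = bL (hd (P t s))) = ((f (last (P t s)) = 0) = bL (last (P t s)))"
    proof (rule alternating_ipath[OF P(5,1)])
      fix x y assume xy: "x \<in> set (P t s)" "y \<in> set (P t s)" "E x y"
      then show "bL x \<noteq> bL y" using bL sub by blast
      have "f x \<noteq> f y" using c3_E[OF f(1) _ _ xy(3)] xy sub by blast
      moreover have "f x = 0 \<or> f x = 2" "f y = 0 \<or> f y = 2" using fL xy sub by blast+
      ultimately show "(f x = 0) \<noteq> (f y = 0)" by auto
    qed
    then show ?thesis using P(2,3) by simp
  qed
  have QM: "((f (m True True) = 0) = bM (m True True)) = ((f (m t s) = 0) = bM (m t s))" for t s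
  proof -
    have sub: "set (Q t s) \<subseteq> S" "set (Q t s) \<subseteq> M" using RS[of t s] Q(4) by (auto simp: R_def)
    have "((f (hd (Q t s)) = 0) = bM (hd (Q t s))) = ((f (last (Q t s)) = 0) = bM (last (Q t s)))"
    proof (rule alternating_ipath[OF Q(5,1)])
      fix x y assume xy: "x \<in> set (Q t s)" "y \<in> set (Q t s)" "E x y"
      then show "bM x \<noteq> bM y" using bM sub by blast
      have "f x \<noteq> f y" using c3_E[OF f(1) _ _ xy(3)] xy sub by blast
      moreover have "f x = 0 \<or> f x = 1" "f y = 0 \<or> f y = 1" using fM xy sub by blast+
      ultimately show "(f x = 0) \<noteq> (f y = 0)" by auto
    qed
    then show ?thesis using Q(2,3) by simp
  qed
  \<comment> \<open>\<open>t\<close> and \<open>s\<close> are the orientations that \<open>f\<close>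
    itself uses, so the obstruction chosen for them applies to \<open>f\<close>.\<close>
  define t where "t = ((f (l True True) = 0) = bL (l True True))"
  define s where "s = ((f (m True True) = 0) = bM (m True True))"
  have "f (l t s) = 0" using PL[of t s] lm(4)[of t s] unfolding t_def by auto
  moreover have "f (m t s) = 0" using QM[of t s] lm(5)[of t s] unfolding s_def by auto
  moreover have "l t s \<in> S" "m t s \<in> S"
    using RS[of t s] last_in_set[OF P(1), of t s] last_in_set[OF Q(1), of t s] P(3)[of t s] Q(3)[of t s]
    by (auto simp: R_def)
  ultimately show False using c3_E[OF f(1) _ _ lm(3)] by metis
qed

end

section \<open>A dominating triangle\<close>

locale dominating_triangle = obstruction5 V E for V :: "'a set" and E +
  fixes t :: "int \<Rightarrow> 'a"
  assumes tri: "icyc 3 t" and dom: "x \<in> V \<Longrightarrow> x \<in> range t \<or> (\<exists>i. E x (t i))"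
begin

lemma near3: "near 3 a b \<longleftrightarrow> \<not> 3 dvd a - b"
  unfolding near_def by presburger

definition good where "good f S \<longleftrightarrow> (\<forall>i. 3 dvd f (t i) - i) \<and>
  (\<forall>x\<in>S \<union> range t. \<forall>y\<in>S \<union> range t. E x y \<longrightarrow> \<not> (3::int) dvd f x - f y)"

lemma good_E: "good f S \<Longrightarrow> x \<in> S \<Longrightarrow> y \<in> S \<Longrightarrow> E x y \<Longrightarrow> \<not> 3 dvd f x - f y"
  by (auto simp: good_def)
lemma good_mono: "good f S \<Longrightarrow> T \<subseteq> S \<Longrightarrow> good f T" unfolding good_def by blast

lemma good_t: assumes "good f S" "x \<in> S" "E x (t i)" shows "\<not> 3 dvd f x - i"
proof -
  have "3 dvd f (t i) - i" using assms(1) by (simp add: good_def)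
  moreover have "\<not> 3 dvd f x - f (t i)" using assms unfolding good_def by blast
  ultimately show ?thesis by presburger
qed

lemma local_good:
  assumes "S \<subseteq> V" "card S \<le> 40" obtains f where "good f S"
proof -
  have "card (S \<union> range t) \<le> card S + card (range t)" by (rule card_Un_le)
  then have "card (S \<union> range t) \<le> 3 * 5 + 28" using icyc_card[OF tri] assms(2) by simp
  moreover have "S \<union> range t \<subseteq> V" using assms(1) tri by (auto simp: icyc_def)
  ultimately have h: "hcol 3 (S \<union> range t)" using local_col by blast
  obtain f where "\<And>i. 3 dvd f (t i) - i"
    "\<And>x y. x \<in> S \<union> range t \<Longrightarrow> y \<in> S \<union> range t \<Longrightarrow> E x y \<Longrightarrow> near 3 (f x) (f y)"
  proof -
    have "odd (3 :: int)" by simp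
    from hcol_normalised[OF tri this h] that show ?thesis by blast
  qed
  then have "good f S" unfolding good_def near3 by blast
  then show ?thesis using that by blast
qed

definition B where "B i x \<longleftrightarrow> x \<in> V \<and> x \<notin> range t \<and> E x (t i) \<and> \<not> E x (t (i + 1)) \<and> \<not> E x (t (i - 1))"
definition det where "det x c \<longleftrightarrow> x \<in> V \<and> (\<forall>f S. good f S \<longrightarrow> x \<in> S \<longrightarrow> 3 dvd f x - c)"
text \<open>Vertices isolated in their own class. Only they take part in chains of implications; the
  other vertices with a single triangle neighbour follow the bipartition of their class.\<close>

definition triv where "triv x \<longleftrightarrow> (\<exists>i. B i x \<and> (\<forall>y. B i y \<longrightarrow> \<not> E x y))"

lemma t_cong: "3 dvd i - j \<Longrightarrow> t i = t j" using icyc_eq[OF tri] by blast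
lemma t_V: "t i \<in> V" using icyc_V[OF tri] .
lemma B_V: "B i x \<Longrightarrow> x \<in> V" by (simp add: B_def)
lemma B_t: "B i x \<Longrightarrow> E x (t i)" by (simp add: B_def)

lemma B_nb: assumes "B i x" "E x (t j)" shows "3 dvd i - j"
proof -
  have "3 dvd i - j \<or> 3 dvd (i + 1) - j \<or> 3 dvd (i - 1) - j" by presburger
  then show ?thesis using t_cong[of "i + 1" j] t_cong[of "i - 1" j] assms by (auto simp: B_def)
qed

lemma B_cong: assumes "B i x" "3 dvd i - j" shows "B j x"
proof -
  have "t i = t j" "t (i + 1) = t (j + 1)" "t (i - 1) = t (j - 1)" using assms(2) by (auto intro!: t_cong)
  then show ?thesis using assms(1) by (simp add: B_def)
qed

lemma B_unique: "B i x \<Longrightarrow> B j x \<Longrightarrow> 3 dvd i - j" using B_nb B_t by blast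

lemma B_colour: assumes "good f S" "x \<in> S" "B i x" shows "3 dvd f x - (i - 1) \<or> 3 dvd f x - (i + 1)"
  using good_t[OF assms(1,2) B_t[OF assms(3)]] by presburger

lemma classification: assumes "x \<in> V" shows "(\<exists>i. B i x) \<or> (\<exists>c. det x c)"
proof (cases "x \<in> range t")
  case True
  then obtain i where "x = t i" by blast
  then have "det x i" using t_V by (auto simp: det_def good_def)
  then show ?thesis by blast
next
  case False
  then obtain i where i: "E x (t i)" using dom assms by blast
  have "det x (i + 2)" if "E x (t (i + 1))"
    unfolding det_def
  proof (intro conjI allI impI)
    fix f S assume f: "good f S" "x \<in> S"
    show "3 dvd f x - (i + 2)" using good_t[OF f i] good_t[OF f that] by presburger
  qed (rule assms)
  moreover have "det x (i + 1)" if "E x (t (i - 1))"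
    unfolding det_def
  proof (intro conjI allI impI)
    fix f S assume f: "good f S" "x \<in> S"
    show "3 dvd f x - (i + 1)" using good_t[OF f i] good_t[OF f that] by presburger
  qed (rule assms)
  ultimately show ?thesis using i False assms unfolding B_def by blast
qed

lemma det_V: "det x c \<Longrightarrow> x \<in> V" by (simp add: det_def)
lemma det_f: "det x c \<Longrightarrow> good f S \<Longrightarrow> x \<in> S \<Longrightarrow> 3 dvd f x - c" by (simp add: det_def)

text \<open>A vertex of one class attached to an edge inside another class is attached to both of its
  ends and isolated in its own class; hence no constraint travels through such edges.\<close>

lemma edge_complete:
  assumes "B i p" "B i p'" "E p p'" "B j w" "\<not> 3 dvd i - j" "E w p" shows "E w p'"
proof (rule ccontr)
  assume n: "\<not> E w p'"
  define k where "k = - i - j"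
  have k: "\<not> 3 dvd i - k" "\<not> 3 dvd j - k" using assms(5) unfolding k_def by presburger+
  have "E (t j) (t k)" using icyc_E[OF tri] near3 k(2) by blast
  moreover have "\<not> E p (t j)" "\<not> E p (t k)" "\<not> E p' (t j)" "\<not> E p' (t k)" "\<not> E w (t k)"
    using B_nb assms(1,2,4,5) k by blast+
  ultimately show False
    using P5_free[OF E_sym[OF assms(3)] E_sym[OF assms(6)] B_t[OF assms(4)]] n E_sym by blast
qed

lemma no_edge_edge:
  assumes "B i p" "B i p'" "E p p'" "B j w" "B j w'" "E w w'" "\<not> 3 dvd i - j" "E w p" shows False
proof -
  have ji: "\<not> 3 dvd j - i" using assms(7) by presburger
  have wp': "E w p'" using edge_complete[OF assms(1-4,7,8)] .
  have "E p w'" using edge_complete[OF assms(4-6,1) ji E_sym[OF assms(8)]] .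
  moreover have "E p' w'" using edge_complete[OF assms(4-6,2) ji E_sym[OF wp']] .
  ultimately show False using no_K4[OF assms(3) E_sym[OF assms(8)] _ E_sym[OF wp'] _ assms(6)] by blast
qed

text \<open>Reads a determined neighbour as a Boolean prescription: \<open>s\<close> says that
  \<open>a\<close> must take the upper colour \<open>i + 1\<close>, namely because \<open>b\<close>
  has \<open>i - 1\<close>.\<close>

lemma forced_value:
  fixes a b c i :: int
  assumes "3 dvd a - (i - 1) \<or> 3 dvd a - (i + 1)" "\<not> 3 dvd a - b" "3 dvd b - c"
    "if s then 3 dvd c - (i - 1) else 3 dvd c - (i + 1)"
  shows "(3 dvd a - (i + 1)) = s"
proof (cases s)
  case True
  then have "3 dvd c - (i - 1)" using assms(4) by simp
  then have "3 dvd a - (i + 1)" using assms(1-3) by presburger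
  then show ?thesis using True by simp
next
  case False
  then have "3 dvd c - (i + 1)" using assms(4) by simp
  then have "\<not> 3 dvd a - (i + 1)" using assms(1-3) by presburger
  then show ?thesis using False by simp
qed

text \<open>Conflicting prescriptions in one component would again sit in six vertices: an induced
  path of at most four and two determined ones.\<close>

lemma class_colouring:
  obtains g :: "'a \<Rightarrow> int" where "\<And>x y. B i x \<Longrightarrow> B i y \<Longrightarrow> E x y \<Longrightarrow> \<not> 3 dvd g x - g y"
    "\<And>x. g x = i - 1 \<or> g x = i + 1" "\<And>u x c. B i u \<Longrightarrow> E u x \<Longrightarrow> det x c \<Longrightarrow> \<not> 3 dvd g u - c"
proof -
  define W where "W = {x. B i x}"
  have WV: "W \<subseteq> V" using B_V by (auto simp: W_def)
  have "bip W" by (rule nbhd_bip[OF WV, of "t i"]) (simp add: W_def B_t E_sym)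
  define P where "P u s \<longleftrightarrow> (\<exists>x c. E u x \<and> det x c \<and> (if s then 3 dvd c - (i - 1) else 3 dvd c - (i + 1)))" for u s
  obtain b :: "'a \<Rightarrow> bool" where b: "\<And>x y. x \<in> W \<Longrightarrow> y \<in> W \<Longrightarrow> E x y \<Longrightarrow> b x \<noteq> b y"
    "\<And>u s. u \<in> W \<Longrightarrow> P u s \<Longrightarrow> b u = s"
  proof (rule bip_extend[OF \<open>bip W\<close>, of P])
    fix u u' s s' and b :: "'a \<Rightarrow> bool"
    assume P: "P u s" "P u' s'" and u: "u \<in> W" "u' \<in> W" "conn W u u'"
      and b: "\<And>x y. x \<in> W \<Longrightarrow> y \<in> W \<Longrightarrow> E x y \<Longrightarrow> b x \<noteq> b y"
    obtain xs where xs: "xs \<noteq> []" "hd xs = u" "last xs = u'" "set xs \<subseteq> W" "ipath xs"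
      by (rule conn_ipath[OF u(3,1) WV])
    obtain x c where x: "E u x" "det x c" "if s then 3 dvd c - (i - 1) else 3 dvd c - (i + 1)"
      using P(1) unfolding P_def by blast
    obtain x' c' where x': "E u' x'" "det x' c'" "if s' then 3 dvd c' - (i - 1) else 3 dvd c' - (i + 1)"
      using P(2) unfolding P_def by blast
    define S where "S = set xs \<union> {x, x'}"
    have "length xs \<le> 4" using ipath_short[OF xs(5)] by simp
    then have "card (set xs) \<le> 4" using card_length[of xs] by simp
    moreover have "card {x, x'} \<le> 2" by (simp add: card_insert_if)
    ultimately have "card S \<le> 40" unfolding S_def using card_Un_le[of "set xs" "{x, x'}"] by linarith
    moreover have "S \<subseteq> V" using xs(4) WV det_V[OF x(2)] det_V[OF x'(2)] unfolding S_def by blast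
    ultimately obtain f where f: "good f S" using local_good by blast
    have m: "u \<in> S" "u' \<in> S" "x \<in> S" "x' \<in> S" using xs(1-3) by (auto simp: S_def)
    have Bc: "3 dvd f w - (i - 1) \<or> 3 dvd f w - (i + 1)" if "w \<in> S" "w \<in> W" for w
      using B_colour[OF f] that by (simp add: W_def)
    have "((3 dvd f (hd xs) - (i + 1)) = b (hd xs)) = ((3 dvd f (last xs) - (i + 1)) = b (last xs))"
    proof (rule alternating_ipath[OF xs(5,1)])
      fix w w' assume ww: "w \<in> set xs" "w' \<in> set xs" "E w w'"
      then show "b w \<noteq> b w'" using b xs(4) by blast
      have mS: "w \<in> S" "w' \<in> S" "w \<in> W" "w' \<in> W" using ww xs(4) by (auto simp: S_def)
      show "(3 dvd f w - (i + 1)) \<noteq> (3 dvd f w' - (i + 1))"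
        using Bc[OF mS(1,3)] Bc[OF mS(2,4)] good_E[OF f mS(1,2) ww(3)] by presburger
    qed
    moreover have "(3 dvd f u - (i + 1)) = s"
      using forced_value[OF Bc[OF m(1) u(1)] good_E[OF f m(1,3) x(1)] det_f[OF x(2) f m(3)] x(3)] .
    moreover have "(3 dvd f u' - (i + 1)) = s'"
      using forced_value[OF Bc[OF m(2) u(2)] good_E[OF f m(2,4) x'(1)] det_f[OF x'(2) f m(4)] x'(3)] .
    ultimately show "(s = s') = (b u = b u')" using xs(2,3) by auto
  qed blast
  show ?thesis
  proof (rule that[of "\<lambda>x. if b x then i + 1 else i - 1"])
    fix x y assume "B i x" "B i y" "E x y"
    then have "b x \<noteq> b y" using b(1) by (simp add: W_def)
    then show "\<not> 3 dvd (if b x then i + 1 else i - 1) - (if b y then i + 1 else i - 1)" by simp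
  next
    fix u x c assume u: "B i u" "E u x" "det x c"
    have "b u = s" if "if s then 3 dvd c - (i - 1) else 3 dvd c - (i + 1)" for s
      using b(2)[of u s] u that unfolding P_def W_def by blast
    from this[of True] this[of False] have "3 dvd c - (i - 1) \<Longrightarrow> b u" "3 dvd c - (i + 1) \<Longrightarrow> \<not> b u" by auto
    then have "if b u then \<not> 3 dvd c - (i + 1) else \<not> 3 dvd c - (i - 1)" by auto
    moreover have "3 dvd x - y \<longleftrightarrow> 3 dvd y - x" for x y :: int by presburger
    ultimately show "\<not> 3 dvd (if b u then i + 1 else i - 1) - c" by (simp split: if_splits)
  qed auto
qed

text \<open>Modulo 3 any two different classes are consecutive in one direction, so every edge
  between trivial vertices of different classes is a step one way. A low \<open>x\<close> has colour
  \<open>i - 1\<close>, which is the high colour \<open>i + 2\<close> of class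
  \<open>i + 1\<close>.\<close>

definition step where "step x x' \<longleftrightarrow> (\<exists>i. B i x \<and> B (i + 1) x' \<and> E x x' \<and> triv x \<and> triv x')"
definition FL where "FL x \<longleftrightarrow> (\<exists>i S. B i x \<and> S \<subseteq> V \<and> card S \<le> 2 \<and>
  (\<forall>f. good f (insert x S) \<longrightarrow> 3 dvd f x - (i - 1)))"
definition FH where "FH x \<longleftrightarrow> (\<exists>i S. B i x \<and> S \<subseteq> V \<and> card S \<le> 2 \<and>
  (\<forall>f. good f (insert x S) \<longrightarrow> 3 dvd f x - (i + 1)))"

lemma triv_no_edge: assumes "triv x" "B i x" "B i y" shows "\<not> E x y"
proof -
  obtain j where j: "B j x" "\<And>y. B j y \<Longrightarrow> \<not> E x y" using assms(1) unfolding triv_def by blast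
  have "B j y" using B_cong[OF assms(3) B_unique[OF assms(2) j(1)]] .
  then show ?thesis using j(2) by blast
qed

text \<open>Otherwise \<open>x\<close>, \<open>y\<close>, \<open>z\<close>,
  \<open>t (i + 2)\<close>, \<open>t i\<close> would be an induced five-cycle.\<close>

lemma two_steps: assumes "step x y" "step y z" shows "E x z"
proof (rule ccontr)
  assume n: "\<not> E x z"
  obtain i where i: "B i x" "B (i + 1) y" "E x y" using assms(1) by (auto simp: step_def)
  obtain j where j: "B j y" "B (j + 1) z" "E y z" using assms(2) by (auto simp: step_def)
  have "3 dvd (j + 1) - (i + 2)" using B_unique[OF j(1) i(2)] by presburger
  then have z: "B (i + 2) z" using B_cong[OF j(2)] by blast
  have "\<not> E x (t (i + 2))" "\<not> E y (t (i + 2))" "\<not> E y (t i)" "\<not> E z (t i)"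
    using B_nb[OF i(1), of "i + 2"] B_nb[OF i(2), of "i + 2"] B_nb[OF i(2), of i] B_nb[OF z, of i] by auto
  moreover have "E (t (i + 2)) (t i)" using icyc_E[OF tri] near3 by auto
  ultimately show False
    using C5_free[OF i(3) j(3) B_t[OF z] _ E_sym[OF B_t[OF i(1)]]] n E_sym by blast
qed

text \<open>In a chain with eight steps \<open>p 0\<close>, \<open>p 2\<close>, \<open>p 4\<close>,
  \<open>p 6\<close>, \<open>p 8\<close> are consecutively adjacent. An edge over four steps would
  be a shortcut, because 4 is 1 modulo 3, and one over six steps would lie inside a class of trivial
  vertices. This is an induced P_5 or five-cycle, so shortest chains have fewer steps and are
  refuted locally.\<close>

lemma no_chain:
  assumes "FL a" "step\<^sup>*\<^sup>* a b" "FH b" shows False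
proof -
  obtain n and p :: "nat \<Rightarrow> 'a" where p: "FL (p 0)" "FH (p n)" "\<And>i. i < n \<Longrightarrow> step (p i) (p (Suc i))"
    "\<And>i j. i < j \<Longrightarrow> j \<le> n \<Longrightarrow> step (p i) (p j) \<Longrightarrow> j = Suc i"
    by (rule shortest_chain[OF assms(2), of "Collect FL" "Collect FH"]) (use assms in auto)
  obtain i0 S0 where S0: "B i0 (p 0)" "S0 \<subseteq> V" "card S0 \<le> 2"
    "\<And>f. good f (insert (p 0) S0) \<Longrightarrow> 3 dvd f (p 0) - (i0 - 1)" using p(1) unfolding FL_def by blast
  obtain i1 S1 where S1: "B i1 (p n)" "S1 \<subseteq> V" "card S1 \<le> 2"
    "\<And>f. good f (insert (p n) S1) \<Longrightarrow> 3 dvd f (p n) - (i1 + 1)" using p(2) unfolding FH_def by blast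
  have pB: "B (i0 + int s) (p s)" if "s \<le> n" for s
    using that
  proof (induction s)
    case (Suc s)
    then obtain j where j: "B j (p s)" "B (j + 1) (p (Suc s))" using p(3)[of s] by (auto simp: step_def)
    have "3 dvd j - (i0 + int s)" using B_unique[OF j(1)] Suc by simp
    then have "3 dvd (j + 1) - (i0 + int (Suc s))" by (simp add: algebra_simps)
    then show ?case using B_cong[OF j(2)] by blast
  qed (use S0(1) in simp)
  have pstep: "E (p s) (p (Suc s))" "triv (p s)" "triv (p (Suc s))" if "s < n" for s
    using p(3)[OF that] by (auto simp: step_def)
  have "n < 8"
  proof (rule ccontr)
    assume "\<not> n < 8"
    then have n: "8 \<le> n" by simp
    have tr: "triv (p s)" if "s \<le> 8" for s
      using pstep(2)[of s] pstep(3)[of 7] that n by (cases "s = 8") auto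
    have e2: "E (p s) (p (s + 2))" if "s \<le> 6" for s
      using two_steps[OF p(3)[of s] p(3)[of "Suc s"]] that n by simp
    have e4: "\<not> E (p s) (p (s + 4))" if "s \<le> 4" for s
    proof
      assume e: "E (p s) (p (s + 4))"
      have "B (i0 + int s + 1) (p (s + 4))" using B_cong[OF pB[of "s + 4"], of "i0 + int s + 1"] that n by simp
      then have "step (p s) (p (s + 4))" using pB[of s] e tr[of s] tr[of "s + 4"] that n unfolding step_def by auto
      then show False using p(4)[of s "s + 4"] that n by simp
    qed
    have e6: "\<not> E (p s) (p (s + 6))" if "s \<le> 2" for s
    proof -
      have "B (i0 + int s) (p (s + 6))" using B_cong[OF pB[of "s + 6"], of "i0 + int s"] that n by simp
      then show ?thesis using triv_no_edge[OF tr pB] that n by simp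
    qed
    have e: "E (p 0) (p 2)" "E (p 2) (p 4)" "E (p 4) (p 6)" "E (p 6) (p 8)"
      using e2[of 0] e2[of 2] e2[of 4] e2[of 6] by (simp_all add: numeral_eq_Suc)
    have ne: "\<not> E (p 0) (p 4)" "\<not> E (p 2) (p 6)" "\<not> E (p 4) (p 8)" "\<not> E (p 0) (p 6)" "\<not> E (p 2) (p 8)"
      using e4[of 0] e4[of 2] e4[of 4] e6[of 0] e6[of 2] by (simp_all add: numeral_eq_Suc)
    show False
    proof (cases "E (p 0) (p 8)")
      case True
      then show False using C5_free[OF e E_sym[OF True]] ne by blast
    next
      case False
      then show False using P5_free[OF e] ne by blast
    qed
  qed
  define S where "S = p ` {..n} \<union> (S0 \<union> S1)"
  have "card (p ` {..n}) \<le> 8" using card_image_le[of "{..n}" p] \<open>n < 8\<close> by simp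
  moreover have "card (S0 \<union> S1) \<le> 4" using card_Un_le[of S0 S1] S0(3) S1(3) by simp
  ultimately have "card S \<le> 40" using card_Un_le[of "p ` {..n}" "S0 \<union> S1"] unfolding S_def by linarith
  moreover have "S \<subseteq> V" using pB B_V S0(2) S1(2) unfolding S_def by blast
  ultimately obtain f where f: "good f S" using local_good by blast
  have low: "3 dvd f (p s) - (i0 + int s - 1)" if "s \<le> n" for s
    using that
  proof (induction s)
    case 0
    have "insert (p 0) S0 \<subseteq> S" by (auto simp: S_def)
    then show ?case using S0(4) good_mono[OF f] by simp
  next
    case (Suc s)
    have m: "p s \<in> S" "p (Suc s) \<in> S" using Suc.prems by (auto simp: S_def)
    have "3 dvd f (p (Suc s)) - (i0 + int s + 1 - 1) \<or> 3 dvd f (p (Suc s)) - (i0 + int s + 1 + 1)"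
      using B_colour[OF f m(2) pB[OF Suc.prems]] by (simp add: algebra_simps)
    moreover have "\<not> 3 dvd f (p s) - f (p (Suc s))" using good_E[OF f m pstep(1)] Suc.prems by simp
    moreover have "3 dvd f (p s) - (i0 + int s - 1)" using Suc by simp
    ultimately have "3 dvd f (p (Suc s)) - (i0 + int s)" by presburger
    then show ?case by (simp add: algebra_simps)
  qed
  have "insert (p n) S1 \<subseteq> S" by (auto simp: S_def)
  then have "3 dvd f (p n) - (i1 + 1)" using S1(4) good_mono[OF f] by blast
  moreover have "3 dvd f (p n) - (i0 + int n - 1)" using low by simp
  moreover have "3 dvd (i0 + int n) - i1" using B_unique[OF pB S1(1)] by simp
  ultimately show False by presburger
qed

definition low where "low x \<longleftrightarrow> (\<exists>a. FL a \<and> step\<^sup>*\<^sup>* a x)"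
definition val where "val i x = (if low x then i - 1 else i + 1)"

text \<open>If no colouring gave \<open>x\<close> the chosen value, \<open>S\<close> would certify
  the opposite one, and \<open>x\<close> would be forced against \<open>low\<close>. So a constraint
  with two further vertices can be checked in an actual colouring.\<close>

lemma val_extends:
  assumes "B i x" "S \<subseteq> V" "card S \<le> 2"
  obtains f where "good f (insert x S)" "3 dvd f x - val i x"
proof -
  have "\<exists>f. good f (insert x S) \<and> 3 dvd f x - val i x"
  proof (rule ccontr)
    assume n: "\<not> ?thesis"
    show False
    proof (cases "low x")
      case True
      have "\<forall>f. good f (insert x S) \<longrightarrow> 3 dvd f x - (i + 1)"
        using n B_colour[OF _ _ assms(1)] True by (auto simp: val_def)
      then have "FH x" unfolding FH_def using assms by blast
      then show False using True no_chain unfolding low_def by blast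
    next
      case False
      have "\<forall>f. good f (insert x S) \<longrightarrow> 3 dvd f x - (i - 1)"
        using n B_colour[OF _ _ assms(1)] False by (auto simp: val_def)
      then have "FL x" unfolding FL_def using assms by blast
      then show False using False unfolding low_def by blast
    qed
  qed
  then show ?thesis using that by blast
qed

lemma val_step:
  assumes "B i x" "B j y" "3 dvd j - i - 1" "E x y" "triv x" "triv y"
  shows "\<not> 3 dvd val i x - val j y"
proof -
  have "B (i + 1) y" using B_cong[OF assms(2), of "i + 1"] assms(3) by (simp add: algebra_simps)
  then have "step x y" using assms by (auto simp: step_def)
  then have "low y \<or> \<not> low x" unfolding low_def by (meson rtranclp.rtrancl_into_rtrancl)
  then consider "low x" "low y" | "\<not> low x" "low y" | "\<not> low x" "\<not> low y" by blast
  then show ?thesis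
  proof cases
    case 1
    have "\<not> 3 dvd (i - 1) - (j - 1)" using assms(3) by presburger
    then show ?thesis using 1 by (simp add: val_def)
  next
    case 2
    have "\<not> 3 dvd (i + 1) - (j - 1)" using assms(3) by presburger
    then show ?thesis using 2 by (simp add: val_def)
  next
    case 3
    have "\<not> 3 dvd (i + 1) - (j + 1)" using assms(3) by presburger
    then show ?thesis using 3 by (simp add: val_def)
  qed
qed

text \<open>Class colourings are chosen for each integer index separately, so congruent indices need
  a common representative.\<close>

definition idx where "idx x = (SOME i. B i x) mod 3"

lemma idx_B: assumes "B i x" shows "B (idx x) x" "idx x = i mod 3"
proof -
  obtain j where j: "B j x" "idx x = j mod 3"
    unfolding idx_def using someI[of "\<lambda>i. B i x", OF assms] by blast
  have "3 dvd j - idx x" unfolding j(2) by (rule dvd_minus_mod)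
  then show "B (idx x) x" by (rule B_cong[OF j(1)])
  show "idx x = i mod 3" unfolding j(2) using B_unique[OF j(1) assms] by (simp only: mod_eq_dvd_iff)
qed

text \<open>Non-trivial vertices of different classes are never adjacent, as their edges would form
  a K_4; so an edge between classes has a trivial end, whose value is backed by a local colouring or
  by the implications.\<close>

lemma dominating_triangle_False: False
proof -
  have "\<forall>i. \<exists>g :: 'a \<Rightarrow> int. (\<forall>x y. B i x \<longrightarrow> B i y \<longrightarrow> E x y \<longrightarrow> \<not> 3 dvd g x - g y) \<and>
    (\<forall>x. g x = i - 1 \<or> g x = i + 1) \<and> (\<forall>u x c. B i u \<longrightarrow> E u x \<longrightarrow> det x c \<longrightarrow> \<not> 3 dvd g u - c)"
  proof
    fix i
    obtain g :: "'a \<Rightarrow> int" where "\<And>x y. B i x \<Longrightarrow> B i y \<Longrightarrow> E x y \<Longrightarrow> \<not> 3 dvd g x - g y"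
      "\<And>x. g x = i - 1 \<or> g x = i + 1" "\<And>u x c. B i u \<Longrightarrow> E u x \<Longrightarrow> det x c \<Longrightarrow> \<not> 3 dvd g u - c"
      by (rule class_colouring[of i]) blast
    then show "\<exists>g :: 'a \<Rightarrow> int. (\<forall>x y. B i x \<longrightarrow> B i y \<longrightarrow> E x y \<longrightarrow> \<not> 3 dvd g x - g y) \<and>
      (\<forall>x. g x = i - 1 \<or> g x = i + 1) \<and> (\<forall>u x c. B i u \<longrightarrow> E u x \<longrightarrow> det x c \<longrightarrow> \<not> 3 dvd g u - c)"
      by (intro exI[of _ g]) simp
  qed
  from choice[OF this] obtain g :: "int \<Rightarrow> 'a \<Rightarrow> int" where "\<forall>i. (\<forall>x y. B i x \<longrightarrow> B i y \<longrightarrow> E x y \<longrightarrow> \<not> 3 dvd g i x - g i y) \<and>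
    (\<forall>x. g i x = i - 1 \<or> g i x = i + 1) \<and> (\<forall>u x c. B i u \<longrightarrow> E u x \<longrightarrow> det x c \<longrightarrow> \<not> 3 dvd g i u - c)" ..
  then have g: "\<And>i x y. B i x \<Longrightarrow> B i y \<Longrightarrow> E x y \<Longrightarrow> \<not> 3 dvd g i x - g i y"
    "\<And>i x. g i x = i - 1 \<or> g i x = i + 1" "\<And>i u x c. B i u \<Longrightarrow> E u x \<Longrightarrow> det x c \<Longrightarrow> \<not> 3 dvd g i u - c"
    by blast+
  define F where "F x = (if \<exists>i. B i x then (if triv x then val (idx x) x else g (idx x) x)
    else (SOME c. det x c))" for x
  have FB: "F x = (if triv x then val (idx x) x else g (idx x) x)" if "B i x" for i x
    using that by (auto simp: F_def)
  have Fdet: "det x (F x)" if "x \<in> V" "\<nexists>i. B i x" for x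
  proof -
    have "det x (SOME c. det x c)" by (rule someI_ex) (use classification that in blast)
    then show ?thesis using that(2) by (simp add: F_def)
  qed
  have Bdet: "\<not> 3 dvd F x - F y" if xy: "B i x" "y \<in> V" "\<nexists>i. B i y" "E x y" for i x y
  proof (cases "triv x")
    case True
    obtain f where f: "good f (insert x {y})" "3 dvd f x - val (idx x) x"
      by (rule val_extends[OF idx_B(1)[OF xy(1)], of "{y}"]) (use xy(2) in auto)
    have "\<not> 3 dvd f x - f y" by (rule good_E[OF f(1) _ _ xy(4)]) simp_all
    moreover have "3 dvd f y - F y" by (rule det_f[OF Fdet[OF xy(2,3)] f(1)]) simp
    moreover have "F x = val (idx x) x" using FB[OF xy(1)] True by simp
    ultimately show ?thesis using f(2) by presburger
  next
    case False
    then show ?thesis using g(3)[OF idx_B(1)[OF xy(1)] xy(4) Fdet[OF xy(2,3)]] FB[OF xy(1)] by simp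
  qed
  \<comment> \<open>\<open>y\<close> sees both ends of an edge in class \<open>i\<close>, whose
    colours are \<open>i - 1\<close> and \<open>i + 1\<close>; so \<open>y\<close> has colour
    \<open>i\<close>, and either possible value of \<open>F x\<close> differs from it.\<close>
  have Btr: "\<not> 3 dvd F x - F y" if xy: "B i x" "B j y" "\<not> 3 dvd j - i" "\<not> triv x" "triv y" "E x y" for i j x y
  proof -
    obtain x' where x': "B i x'" "E x x'" using xy(1,4) unfolding triv_def by blast
    have ij: "\<not> 3 dvd i - j" using xy(3) by presburger
    have yx: "E y x" "E y x'" using edge_complete[OF xy(1) x' xy(2) ij] E_sym[OF xy(6)] by blast+
    have "{x, x'} \<subseteq> V" "card {x, x'} \<le> 2" using B_V xy(1) x'(1) by (auto simp: card_insert_if)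
    then obtain f where f: "good f (insert y {x, x'})" "3 dvd f y - val (idx y) y"
      by (rule val_extends[OF idx_B(1)[OF xy(2)]])
    have "\<not> 3 dvd f x - f x'" "\<not> 3 dvd f y - f x" "\<not> 3 dvd f y - f x'"
      using good_E[OF f(1) _ _ x'(2)] good_E[OF f(1) _ _ yx(1)] good_E[OF f(1) _ _ yx(2)] by simp_all
    moreover have "3 dvd f x - (i - 1) \<or> 3 dvd f x - (i + 1)" by (rule B_colour[OF f(1) _ xy(1)]) simp
    moreover have "3 dvd f x' - (i - 1) \<or> 3 dvd f x' - (i + 1)" by (rule B_colour[OF f(1) _ x'(1)]) simp
    ultimately have "3 dvd f y - i" by presburger
    moreover have "F y = val (idx y) y" using FB[OF xy(2)] xy(5) by simp
    ultimately have "3 dvd F y - i" using f(2) by presburger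
    moreover have "F x = idx x - 1 \<or> F x = idx x + 1" using FB[OF xy(1)] xy(4) g(2) by simp
    moreover have "3 dvd idx x - i" using idx_B(2)[OF xy(1)] by (simp add: mod_eq_dvd_iff[symmetric])
    ultimately show ?thesis by presburger
  qed
  have BB: "\<not> 3 dvd F x - F y" if xy: "B i x" "B j y" "E x y" for i j x y
  proof -
    have b: "B (idx x) x" "B (idx y) y" using idx_B(1) xy by blast+
    have yx: "E y x" using E_sym xy(3) by blast
    show ?thesis
    proof (cases "3 dvd idx y - idx x")
      case True
      have eq: "idx x = idx y"
        using True by (simp add: idx_def mod_eq_dvd_iff[symmetric])
      have By: "B (idx x) y" using b(2) eq by simp
      have "\<not> triv x" "\<not> triv y" using triv_no_edge[OF _ b(1) By] triv_no_edge[OF _ By b(1)] xy(3) yx by blast+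
      then show ?thesis using g(1)[OF b(1) By xy(3)] FB[OF xy(1)] FB[OF xy(2)] eq by simp
    next
      case False
      have False': "\<not> 3 dvd idx x - idx y" using False by presburger
      consider "triv x" "triv y" | "\<not> triv x" "triv y" | "triv x" "\<not> triv y" | "\<not> triv x" "\<not> triv y" by blast
      then show ?thesis
      proof cases
        case 1
        then have F: "F x = val (idx x) x" "F y = val (idx y) y" using FB xy by simp_all
        have "3 dvd idx y - idx x - 1 \<or> 3 dvd idx x - idx y - 1" using False by presburger
        then show ?thesis
        proof
          assume "3 dvd idx y - idx x - 1"
          then show ?thesis using val_step[OF b] xy(3) 1 F by simp
        next
          assume "3 dvd idx x - idx y - 1"
          then have "\<not> 3 dvd F y - F x" using val_step[OF b(2,1)] yx 1 F by simp
          then show ?thesis by presburger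
        qed
      next
        case 2
        then show ?thesis using Btr[OF b False] xy(3) by blast
      next
        case 3
        then have "\<not> 3 dvd F y - F x" using Btr[OF b(2,1) False'] yx by blast
        then show ?thesis by presburger
      next
        case 4
        obtain x' y' where "B (idx x) x'" "E x x'" "B (idx y) y'" "E y y'"
          using 4 b unfolding triv_def by blast
        then show ?thesis using no_edge_edge[OF b(1) _ _ b(2) _ _ False' yx] by blast
      qed
    qed
  qed
  have dd: "\<not> 3 dvd F x - F y" if xy: "x \<in> V" "y \<in> V" "\<nexists>i. B i x" "\<nexists>i. B i y" "E x y" for x y
  proof -
    have "{x, y} \<subseteq> V" "card {x, y} \<le> 40" using xy by (auto simp: card_insert_if)
    then obtain f where f: "good f {x, y}" using local_good by blast
    have "3 dvd f x - F x" by (rule det_f[OF Fdet[OF xy(1,3)] f]) simp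
    moreover have "3 dvd f y - F y" by (rule det_f[OF Fdet[OF xy(2,4)] f]) simp
    moreover have "\<not> 3 dvd f x - f y" by (rule good_E[OF f _ _ xy(5)]) simp_all
    ultimately show ?thesis by presburger
  qed
  have "near 3 (F x) (F y)" if xy: "x \<in> V" "y \<in> V" "E x y" for x y
  proof (cases "\<exists>i. B i x"; cases "\<exists>i. B i y")
    assume "\<exists>i. B i x" "\<exists>i. B i y"
    then show ?thesis using BB xy(3) near3 by blast
  next
    assume "\<exists>i. B i x" "\<nexists>i. B i y"
    then show ?thesis using Bdet xy near3 by blast
  next
    assume "\<nexists>i. B i x" "\<exists>i. B i y"
    then have "near 3 (F y) (F x)" using Bdet xy E_sym near3 by blast
    then show ?thesis by (rule near_sym)
  next
    assume "\<nexists>i. B i x" "\<nexists>i. B i y"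
    then show ?thesis using dd xy near3 by blast
  qed
  then have "hcol 3 V" unfolding hcol_def by blast
  then show False using notcol by blast
qed

end

section \<open>Assembling the cases\<close>

context obstruction5
begin

text \<open>A largest dominating clique has two or three vertices: a single vertex could be joined
  by any other one, and there is no K_4. If it has two, maximality excludes a common
  neighbour.\<close>

lemma obstruction5_False: False
proof -
  define D where "D = {K. clique K \<and> Nbh K = V}"
  have fin: "finite D" unfolding D_def clique_def using finV by (auto intro: finite_subset[of _ "Pow V"])
  obtain K0 where "K0 \<in> D" using dominating_clique by (auto simp: D_def)
  define M where "M = Max (card ` D)"
  have "M \<in> card ` D" unfolding M_def using fin \<open>K0 \<in> D\<close> by (intro Max_in) auto
  then obtain K where K: "K \<in> D" "card K = M" by auto
  have max: "card K' \<le> card K" if "K' \<in> D" for K'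
    unfolding K(2) M_def using fin that by (intro Max_ge) auto
  have cl: "clique K" and dom: "Nbh K = V" using K(1) by (simp_all add: D_def)
  have KV: "K \<subseteq> V" using cl by (simp add: clique_def)
  have finK: "finite K" using KV finV finite_subset by blast
  have maximal: False if "\<And>k. k \<in> K \<Longrightarrow> E x k" "x \<in> V" for x
  proof -
    have "x \<notin> K" using that(1)[of x] E_irrefl by blast
    have "clique (insert x K)" using cl that E_sym unfolding clique_def by auto
    moreover have "Nbh (insert x K) = V"
      using dom Nbh_V[of "insert x K"] that(2) KV unfolding Nbh_def by blast
    ultimately have "insert x K \<in> D" by (simp add: D_def)
    then show False using max[of "insert x K"] \<open>x \<notin> K\<close> finK by simp
  qed
  have dom': "x \<in> K \<or> (\<exists>k\<in>K. E x k)" if "x \<in> V" for x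
    using that dom E_sym unfolding Nbh_def by blast
  obtain a where a: "a \<in> K" using dom V_nonempty by (auto simp: Nbh_def)
  have "K \<noteq> {a}"
  proof
    assume "K = {a}"
    have "V \<noteq> {a}" using big by auto
    then obtain x where "x \<in> V" "x \<noteq> a" using V_nonempty by blast
    then show False using dom'[of x] maximal[of x] \<open>K = {a}\<close> by blast
  qed
  then obtain b where b: "b \<in> K" "b \<noteq> a" using a by blast
  have ab: "E a b" using cliqueD[OF cl a b(1)] b(2) by blast
  show False
  proof (cases "K = {a, b}")
    case True
    show False
    proof (rule no_dominating_edge[OF ab])
      fix x assume x: "E a x" "E b x"
      then show False using maximal[of x] True E_V2[OF x(1)] E_sym by blast
    next
      fix x assume "x \<in> V"
      then show "E a x \<or> E b x" using dom'[of x] True ab E_sym by blast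
    qed
  next
    case False
    then obtain c where c: "c \<in> K" "c \<noteq> a" "c \<noteq> b" using a b by blast
    have e: "E a b" "E a c" "E b c" using ab cliqueD[OF cl] a b c by metis+
    have K3: "K = {a, b, c}"
    proof (rule ccontr)
      assume "K \<noteq> {a, b, c}"
      then obtain d where d: "d \<in> K" "d \<noteq> a" "d \<noteq> b" "d \<noteq> c" using a b c by blast
      have "E a d" "E b d" "E c d" using cliqueD[OF cl _ d(1)] a b c d by metis+
      then show False using no_K4 e by blast
    qed
    define w where "w r = (if r = 0 then a else if r = 1 then b else c)" for r :: int
    have m: "i mod 3 = 0 \<or> i mod 3 = 1 \<or> i mod 3 = 2" for i :: int by presburger
    have ne: "a \<noteq> b" "a \<noteq> c" "b \<noteq> c" using e E_irrefl by blast+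
    have w_eq: "w r = w s \<longleftrightarrow> r = s" and w_E: "E (w r) (w s) \<longleftrightarrow> r \<noteq> s"
      if "r = 0 \<or> r = 1 \<or> r = 2" "s = 0 \<or> s = 1 \<or> s = 2" for r s
      using that e e[THEN E_sym] E_irrefl ne ne[symmetric] by (auto simp: w_def)
    have near3: "near 3 i j \<longleftrightarrow> \<not> 3 dvd i - j" for i j unfolding near_def by presburger
    have wV: "w r \<in> V" for r using a b c KV by (auto simp: w_def)
    have "icyc 3 (\<lambda>i. w (i mod 3))"
      unfolding icyc_def near3 using w_eq[OF m m] w_E[OF m m] wV by (auto simp: mod_eq_dvd_iff)
    moreover have rw: "range (\<lambda>i. w (i mod 3)) = K"
      unfolding K3
    proof
      show "range (\<lambda>i. w (i mod 3)) \<subseteq> {a, b, c}" by (auto simp: w_def)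
      have "w (0 mod 3) = a" "w (1 mod 3) = b" "w (2 mod 3) = c" by (simp_all add: w_def)
      then show "{a, b, c} \<subseteq> range (\<lambda>i. w (i mod 3))" by blast
    qed
    ultimately have "dominating_triangle V E (\<lambda>i. w (i mod 3))"
    proof (intro dominating_triangle.intro dominating_triangle_axioms.intro)
      fix x assume "x \<in> V"
      then have "x \<in> K \<or> (\<exists>k\<in>K. E x k)" by (rule dom')
      then show "x \<in> range (\<lambda>i. w (i mod 3)) \<or> (\<exists>i. E x (w (i mod 3)))"
        unfolding rw[symmetric] by auto
    qed (rule obstruction5_axioms)
    then show False by (rule dominating_triangle.dominating_triangle_False)
  qed
qed

end

context obstruction
begin

lemma obstruction_False: False
proof (cases "k = 5")
  case True
  then have "q = 3" using q_def by simp
  then have "obstruction V E 5 3" using obstruction_axioms True by simp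
  then show False using obstruction5.obstruction5_False obstruction5.intro by blast
next
  case False
  have "\<not> bip V" using bip_hcol notcol by blast
  then obtain n v where v: "odd n" "icyc (int n) v" "\<And>m u. odd m \<Longrightarrow> (adj_in V ^^ m) u u \<Longrightarrow> n \<le> m"
    by (rule shortest_odd_cycle) auto
  have oq: "odd q" and "int n = q \<or> int n = int k" using odd_cycle_cases v(1,2) by blast+
  then show False
  proof (elim disjE)
    assume n: "int n = int k"
    show False by (rule no_long_odd_girth[of v]) (use v n in auto)
  next
    assume n: "int n = q"
    \<comment> \<open>\<open>q = 3\<close> means \<open>k = 5\<close>, which is settled, so an odd
      \<open>q\<close> is now at least 5.\<close>
    have "q \<noteq> 3" "q \<noteq> 4" using False q_def oq by auto
    then have "q \<ge> 5" using q3 by linarith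
    then have "short_cycle V E k q v"
      using oq v(2) n by (intro short_cycle.intro short_cycle_axioms.intro obstruction_axioms) simp_all
    then show False by (rule short_cycle.short_cycle_False)
  qed
qed

end

section \<open>Translation to digraphs\<close>

definition induced_on :: "'a pair_pre_digraph \<Rightarrow> 'a set \<Rightarrow> 'a pair_pre_digraph" where
  "induced_on G S = \<lparr>pverts = S, parcs = {(u, w) \<in> parcs G. u \<in> S \<and> w \<in> S}\<rparr>"

lemma induced_on_simps [simp]: "pverts (induced_on G S) = S"
  "parcs (induced_on G S) = {(u, w) \<in> parcs G. u \<in> S \<and> w \<in> S}"
  by (simp_all add: induced_on_def)

lemma induced_subgraph_induced_on:
  assumes "pair_graph G" "S \<subseteq> pverts G"
  shows "induced_subgraph (with_proj (induced_on G S)) (with_proj G)"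
proof -
  have "wf_digraph (with_proj (induced_on G S))" by unfold_locales auto
  moreover have "wf_digraph (with_proj G)"
    using assms(1) by (simp add: wf_digraph_wp_iff pair_graph_def pair_digraph_def pair_fin_digraph_def)
  ultimately show ?thesis
    using assms(2) unfolding induced_subgraph_def subgraph_def compatible_def by auto
qed

lemma cycle_graph_near:
  assumes "n \<ge> 3" "i < n" "j < n"
  shows "(i, j) \<in> parcs (cycle_graph n) \<longleftrightarrow> near (int n) (int i) (int j)"
proof -
  have s: "a = (b + 1) mod n \<longleftrightarrow> int n dvd int a - int b - 1" if "a < n" for a b
  proof -
    have "a = (b + 1) mod n \<longleftrightarrow> int a mod int n = (int b + 1) mod int n"
      using that by (metis mod_less of_nat_1 of_nat_add of_nat_eq_iff of_nat_mod)
    then show ?thesis by (simp add: mod_eq_dvd_iff algebra_simps)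
  qed
  have "int n dvd int j - int i - 1 \<longleftrightarrow> int n dvd int i - int j + 1"
    using dvd_minus_iff[of "int n" "int i - int j + 1"] by (simp add: algebra_simps)
  then show ?thesis using s[OF assms(2), of j] s[OF assms(3), of i] assms(2,3)
    by (auto simp: cycle_graph_def near_def)
qed

text \<open>Reducing integers modulo \<open>n\<close> yields vertices of the cycle, and adjacency
  survives because \<open>near\<close> respects congruence.\<close>

lemma colorable_cycle_iff:
  fixes H :: "'a pair_pre_digraph"
  assumes "n \<ge> 3" and ends: "\<And>u w. (u, w) \<in> parcs H \<Longrightarrow> u \<in> pverts H \<and> w \<in> pverts H"
  shows "colorable (cycle_graph n) H \<longleftrightarrow>
    (\<exists>f :: 'a \<Rightarrow> int. (\<forall>(u, w) \<in> parcs H. near (int n) (f u) (f w)))"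
proof
  assume "colorable (cycle_graph n) H"
  then obtain c where c: "c ` pverts H \<subseteq> {..<n}" "\<forall>(u, w) \<in> parcs H. (c u, c w) \<in> parcs (cycle_graph n)"
    unfolding colorable_def by (auto simp: cycle_graph_def)
  have "near (int n) (int (c u)) (int (c w))" if "(u, w) \<in> parcs H" for u w
  proof -
    have "c u < n" "c w < n" using c(1) ends[OF that] by auto
    moreover have "(c u, c w) \<in> parcs (cycle_graph n)" using c(2) that by auto
    ultimately show ?thesis using cycle_graph_near[OF assms(1)] by blast
  qed
  then show "\<exists>f :: 'a \<Rightarrow> int. \<forall>(u, w) \<in> parcs H. near (int n) (f u) (f w)" by (intro exI[of _ "\<lambda>u. int (c u)"]) auto
next
  assume "\<exists>f :: 'a \<Rightarrow> int. \<forall>(u, w) \<in> parcs H. near (int n) (f u) (f w)"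
  then obtain f :: "'a \<Rightarrow> int" where f: "\<forall>(u, w) \<in> parcs H. near (int n) (f u) (f w)" by blast
  define c where "c u = nat (f u mod int n)" for u
  have cf: "int (c u) = f u mod int n" "c u < n" for u using assms(1) by (auto simp: c_def nat_less_iff)
  have "(c u, c w) \<in> parcs (cycle_graph n)" if "(u, w) \<in> parcs H" for u w
  proof -
    have "near (int n) (f u) (f w)" using f that by auto
    moreover have "int n dvd f x - int (c x)" for x unfolding cf(1) by (rule dvd_minus_mod)
    ultimately have "near (int n) (int (c u)) (int (c w))" using near_cong by blast
    then show ?thesis using cycle_graph_near[OF assms(1) cf(2) cf(2)] by blast
  qed
  moreover have "c ` pverts H \<subseteq> pverts (cycle_graph n)" using cf(2) by (auto simp: cycle_graph_def)
  ultimately show "colorable (cycle_graph n) H" unfolding colorable_def by blast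
qed

lemma (in ugraph) ipath_nth:
  assumes "ipath xs" "i < j" "j < length xs"
  shows "xs ! i \<noteq> xs ! j \<and> (E (xs ! i) (xs ! j) \<longleftrightarrow> j = Suc i)"
  using assms
proof (induction xs arbitrary: i j)
  case (Cons x xs)
  obtain j' where j: "j = Suc j'" "j' < length xs" using Cons.prems by (cases j) auto
  show ?case
  proof (cases i)
    case 0
    have "x \<noteq> xs ! j'" using Cons.prems(1) j(2) by auto
    moreover have "E x (xs ! j') \<longleftrightarrow> j' = 0"
    proof (cases j')
      case 0
      then show ?thesis using Cons.prems(1) j(2) by (auto simp: hd_conv_nth)
    next
      case (Suc m)
      then have "xs ! j' = tl xs ! m" "m < length (tl xs)" using j(2) by (auto simp: nth_tl)
      then have "xs ! j' \<in> set (tl xs)" by simp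
      then show ?thesis using Cons.prems(1) Suc by simp
    qed
    ultimately show ?thesis using 0 j(1) by simp
  next
    case (Suc i')
    then show ?thesis using Cons.IH[of i' j'] Cons.prems j by simp
  qed
qed simp

lemma induced_path_contained:
  fixes G :: "'a pair_pre_digraph"
  assumes G: "pair_graph G" and len: "length xs = k" and xs: "set xs \<subseteq> pverts G" "distinct xs"
    and E: "\<And>i j. i < j \<Longrightarrow> j < k \<Longrightarrow> (xs ! i, xs ! j) \<in> parcs G \<longleftrightarrow> j = Suc i"
  shows "contains_induced G (path_graph k)"
proof -
  have sym: "(u, w) \<in> parcs G \<Longrightarrow> (w, u) \<in> parcs G" for u w
    using G by (metis pair_graph_def pair_pseudo_graph_def pair_sym_digraph.arcs_symmetric)
  have loop: "(u, u) \<notin> parcs G" for u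
    using pair_loopfree_digraph.pair_no_loops[of G "(u, u)"] G
    by (auto simp: pair_graph_def pair_digraph_def)
  have E': "(xs ! i, xs ! j) \<in> parcs G \<longleftrightarrow> j = Suc i \<or> i = Suc j" if "i < k" "j < k" for i j
    using E[of i j] E[of j i] that sym[of "xs ! i" "xs ! j"] sym[of "xs ! j" "xs ! i"] loop[of "xs ! i"]
    by (cases i j rule: linorder_cases) auto
  define H where "H = induced_on G (set xs)"
  define h where "h = \<lparr>iso_verts = (\<lambda>i. xs ! i), iso_arcs = (\<lambda>(i, j). (xs ! i, xs ! j)),
    iso_head = snd, iso_tail = fst\<rparr>"
  have inj: "inj_on ((!) xs) {..<k}" using xs(2) len by (auto intro: inj_on_nth)
  have arcs: "parcs H = (\<lambda>(i, j). (xs ! i, xs ! j)) ` parcs (path_graph k)"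
  proof (intro equalityI subsetI)
    fix e assume "e \<in> parcs H"
    then obtain u w where e: "e = (u, w)" "(u, w) \<in> parcs G" "u \<in> set xs" "w \<in> set xs" by (auto simp: H_def)
    then obtain i j where "u = xs ! i" "w = xs ! j" "i < k" "j < k" using len by (auto simp: in_set_conv_nth)
    then show "e \<in> (\<lambda>(i, j). (xs ! i, xs ! j)) ` parcs (path_graph k)"
      using e E'[of i j] by (auto simp: path_graph_def intro!: image_eqI[of _ _ "(i, j)"])
  next
    fix e assume "e \<in> (\<lambda>(i, j). (xs ! i, xs ! j)) ` parcs (path_graph k)"
    then obtain i j where ij: "e = (xs ! i, xs ! j)" "(i, j) \<in> parcs (path_graph k)" by auto
    then have "i < k" "j < k" "j = Suc i \<or> i = Suc j" by (auto simp: path_graph_def)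
    then show "e \<in> parcs H" using ij(1) E'[of i j] len by (auto simp: H_def)
  qed
  have "pre_digraph.digraph_isomorphism (with_proj (path_graph k)) h"
    unfolding pre_digraph.digraph_isomorphism_def
  proof (intro conjI)
    show "wf_digraph (with_proj (path_graph k))" by unfold_locales (auto simp: path_graph_def)
    show "inj_on (iso_verts h) (verts (with_proj (path_graph k)))"
      using inj by (simp add: h_def path_graph_def)
    show "inj_on (iso_arcs h) (arcs (with_proj (path_graph k)))"
    proof (rule inj_onI)
      fix a b assume ab: "a \<in> arcs (with_proj (path_graph k))" "b \<in> arcs (with_proj (path_graph k))"
        "iso_arcs h a = iso_arcs h b"
      obtain i j i' j' where [simp]: "a = (i, j)" "b = (i', j')" by (cases a; cases b) auto
      have "i < k" "j < k" "i' < k" "j' < k" using ab by (auto simp: path_graph_def)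
      moreover have "xs ! i = xs ! i'" "xs ! j = xs ! j'" using ab(3) by (simp_all add: h_def)
      ultimately show "a = b" using inj by (auto dest: inj_onD)
    qed
  qed (auto simp: h_def)
  moreover have "with_proj H = app_iso h (with_proj (path_graph k))"
  proof -
    have "set xs = (!) xs ` {..<k}" using len by (auto simp: in_set_conv_nth)
    then show ?thesis
      unfolding app_iso_def with_proj_def arcs by (simp add: h_def H_def path_graph_def)
  qed
  ultimately have "digraph_iso (with_proj (path_graph k)) (with_proj H)" unfolding digraph_iso_def by blast
  moreover have "induced_subgraph (with_proj H) (with_proj G)"
    unfolding H_def using induced_subgraph_induced_on G xs(1) by blast
  ultimately show ?thesis unfolding contains_induced_def by blast
qed

theorem theorem2:
  fixes k :: nat and G :: "'a pair_pre_digraph"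
  assumes "k > 4"
    and "pair_graph G"
    and "\<not> contains_induced G (path_graph k)"
    and "\<not> colorable (cycle_graph (k - 2)) G"
    and "\<And>H :: 'a pair_pre_digraph.
           induced_subgraph (with_proj H) (with_proj G) \<Longrightarrow> H \<noteq> G \<Longrightarrow>
           colorable (cycle_graph (k - 2)) H"
  shows "card (pverts G) \<le> 3 * k + 28"
proof (rule ccontr)
  assume "\<not> card (pverts G) \<le> 3 * k + 28"
  then have big: "3 * k + 28 < card (pverts G)" by simp
  define E where "E u w \<longleftrightarrow> (u, w) \<in> parcs G" for u w
  have ends: "u \<in> pverts G \<and> w \<in> pverts G" if "(u, w) \<in> parcs G" for u w
    using assms(2) that pair_wf_digraph.arc_fst_in_verts[of G "(u, w)"] pair_wf_digraph.arc_snd_in_verts[of G "(u, w)"]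
    by (simp add: pair_graph_def pair_digraph_def pair_fin_digraph_def)
  interpret ugraph "pverts G" E
  proof
    show "finite (pverts G)"
      using assms(2) pair_fin_digraph.pair_finite_verts by (auto simp: pair_graph_def pair_digraph_def)
    show "E x y \<Longrightarrow> E y x" for x y
      using assms(2) unfolding E_def by (metis pair_graph_def pair_pseudo_graph_def pair_sym_digraph.arcs_symmetric)
    show "\<not> E x x" for x
      using pair_loopfree_digraph.pair_no_loops[of G "(x, x)"] assms(2)
      unfolding E_def by (auto simp: pair_graph_def pair_digraph_def)
    show "E x y \<Longrightarrow> x \<in> pverts G" for x y using ends unfolding E_def by blast
  qed
  have n3: "k - 2 \<ge> 3" and q: "int (k - 2) = int k - 2" using assms(1) by auto
  have col: "colorable (cycle_graph (k - 2)) (induced_on G S) \<longleftrightarrow> hcol (int k - 2) S" for S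
    using colorable_cycle_iff[OF n3, of "induced_on G S"] unfolding q hcol_def E_def by auto
  \<comment> \<open>Makes the hypothesis on \<open>G\<close> itself an instance of
    \<open>col\<close>.\<close>
  have whole: "induced_on G (pverts G) = G" using ends by (auto simp: induced_on_def intro!: pair_pre_digraph.equality)
  have "obstruction (pverts G) E k (int k - 2)"
  proof
    show "length xs \<noteq> k" if "ipath xs" for xs
    proof
      assume "length xs = k"
      moreover have "set xs \<subseteq> pverts G" using that by (induction xs) auto
      moreover have "distinct xs" using that by (induction xs) auto
      ultimately have "contains_induced G (path_graph k)"
        using induced_path_contained[OF assms(2)] ipath_nth[OF that] unfolding E_def by blast
      then show False using assms(3) by blast
    qed
    show "\<not> hcol (int k - 2) (pverts G)" using assms(4) col[of "pverts G"] whole by simp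
    show "hcol (int k - 2) S" if "S \<subset> pverts G" for S
    proof -
      have "induced_on G S \<noteq> G" using that by (metis induced_on_simps(1) psubset_eq)
      then show ?thesis
        using assms(5)[OF induced_subgraph_induced_on[OF assms(2)]] that col by blast
    qed
  qed (use assms(1) big in auto)
  then show False by (rule obstruction.obstruction_False)
qed

end
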